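(* The following conditions are equivalent: (a) $F_{\mathfrak c}$ admits a minimal pseudocompact group topology; (b) $F_{\mathfrak c}$ admits a connected minimal pseudocompact group topology; (c) $F_{\mathfrak c}$ admits a zero-dimensional minimal pseudocompact group topology; (d) Lusin's Hypothesis $2^{\omega_1}=\mathfrak c$ holds.
   Context: $\mathfrak c=2^\omega$, and $F_{\mathfrak c}$ denotes the free abelian group with $\mathfrak c$ many generators. All group topologies are assumed Hausdorff. A Hausdorff group topology $\tau$ on a group $G$ is minimal if every Hausdorff group topology $\tau'\subseteq\tau$ on $G$ satisfies $\tau'=\tau$. A topological group is pseudocompact if every continuous real-valued function on it is bounded. A topology is zero-dimensional if it has a base of clopen sets. In each of (a)-(c) a single topology has all the listed properties. *)

theory Defs
  imports "HOL-Analysis.Analysis" "HOL-Algebra.Free_Abelian_Groups"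
begin

unbundle cardinal_syntax

text \<open>All group topologies are Hausdorff by convention, so this is part of the definition.\<close>

definition group_topology :: "('a, 'm) monoid_scheme \<Rightarrow> 'a topology \<Rightarrow> bool" where
  "group_topology G T \<longleftrightarrow>
     topspace T = carrier G \<and>
     Hausdorff_space T \<and>
     continuous_map (prod_topology T T) T (\<lambda>(x, y). x \<otimes>\<^bsub>G\<^esub> y) \<and>
     continuous_map T T (\<lambda>x. inv\<^bsub>G\<^esub> x)"

definition minimal_group_topology :: "('a, 'm) monoid_scheme \<Rightarrow> 'a topology \<Rightarrow> bool" where
  "minimal_group_topology G T \<longleftrightarrow>
     group_topology G T \<and>
     (\<forall>T'. group_topology G T' \<and> (\<forall>U. openin T' U \<longrightarrow> openin T U) \<longrightarrow> T' = T)"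

definition pseudocompact_space :: "'a topology \<Rightarrow> bool" where
  "pseudocompact_space T \<longleftrightarrow>
     (\<forall>f. continuous_map T euclideanreal f \<longrightarrow> bounded (f ` topspace T))"

definition zero_dimensional_space :: "'a topology \<Rightarrow> bool" where
  "zero_dimensional_space T \<longleftrightarrow>
     (\<exists>B. (\<forall>U\<in>B. openin T U \<and> closedin T U) \<and>
          openin T = arbitrary union_of (\<lambda>U. U \<in> B))"

text \<open>
  Cardinals are represented by well-order relations up to \<open>=o\<close>:
  \<open>natLeq\<close> is $\omega$, its cardinal successor \<open>cardSuc natLeq\<close> is $\omega_1$,
  and \<open>ctwo\<close> is the cardinal 2.
\<close>

definition continuum :: "(nat \<Rightarrow> bool) rel" where
  "continuum = ctwo ^c natLeq"

definition Lusin_hypothesis :: bool where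
  "Lusin_hypothesis \<longleftrightarrow> ctwo ^c (cardSuc natLeq) =o continuum"

end

theory Submission
  imports Defs "HOL-Library.Function_Algebras" "HOL-Computational_Algebra.Primes"
begin

text \<open>
  Assume Lusin's Hypothesis and let \<open>X\<close> be a solenoid (or a fibre of it over a point, which is zero-dimensional). The
  compact torsion-free group \<open>X^omega_1\<close> has at most \<open>2^omega_1 = c\<close> closed subsets, so a transfinite recursion picks in
  each closed subset of size at least \<open>c\<close> a point independent of the previous ones. The free group generated by these
  points meets every such set. Nontrivial closed subgroups, slices and subproducts over cocountable sets are that large,
  which makes the free group minimal, connected (for the solenoid) and pseudocompact.

  Conversely, a pseudocompact group topology is precompact, so its continuous characters separate points, and minimality
  says that no proper subgroup of the character group \<open>A\<close> separates points. As the group is torsion-free, \<open>A\<close> is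
  divisible, and a nonzero homomorphism \<open>x\<close> from \<open>A\<close> to a quasicyclic group does not have a separating kernel; so there
  is \<open>g \<noteq> 0\<close> such that \<open>a \<mapsto> a g\<close> factors through \<open>x\<close>, and the pair of \<open>g\<close> and the factor determines \<open>x\<close>. Hence there
  are at most \<open>c\<close> such homomorphisms. On the other hand \<open>A\<close> is uncountable, because otherwise the group would be
  compact and metrizable, hence divisible by 2. So for some prime \<open>p\<close> it has an uncountable subset independent modulo \<open>p\<close>, and every function from this set to
  the elements of order \<open>p\<close> extends to a homomorphism. This gives \<open>2^omega_1 \<le> c\<close>.
\<close>

section \<open>Integer multiples and the circle group\<close>

text \<open>Classically one works in the compact completion of the group: Haar measure on it yields
  the characters, and a dense subgroup of a compact group is minimal iff it meets every nontrivial
  closed subgroup. Neither the completion nor Haar measure is formed here. Characters come from an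
  invariant mean on the discrete group and from extreme positive definite functions. In the converse
  direction the points of the completion are represented by homomorphisms from \<open>A\<close> to
  the circle. Values in a quasicyclic group are imposed because the annihilator of the kernel of
  such a nonzero \<open>x\<close> is a copy of the \<open>p\<close>-adic integers, a closed subgroup
  that the group must meet; the element \<open>g\<close> is a point of this intersection. In the
  construction, \<open>X\<close> has to be torsion-free because a free group cannot meet a finite
  subgroup nontrivially. Torsion-freeness also makes nontrivial closed subgroups perfect, which is
  where their size comes from.\<close>

definition zs :: "int \<Rightarrow> 'a::ab_group_add \<Rightarrow> 'a" where
  "zs n x = (if 0 \<le> n then ((+) x ^^ nat n) 0 else - (((+) x ^^ nat (- n)) 0))"

lemma zs_0 [simp]: "zs 0 x = 0"
  by (simp add: zs_def)

lemma zs_Suc: "zs (n + 1) x = zs n x + x"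
proof (cases "0 \<le> n")
  case True
  then have "nat (n + 1) = Suc (nat n)" by simp
  with True show ?thesis by (simp add: zs_def add.commute)
next
  case False
  then have "nat (- n) = Suc (nat (- (n + 1)))" by simp
  with False show ?thesis by (auto simp: zs_def)
qed

lemma zs_pred: "zs (n - 1) x = zs n x - x"
  using zs_Suc[of "n - 1" x] by simp

lemma zs_1 [simp]: "zs 1 x = x"
  using zs_Suc[of 0 x] by simp

lemma zs_add_left: "zs (m + n) x = zs m x + zs n x"
proof (induction n rule: int_induct[where k = 0])
  case (step1 i)
  then show ?case using zs_Suc[of "m + i" x] zs_Suc[of i x] by (simp add: add.assoc)
next
  case (step2 i)
  have "zs (m + (i - 1)) x = zs (m + i) x - x"
    using zs_pred[of "m + i" x] by (simp add: add_diff_eq)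
  with step2 show ?case by (simp add: zs_pred add_diff_eq)
qed simp

lemma zs_additive:
  fixes f :: "'a::ab_group_add \<Rightarrow> 'b::ab_group_add"
  assumes "Modules.additive f"
  shows "f (zs n x) = zs n (f x)"
proof -
  interpret Modules.additive f by fact
  show ?thesis
  proof (induction n rule: int_induct[where k = 0])
    case base
    then show ?case by (simp add: zero)
  next
    case (step1 i)
    then show ?case by (simp add: zs_Suc add)
  next
    case (step2 i)
    then show ?case by (simp add: zs_pred diff)
  qed
qed

lemma zs_add_right: "zs n (x + y) = zs n x + zs n y"
  by (induction n rule: int_induct[where k = 0]) (simp_all add: zs_Suc zs_pred algebra_simps)

lemma zs_int [simp]: "zs n (m::int) = n * m"
  by (induction n rule: int_induct[where k = 0]) (simp_all add: zs_Suc zs_pred algebra_simps)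

lemma zs_zs: "zs m (zs n x) = zs (m * n) x"
proof (induction m rule: int_induct[where k = 0])
  case (step1 i)
  have "zs ((i + 1) * n) x = zs (i * n) x + zs n x"
    using zs_add_left[of "i * n" n x] by (simp add: distrib_right)
  with step1 show ?case by (simp add: zs_Suc)
next
  case (step2 i)
  have "zs ((i - 1) * n) x + zs n x = zs (i * n) x"
    using zs_add_left[of "(i - 1) * n" n x] by (simp add: left_diff_distrib)
  with step2 show ?case unfolding zs_pred by (metis add_diff_cancel_right')
qed simp

text \<open>Abelian groups as modules over the integers: \<open>zm.span\<close> is then the
  generated subgroup, and the scaling laws come with the interpretation.\<close>

interpretation zm: module "zs :: int \<Rightarrow> 'a::ab_group_add \<Rightarrow> 'a"
  by unfold_locales (simp_all add: zs_add_left zs_add_right zs_zs)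

lemma zs_fun: "zs n f x = zs n (f x)"
  using zs_additive[of "\<lambda>f. f x" n f] by (simp add: Modules.additive_def)

lemma lookup_zs: "Poly_Mapping.lookup (zs n f) k = n * Poly_Mapping.lookup f k"
  for f :: "'a \<Rightarrow>\<^sub>0 int"
  using zs_additive[of "\<lambda>f. Poly_Mapping.lookup f k" n f] by (simp add: Modules.additive_def lookup_add)

text \<open>Additive notation for the unit circle puts it in class \<open>ab_group_add\<close> with
  all other groups here, so that a character is simply a map satisfying
  \<open>Modules.additive\<close>.\<close>

typedef circle = "{z::complex. norm z = 1}"
  morphisms cval Circ by (rule exI[of _ 1]) simp

setup_lifting type_definition_circle

instantiation circle :: ab_group_add
begin
lift_definition zero_circle :: circle is 1 by simp
lift_definition plus_circle :: "circle \<Rightarrow> circle \<Rightarrow> circle" is "(*)" by (simp add: norm_mult)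
lift_definition uminus_circle :: "circle \<Rightarrow> circle" is inverse by (simp add: norm_inverse)
lift_definition minus_circle :: "circle \<Rightarrow> circle \<Rightarrow> circle" is "(/)" by (simp add: norm_divide)
instance
proof
  fix a b c :: circle
  show "a + b + c = a + (b + c)" by transfer (rule mult.assoc)
  show "a + b = b + a" by transfer (rule mult.commute)
  show "0 + a = a" by transfer simp
  show "- a + a = 0" by transfer (metis left_inverse norm_zero zero_neq_one)
  show "a - b = a + - b" by transfer (rule divide_inverse)
qed
end

lemma norm_cval [simp]: "norm (cval x) = 1"
  using cval[of x] by simp

lemma cval_nonzero [simp]: "cval x \<noteq> 0"
  using norm_cval[of x] by force

lemma cval_0 [simp]: "cval 0 = 1" by transfer simp
lemma cval_add: "cval (x + y) = cval x * cval y" by transfer simp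
lemma cval_minus: "cval (- x) = cnj (cval x)"
proof transfer
  fix z :: complex assume "norm z = 1"
  then have "z * cnj z = 1" by (simp add: complex_norm_square[symmetric])
  then show "inverse z = cnj z" by (rule inverse_unique)
qed
lemma cval_diff: "cval (x - y) = cval x * cnj (cval y)"
  using cval_add[of x "- y"] by (simp add: cval_minus)
lemma cval_inject_iff: "cval x = cval y \<longleftrightarrow> x = y" by (simp add: cval_inject)

lemma cval_eq_1 [simp]: "cval x = 1 \<longleftrightarrow> x = 0"
  by transfer simp

lemma cval_zs: "cval (zs n x) = cval x powi n"
proof (induction n rule: int_induct[where k = 0])
  case (step1 i)
  then show ?case by (simp add: zs_Suc cval_add power_int_add)
next
  case (step2 i)
  have "zs (i - 1) x + x = zs i x" by (simp add: zs_pred)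
  then have "cval (zs (i - 1) x) * cval x = cval x powi i" using step2 by (metis cval_add)
  then show ?case by (simp add: power_int_diff eq_divide_eq)
qed simp

instantiation circle :: metric_space
begin
lift_definition dist_circle :: "circle \<Rightarrow> circle \<Rightarrow> real" is dist .
definition uniformity_circle :: "(circle \<times> circle) filter"
  where "uniformity_circle = (INF e\<in>{0<..}. principal {(x, y). dist x y < e})"
definition open_circle :: "circle set \<Rightarrow> bool"
  where "open_circle U \<longleftrightarrow> (\<forall>x\<in>U. eventually (\<lambda>(x', y). x' = x \<longrightarrow> y \<in> U) uniformity)"
instance
proof
  show "\<And>x y::circle. (dist x y = 0) = (x = y)" by transfer simp
  show "\<And>x y z::circle. dist x y \<le> dist x z + dist y z" by transfer (rule dist_triangle2)
qed (simp_all add: uniformity_circle_def open_circle_def)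
end

lemma dist_cval: "dist x y = norm (cval x - cval y)"
  by transfer (simp add: dist_norm)

lemma dist_circle_add_right [simp]: "dist (x + z) (y + z) = dist x (y::circle)"
  by (simp add: dist_cval cval_add norm_mult flip: left_diff_distrib)

lemma dist_circle_minus [simp]: "dist (- x) (- y) = dist x (y::circle)"
  by (simp add: dist_cval cval_minus norm_mult flip: complex_cnj_diff)

lemma dist_circle_add: "dist (x + y) (x' + y') \<le> dist x x' + dist y (y'::circle)"
proof -
  have "dist (x' + y) (x' + y') = dist y y'"
    using dist_circle_add_right[of y x' y'] by (simp add: add.commute)
  then show ?thesis
    using dist_triangle[of "x + y" "x' + y'" "x' + y"] by simp
qed

lemma continuous_on_cval: "continuous_on A cval"
  unfolding continuous_on_iff by (auto simp: dist_cval dist_norm)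

lemma tendsto_nhds_if_continuous:
  assumes "continuous_on UNIV f"
  shows "(f \<longlongrightarrow> f x) (nhds x)"
  unfolding tendsto_def eventually_nhds
  using assms by (metis open_vimage vimageE vimageI2)

instance circle :: topological_ab_group_add
proof
  fix a b :: circle
  have "continuous_on UNIV (\<lambda>p::circle \<times> circle. fst p + snd p)"
    unfolding continuous_on_iff
  proof (intro ballI allI impI)
    fix p :: "circle \<times> circle" and e :: real assume "0 < e"
    show "\<exists>d>0. \<forall>p'\<in>UNIV. dist p' p < d \<longrightarrow> dist (fst p' + snd p') (fst p + snd p) < e"
    proof (intro exI[of _ "e/2"] conjI ballI impI)
      fix p' assume "dist p' p < e/2"
      then have "dist (fst p') (fst p) < e/2" "dist (snd p') (snd p) < e/2"
        using dist_fst_le[of p' p] dist_snd_le[of p' p] by auto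
      then show "dist (fst p' + snd p') (fst p + snd p) < e"
        using dist_circle_add[of "fst p'" "snd p'" "fst p" "snd p"] by linarith
    qed (use \<open>0 < e\<close> in simp)
  qed
  then show "((\<lambda>x. fst x + snd x) \<longlongrightarrow> a + b) (nhds a \<times>\<^sub>F nhds b)"
    using tendsto_nhds_if_continuous[of "\<lambda>p. fst p + snd p" "(a, b)"] by (simp add: nhds_prod)
next
  fix a :: circle
  show "(uminus \<longlongrightarrow> - a) (nhds a)"
    unfolding tendsto_iff by (auto simp: eventually_nhds_metric)
qed

lemma compact_UNIV_circle: "compact (UNIV :: circle set)"
proof -
  have cont: "continuous_on (sphere 0 1) Circ"
    unfolding continuous_on_iff
  proof (intro ballI allI impI)
    fix x :: complex and e :: real assume x: "x \<in> sphere 0 1" and "0 < e"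
    have "dist (Circ y) (Circ x) = dist y x" if "y \<in> sphere 0 1" for y
      using x that by (simp add: dist_cval Circ_inverse dist_norm)
    then show "\<exists>d>0. \<forall>y\<in>sphere 0 1. dist y x < d \<longrightarrow> dist (Circ y) (Circ x) < e"
      using \<open>0 < e\<close> by auto
  qed
  have "c \<in> Circ ` sphere 0 1" for c
    by (rule image_eqI[of _ _ "cval c"]) (simp_all add: cval_inverse)
  then have "Circ ` sphere 0 1 = UNIV" by blast
  then show ?thesis
    using compact_continuous_image[OF cont compact_sphere] by simp
qed

instance circle :: second_countable_topology
proof
  obtain B :: "complex set set" where B: "countable B" "topological_basis B"
    using ex_countable_basis by blast
  have "topological_basis ((\<lambda>U. cval -` U) ` B)"
    unfolding topological_basis_def
  proof safe
    fix U assume "U \<in> B"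
    then show "open (cval -` U)"
      using B(2) continuous_on_cval[of UNIV] by (metis open_vimage topological_basis_open)
  next
    fix S :: "circle set" assume "open S"
    let ?B = "(\<lambda>U. cval -` U) ` {U \<in> B. cval -` U \<subseteq> S}"
    have "x \<in> \<Union>?B" if x: "x \<in> S" for x
    proof -
      obtain e where e: "e > 0" "\<And>y. dist y x < e \<Longrightarrow> y \<in> S"
        using \<open>open S\<close> x unfolding open_dist by blast
      obtain U where "U \<in> B" "cval x \<in> U" "U \<subseteq> ball (cval x) e"
        using topological_basisE[OF B(2), of "ball (cval x) e" "cval x"] e(1) by auto
      then show ?thesis using e(2) by (force simp: dist_cval dist_norm norm_minus_commute)
    qed
    then show "\<exists>B'\<subseteq>(\<lambda>U. cval -` U) ` B. \<Union> B' = S"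
      by (intro exI[of _ ?B]) auto
  qed
  with B(1) show "\<exists>B::circle set set. countable B \<and> open = generate_topology B"
    by (metis countable_image topological_basis_imp_subbasis)
qed

text \<open>One instance serves \<open>nat \<Rightarrow> circle\<close>, its powers, and the product
  into which a group is mapped by its characters.\<close>

instance "fun" :: (type, topological_ab_group_add) topological_ab_group_add
proof
  fix a b :: "'a \<Rightarrow> 'b"
  have "continuous_on UNIV (\<lambda>p::('a \<Rightarrow> 'b) \<times> ('a \<Rightarrow> 'b). fst p + snd p)"
  proof (rule continuous_on_coordinatewise_then_product)
    fix i
    have "continuous_on UNIV (\<lambda>p::('a \<Rightarrow> 'b) \<times> ('a \<Rightarrow> 'b). fst p i)"
      "continuous_on UNIV (\<lambda>p::('a \<Rightarrow> 'b) \<times> ('a \<Rightarrow> 'b). snd p i)"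
      by (rule continuous_on_product_then_coordinatewise, intro continuous_intros)+
    then show "continuous_on UNIV (\<lambda>p::('a \<Rightarrow> 'b) \<times> ('a \<Rightarrow> 'b). (fst p + snd p) i)"
      by (simp add: continuous_on_add)
  qed
  then show "((\<lambda>x. fst x + snd x) \<longlongrightarrow> a + b) (nhds a \<times>\<^sub>F nhds b)"
    using tendsto_nhds_if_continuous[of "\<lambda>p. fst p + snd p" "(a, b)"] by (simp add: nhds_prod)
next
  fix a :: "'a \<Rightarrow> 'b"
  have "continuous_on UNIV (\<lambda>p::'a \<Rightarrow> 'b. - p)"
  proof (rule continuous_on_coordinatewise_then_product)
    fix i
    have "continuous_on UNIV (\<lambda>p::'a \<Rightarrow> 'b. p i)"
      by (rule continuous_on_product_then_coordinatewise, rule continuous_on_id)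
    moreover have "continuous_on UNIV (uminus :: 'b \<Rightarrow> 'b)"
      unfolding continuous_on_def by (auto intro: tendsto_minus tendsto_ident_at)
    ultimately show "continuous_on UNIV (\<lambda>p::'a \<Rightarrow> 'b. (- p) i)"
      using continuous_on_compose2[of UNIV uminus UNIV "\<lambda>p. p i"] by (simp add: fun_Compl_def)
  qed
  then show "(uminus \<longlongrightarrow> - a) (nhds a)"
    by (rule tendsto_nhds_if_continuous)
qed

section \<open>Invariant means\<close>

definition invariant_mean :: "(('g::ab_group_add \<Rightarrow> real) \<Rightarrow> real) \<Rightarrow> bool" where
  "invariant_mean M \<longleftrightarrow>
     (\<forall>f g. bounded (range f) \<longrightarrow> bounded (range g) \<longrightarrow> M (\<lambda>x. f x + g x) = M f + M g) \<and>
     (\<forall>c f. bounded (range f) \<longrightarrow> M (\<lambda>x. c * f x) = c * M f) \<and>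
     (\<forall>f. bounded (range f) \<longrightarrow> (\<forall>x. 0 \<le> f x) \<longrightarrow> 0 \<le> M f) \<and>
     M (\<lambda>_. 1) = 1 \<and>
     (\<forall>f h. bounded (range f) \<longrightarrow> M (\<lambda>x. f (x + h)) = M f)"

text \<open>Stated for all functions, bounded or not: a finite average of point evaluations is
  linear everywhere, so the finite stage carries no boundedness conditions.\<close>

definition mean_functional :: "(('g \<Rightarrow> real) \<Rightarrow> real) \<Rightarrow> bool" where
  "mean_functional m \<longleftrightarrow> (\<forall>f g. m (\<lambda>x. f x + g x) = m f + m g) \<and> (\<forall>c f. m (\<lambda>x. c * f x) = c * m f) \<and>
     (\<forall>f. (\<forall>x. 0 \<le> f x) \<longrightarrow> 0 \<le> m f) \<and> m (\<lambda>_. 1) = 1"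

lemma mean_functional_abs_le:
  assumes m: "mean_functional m" and C: "\<And>x. \<bar>f x\<bar> \<le> C"
  shows "\<bar>m f\<bar> \<le> C"
proof -
  have lin: "\<And>f g. m (\<lambda>x. f x + g x) = m f + m g" "\<And>c f. m (\<lambda>x. c * f x) = c * m f"
    and pos: "\<And>f. (\<And>x. 0 \<le> f x) \<Longrightarrow> 0 \<le> m f" and one: "m (\<lambda>_. 1) = 1"
    using m unfolding mean_functional_def by auto
  have const: "m (\<lambda>_. C) = C" using lin(2)[of C "\<lambda>_. 1"] one by simp
  have "0 \<le> m (\<lambda>x. C + f x)" "0 \<le> m (\<lambda>x. C + (- 1) * f x)"
    using C by (intro pos; smt (verit))+
  then have "0 \<le> C + m f" "0 \<le> C + (- 1) * m f"
    using const lin(1)[of "\<lambda>_. C" f] lin(1)[of "\<lambda>_. C" "\<lambda>x. (- 1) * f x"] lin(2)[of "- 1" f] by auto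
  then show ?thesis by auto
qed

text \<open>Averaging first over \<open>N\<close> consecutive multiples of \<open>h\<close> makes a
  functional almost invariant under \<open>h\<close>, because a shift by \<open>h\<close> telescopes
  to the two end terms, at most \<open>2 * C / N\<close>. Near-invariance under the earlier elements
  survives, as averaging commutes with translations in an abelian group.\<close>

lemma almost_invariant_mean:
  fixes H :: "'g::ab_group_add set" and e :: real
  assumes "finite H" "e > 0"
  shows "\<exists>m. mean_functional m \<and>
    (\<forall>h\<in>H. \<forall>f C. (\<forall>x. \<bar>f x\<bar> \<le> C) \<longrightarrow> \<bar>m (\<lambda>x. f (x + h)) - m f\<bar> \<le> e * C)"
  using assms(1)
proof (induction H rule: finite_induct)
  case empty
  show ?case by (rule exI[of _ "\<lambda>f. f 0"]) (simp add: mean_functional_def)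
next
  case (insert h H)
  then obtain m where m: "mean_functional m"
    and inv: "\<And>h f C. h \<in> H \<Longrightarrow> (\<And>x. \<bar>f x\<bar> \<le> C) \<Longrightarrow> \<bar>m (\<lambda>x. f (x + h)) - m f\<bar> \<le> e * C"
    by blast
  have lin: "\<And>f g. m (\<lambda>x. f x + g x) = m f + m g" "\<And>c f. m (\<lambda>x. c * f x) = c * m f"
    and pos: "\<And>f. (\<And>x. 0 \<le> f x) \<Longrightarrow> 0 \<le> m f" and one: "m (\<lambda>_. 1) = 1"
    using m unfolding mean_functional_def by auto
  obtain N :: nat where N: "N > 0" "2 / real N \<le> e"
  proof -
    obtain N :: nat where "2 / e < real N" using reals_Archimedean2 by blast
    moreover have "0 < 2 / e" using assms(2) by simp
    ultimately have "0 < real N" "2 < e * real N" using assms(2) by (linarith, simp add: field_simps)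
    then show ?thesis using that[of N] by (simp add: divide_le_eq)
  qed
  define A where "A f x = (1 / real N) * (\<Sum>i<N. f (x + zs (int i) h))" for f :: "'g \<Rightarrow> real" and x
  have Abd: "\<bar>A f x\<bar> \<le> C" if "\<And>x. \<bar>f x\<bar> \<le> C" for f C x
  proof -
    have "\<bar>\<Sum>i<N. f (x + zs (int i) h)\<bar> \<le> (\<Sum>i<N. C)"
      by (rule order_trans[OF sum_abs]) (intro sum_mono that)
    then show ?thesis using N(1) by (simp add: A_def abs_mult divide_le_eq mult.commute)
  qed
  have "mean_functional (\<lambda>f. m (A f))"
    unfolding mean_functional_def
  proof (intro conjI allI impI)
    fix f g :: "'g \<Rightarrow> real"
    have "A (\<lambda>x. f x + g x) = (\<lambda>x. A f x + A g x)"
      by (simp add: A_def sum.distrib distrib_left fun_eq_iff)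
    then show "m (A (\<lambda>x. f x + g x)) = m (A f) + m (A g)" using lin(1)[of "A f" "A g"] by simp
  next
    fix c and f :: "'g \<Rightarrow> real"
    have "A (\<lambda>x. c * f x) = (\<lambda>x. c * A f x)"
      by (simp add: A_def fun_eq_iff sum_distrib_left[symmetric])
    then show "m (A (\<lambda>x. c * f x)) = c * m (A f)" using lin(2)[of c "A f"] by simp
  next
    fix f :: "'g \<Rightarrow> real" assume "\<forall>x. 0 \<le> f x"
    then show "0 \<le> m (A f)" by (intro pos) (simp add: A_def sum_nonneg)
  next
    have "A (\<lambda>_. 1) = (\<lambda>_. 1)" using N(1) by (simp add: A_def fun_eq_iff)
    then show "m (A (\<lambda>_. 1)) = 1" using one by simp
  qed
  moreover have "\<bar>m (A (\<lambda>x. f (x + k))) - m (A f)\<bar> \<le> e * C"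
    if k: "k \<in> insert h H" and C: "\<forall>x. \<bar>f x\<bar> \<le> C" for k f C
  proof (cases "k = h")
    case False
    have "A (\<lambda>x. f (x + k)) = (\<lambda>x. A f (x + k))"
      by (simp add: A_def fun_eq_iff add_ac)
    then show ?thesis using inv[of k "A f" C] k False Abd[of f C] C by auto
  next
    case True
    have C0: "0 \<le> C" using C by (meson abs_ge_zero order_trans)
    have "(\<Sum>i<N. f (x + h + zs (int i) h)) - (\<Sum>i<N. f (x + zs (int i) h)) = f (x + zs (int N) h) - f x" for x
    proof -
      have "x + h + zs (int i) h = x + zs (int (Suc i)) h" for i
        using zs_Suc[of "int i" h] by (simp add: add.commute add.left_commute)
      then have "(\<Sum>i<N. f (x + h + zs (int i) h)) = (\<Sum>i<N. f (x + zs (int (Suc i)) h))" by (simp only:)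
      moreover have "(\<Sum>i<N. f (x + zs (int (Suc i)) h) - f (x + zs (int i) h))
          = f (x + zs (int N) h) - f (x + zs (int 0) h)"
        by (rule sum_lessThan_telescope)
      ultimately show ?thesis
        by (simp only: sum_subtractf zs_0 of_nat_0 add_0_right)
    qed
    moreover have "(\<Sum>i<N. f (x + zs (int i) h + h)) = (\<Sum>i<N. f (x + h + zs (int i) h))" for x
      by (rule sum.cong) (simp_all add: add_ac)
    ultimately have "A (\<lambda>x. f (x + k)) x - A f x = (1 / real N) * (f (x + zs (int N) h) - f x)" for x
      by (simp only: A_def True right_diff_distrib[symmetric])
    moreover have "\<bar>(1 / real N) * (f (x + zs (int N) h) - f x)\<bar> \<le> e * C" for x
    proof -
      have "\<bar>f (x + zs (int N) h) - f x\<bar> \<le> 2 * C"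
        using spec[OF C, of "x + zs (int N) h"] spec[OF C, of x] by linarith
      then have "\<bar>(1 / real N) * (f (x + zs (int N) h) - f x)\<bar> \<le> (2 / real N) * C"
        using N(1) by (simp add: abs_mult divide_right_mono)
      also have "\<dots> \<le> e * C" using N(2) C0 by (rule mult_right_mono)
      finally show ?thesis .
    qed
    ultimately have "\<bar>A (\<lambda>x. f (x + k)) x - A f x\<bar> \<le> e * C" for x by simp
    then have "\<bar>m (\<lambda>x. A (\<lambda>x. f (x + k)) x + (- 1) * A f x)\<bar> \<le> e * C"
      by (intro mean_functional_abs_le[OF m]) simp
    then show ?thesis by (simp only: lin)
  qed
  ultimately show ?case by blast
qed

lemma compact_PiE_UNIV:
  fixes S :: "'a \<Rightarrow> 'b::topological_space set"
  assumes "\<And>i. compact (S i)"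
  shows "compact (Pi UNIV S)"
proof -
  have "compactin (product_topology (\<lambda>_. euclidean) UNIV) (Pi\<^sub>E UNIV S)"
    by (simp add: compactin_PiE assms)
  then show ?thesis by (simp add: euclidean_product_topology PiE_def)
qed

text \<open>Compactness of a product of intervals. A translation \<open>h\<close> and a tolerance
  \<open>1 / (n + 1)\<close> together give a closed condition; finitely many of these hold for the
  functional from \<open>almost_invariant_mean\<close>, and a common point has tolerance 0 for every
  \<open>h\<close>.\<close>

lemma ex_invariant_mean: "\<exists>M :: ('g::ab_group_add \<Rightarrow> real) \<Rightarrow> real. invariant_mean M"
proof -
  \<comment> \<open>The value 0 on unbounded functions pins the functional there, so that
    \<open>K\<close> is a product of compact intervals over all functions.\<close>
  define B where "B f = (if bounded (range f) then (SUP x. \<bar>f x\<bar>) else 0)" for f :: "'g \<Rightarrow> real"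
  have B: "\<bar>f x\<bar> \<le> B f" if "bounded (range f)" for f :: "'g \<Rightarrow> real" and x
  proof -
    have "bdd_above (range (\<lambda>x. \<bar>f x\<bar>))"
      using that unfolding bounded_iff bdd_above_def by auto
    then show ?thesis using that cSUP_upper[of x UNIV "\<lambda>x. \<bar>f x\<bar>"] by (simp add: B_def)
  qed
  have B0: "0 \<le> B f" for f
  proof (cases "bounded (range f)")
    case True
    then show ?thesis using B[OF True] by (meson abs_ge_zero order_trans)
  qed (simp add: B_def)
  define K where "K = Pi UNIV (\<lambda>f. {- B f..B f})"
  have K: "compact K" unfolding K_def by (rule compact_PiE_UNIV) simp
  define bd where "bd f \<longleftrightarrow> bounded (range f)" for f :: "'g \<Rightarrow> real"
  define C where "C = (\<lambda>(h, n). {M::('g \<Rightarrow> real) \<Rightarrow> real.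
     (\<forall>f g. bd f \<longrightarrow> bd g \<longrightarrow> M (\<lambda>x. f x + g x) = M f + M g) \<and>
     (\<forall>c f. bd f \<longrightarrow> M (\<lambda>x. c * f x) = c * M f) \<and>
     (\<forall>f. bd f \<longrightarrow> (\<forall>x. 0 \<le> f x) \<longrightarrow> 0 \<le> M f) \<and>
     M (\<lambda>_. 1) = 1 \<and>
     (\<forall>f. bd f \<longrightarrow> \<bar>M (\<lambda>x. f (x + h)) - M f\<bar> \<le> inverse (real (Suc n)) * B f)})"
  have cc: "continuous_on UNIV (\<lambda>M::('g \<Rightarrow> real) \<Rightarrow> real. M f)" for f
    by (rule continuous_on_product_coordinates)
  have clC: "closed (C p)" for p
    unfolding C_def
    by (cases p, simp only: prod.case)
      (intro closed_Collect_conj closed_Collect_all closed_Collect_imp open_Collect_const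
        closed_Collect_eq closed_Collect_le continuous_intros cc)
  have "K \<inter> \<Inter> (C ` UNIV) \<noteq> {}"
  proof (rule compact_imp_fip_image[OF K])
    fix I :: "('g \<times> nat) set" assume I: "finite I" "I \<subseteq> UNIV"
    define n where "n = Max (insert 0 (snd ` I))"
    have n: "k \<le> n" if "(h, k) \<in> I" for h k
      unfolding n_def using I(1) that by (intro Max_ge) (auto intro: rev_image_eqI)
    obtain m where m: "mean_functional m" and inv: "\<forall>h\<in>fst ` I. \<forall>f C. (\<forall>x. \<bar>f x\<bar> \<le> C) \<longrightarrow>
        \<bar>m (\<lambda>x. f (x + h)) - m f\<bar> \<le> inverse (real (Suc n)) * C"
      using almost_invariant_mean[of "fst ` I" "inverse (real (Suc n))"] I(1) by auto
    have lin: "\<And>f g. m (\<lambda>x. f x + g x) = m f + m g" "\<And>c f. m (\<lambda>x. c * f x) = c * m f"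
      and pos: "\<And>f. (\<And>x. 0 \<le> f x) \<Longrightarrow> 0 \<le> m f" and one: "m (\<lambda>_. 1) = 1"
      using m unfolding mean_functional_def by auto
    define M where "M f = (if bd f then m f else 0)" for f
    have bds: "bd (\<lambda>x. f x + g x)" "bd (\<lambda>x. c * f x)" "bd (\<lambda>x. f (x + h))"
      if "bd f" "bd g" for f g c h
    proof -
      show "bd (\<lambda>x. f x + g x)" using that unfolding bd_def by (intro bounded_plus_comp)
      show "bd (\<lambda>x. c * f x)"
        using that bounded_scaling[of "range f" c] unfolding bd_def by (simp add: image_image)
      show "bd (\<lambda>x. f (x + h))"
        using that(1) unfolding bd_def by (rule bounded_subset) auto
    qed
    have bd1: "bd (\<lambda>_. 1)" unfolding bd_def by simp
    have "M \<in> K"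
      unfolding K_def
    proof
      fix f
      have "\<bar>M f\<bar> \<le> B f"
        using mean_functional_abs_le[OF m, of f "B f"] B[of f] B0[of f] by (auto simp: M_def bd_def)
      then show "M f \<in> {- B f..B f}" by auto
    qed
    moreover have "M \<in> C p" if "p \<in> I" for p
    proof -
      obtain h k where p: "p = (h, k)" by (cases p)
      have "\<bar>m (\<lambda>x. f (x + h)) - m f\<bar> \<le> inverse (real (Suc k)) * B f" if f: "bd f" for f
      proof -
        have "\<bar>m (\<lambda>x. f (x + h)) - m f\<bar> \<le> inverse (real (Suc n)) * B f"
          using inv \<open>p \<in> I\<close> p B f by (force simp: bd_def)
        also have "\<dots> \<le> inverse (real (Suc k)) * B f"
          using n[of h k] \<open>p \<in> I\<close> p B0 by (intro mult_right_mono) auto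
        finally show ?thesis .
      qed
      then show ?thesis
        unfolding C_def p using lin pos one bds bd1 by (auto simp: M_def)
    qed
    ultimately show "K \<inter> \<Inter> (C ` I) \<noteq> {}" by blast
  qed (use clC in auto)
  then obtain M where M: "\<And>h n. M \<in> C (h, n)" by auto
  have "M (\<lambda>x. f (x + h)) = M f" if "bd f" for f h
  proof -
    have "\<bar>M (\<lambda>x. f (x + h)) - M f\<bar> \<le> inverse (real (Suc n)) * B f" for n
      using M[of h n] that unfolding C_def by auto
    then have "\<bar>M (\<lambda>x. f (x + h)) - M f\<bar> \<le> 0 * B f"
      by (intro LIMSEQ_le_const[OF tendsto_mult[OF LIMSEQ_inverse_real_of_nat tendsto_const]]) auto
    then show ?thesis by simp
  qed
  with M[of 0 0] have "invariant_mean M"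
    unfolding invariant_mean_def C_def bd_def by auto
  then show ?thesis by blast
qed

section \<open>Positive definite functions and characters\<close>

text \<open>Hermitian symmetry is demanded separately because the second clause controls only the
  real part of the quadratic form.\<close>

definition pd :: "('g::ab_group_add \<Rightarrow> complex) \<Rightarrow> bool" where
  "pd \<phi> \<longleftrightarrow> (\<forall>x. \<phi> (- x) = cnj (\<phi> x)) \<and>
     (\<forall>n (z :: nat \<Rightarrow> complex) (x :: nat \<Rightarrow> 'g).
        0 \<le> Re (\<Sum>i<n. \<Sum>j<n. z i * cnj (z j) * \<phi> (x i - x j)))"

lemma pd_minus: "pd \<phi> \<Longrightarrow> \<phi> (- x) = cnj (\<phi> x)"
  by (simp add: pd_def)

lemma pd_sum_nonneg:
  assumes "pd \<phi>" "finite I"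
  shows "0 \<le> Re (\<Sum>i\<in>I. \<Sum>j\<in>I. z i * cnj (z j) * \<phi> (x i - x j))"
proof -
  obtain b where b: "bij_betw b {0..<card I} I"
    using ex_bij_betw_nat_finite[OF assms(2)] by blast
  then have b: "bij_betw b {..<card I} I" by (simp add: lessThan_atLeast0)
  have "(\<Sum>i\<in>I. \<Sum>j\<in>I. z i * cnj (z j) * \<phi> (x i - x j)) =
    (\<Sum>i<card I. \<Sum>j<card I. z (b i) * cnj (z (b j)) * \<phi> (x (b i) - x (b j)))"
    by (simp add: sum.reindex_bij_betw[OF b, symmetric])
  then show ?thesis using assms(1) unfolding pd_def by simp
qed

lemma pd_zero_value:
  assumes "pd \<phi>"
  shows "Im (\<phi> 0) = 0" "0 \<le> Re (\<phi> 0)" "\<phi> 0 = of_real (Re (\<phi> 0))"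
proof -
  show "Im (\<phi> 0) = 0" using pd_minus[OF assms, of 0] by (simp add: complex_eq_iff)
  then show "\<phi> 0 = of_real (Re (\<phi> 0))" by (simp add: complex_eq_iff)
  show "0 \<le> Re (\<phi> 0)" using pd_sum_nonneg[OF assms, of "{0::nat}" "\<lambda>_. 1" "\<lambda>_. 0"] by simp
qed

lemma pd_norm_le:
  assumes "pd \<phi>"
  shows "norm (\<phi> x) \<le> Re (\<phi> 0)"
proof (cases "\<phi> x = 0")
  case True
  then show ?thesis using pd_zero_value[OF assms] by simp
next
  case False
  \<comment> \<open>The unit number that turns \<open>\<phi> x\<close> into
    \<open>- norm (\<phi> x)\<close>; the bound follows by testing the form at the points 0 and
    \<open>x\<close> with coefficients 1 and \<open>c\<close>.\<close>
  define c where "c = - cnj (\<phi> x) / norm (\<phi> x)"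
  have "norm (\<phi> x) \<noteq> 0" using False by simp
  have cc: "c * cnj c = 1"
    using False by (simp add: c_def complex_norm_square[symmetric] power2_eq_square mult.commute)
  have "c * \<phi> x = - (\<phi> x * cnj (\<phi> x)) / norm (\<phi> x)" by (simp add: c_def mult.commute)
  also have "\<phi> x * cnj (\<phi> x) = of_real (norm (\<phi> x)) * of_real (norm (\<phi> x))"
    by (simp add: complex_norm_square[symmetric] power2_eq_square)
  also have "- (complex_of_real (norm (\<phi> x)) * complex_of_real (norm (\<phi> x))) / complex_of_real (norm (\<phi> x))
      = - complex_of_real (norm (\<phi> x))"
    using False by simp
  finally have cphi: "c * \<phi> x = - of_real (norm (\<phi> x))" .
  have "0 \<le> Re (\<Sum>i<(2::nat). \<Sum>j<(2::nat). (if i = 0 then 1 else c) * cnj (if j = 0 then 1 else c) *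
      \<phi> ((if i = 0 then 0 else x) - (if j = 0 then 0 else x)))"
    using pd_sum_nonneg[OF assms, of "{..<2}" "\<lambda>i::nat. if i = 0 then 1 else c" "\<lambda>i. if i = 0 then 0 else x"]
    by simp
  then have "0 \<le> Re (\<phi> 0 + cnj c * cnj (\<phi> x) + (c * \<phi> x + c * cnj c * \<phi> 0))"
    by (simp add: numeral_2_eq_2 pd_minus[OF assms])
  also have "cnj c * cnj (\<phi> x) = cnj (c * \<phi> x)" by simp
  finally show ?thesis unfolding cc cphi by simp
qed

lemma pd_mix:
  assumes "pd \<alpha>" "pd \<beta>" "0 \<le> s" "0 \<le> (t::real)"
  shows "pd (\<lambda>x. of_real s * \<alpha> x + of_real t * \<beta> x)"
  unfolding pd_def
proof (intro conjI allI)
  fix n and z :: "nat \<Rightarrow> complex" and x :: "nat \<Rightarrow> 'a"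
  have "(\<Sum>i<n. \<Sum>j<n. z i * cnj (z j) * (of_real s * \<alpha> (x i - x j) + of_real t * \<beta> (x i - x j)))
    = of_real s * (\<Sum>i<n. \<Sum>j<n. z i * cnj (z j) * \<alpha> (x i - x j))
      + of_real t * (\<Sum>i<n. \<Sum>j<n. z i * cnj (z j) * \<beta> (x i - x j))"
    by (simp add: sum_distrib_left sum.distrib[symmetric] algebra_simps)
  then show "0 \<le> Re (\<Sum>i<n. \<Sum>j<n. z i * cnj (z j) * (of_real s * \<alpha> (x i - x j) + of_real t * \<beta> (x i - x j)))"
    using assms unfolding pd_def by simp
qed (use assms in \<open>simp add: pd_minus\<close>)

text \<open>If \<open>\<psi>\<close> is the matrix coefficient of a unitary representation at a
  vector, this is the squared norm of the average of the translates of that vector by the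
  \<open>h i\<close>. Its infimum over all families is the squared norm of the projection to the
  invariant vectors.\<close>

definition qavg :: "'i set \<Rightarrow> ('i \<Rightarrow> 'g::ab_group_add) \<Rightarrow> ('g \<Rightarrow> complex) \<Rightarrow> real" where
  "qavg I h \<psi> = Re (\<Sum>i\<in>I. \<Sum>j\<in>I. \<psi> (h i - h j)) / (real (card I))\<^sup>2"

text \<open>\<open>qinf (F * \<phi>)\<close> replaces the Fourier coefficient of \<open>F\<close> at \<open>\<phi>\<close>: unlike an invariant mean, an infimum of
  finite averages is upper semicontinuous in \<open>\<phi>\<close>, so it attains its maximum on a compact set.\<close>

definition qinf :: "('g::ab_group_add \<Rightarrow> complex) \<Rightarrow> real" where
  "qinf \<psi> = Inf {qavg {..<n::nat} h \<psi> | n h. n > 0}"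

lemma qavg_nonneg: "pd \<psi> \<Longrightarrow> finite I \<Longrightarrow> 0 \<le> qavg I h \<psi>"
  unfolding qavg_def using pd_sum_nonneg[of \<psi> I "\<lambda>_. 1" h] by simp

lemma qavg_lessThan:
  assumes "finite I"
  obtains h' where "\<And>\<psi>. qavg I h \<psi> = qavg {..<card I} h' \<psi>"
proof -
  obtain b where b: "bij_betw b {0..<card I} I"
    using ex_bij_betw_nat_finite[OF assms] by blast
  then have b: "bij_betw b {..<card I} I" by (simp add: lessThan_atLeast0)
  have "qavg I h \<psi> = qavg {..<card I} (h \<circ> b) \<psi>" for \<psi>
    by (simp add: qavg_def sum.reindex_bij_betw[OF b, symmetric])
  then show ?thesis using that by blast
qed

lemma qinf_le:
  assumes "pd \<psi>" "finite I" "I \<noteq> {}"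
  shows "qinf \<psi> \<le> qavg I h \<psi>"
proof -
  obtain h' where "\<And>\<psi>. qavg I h \<psi> = qavg {..<card I} h' \<psi>"
    using qavg_lessThan[OF assms(2)] by blast
  moreover have "card I > 0" using assms by (simp add: card_gt_0_iff)
  moreover have "bdd_below {qavg {..<n::nat} h \<psi> | n h. n > 0}"
    by (rule bdd_belowI[of _ 0]) (use qavg_nonneg[OF assms(1)] in auto)
  ultimately show ?thesis unfolding qinf_def by (intro cInf_lower) auto
qed

lemma qinf_ge:
  assumes "\<And>n h. n > 0 \<Longrightarrow> c \<le> qavg {..<n::nat} h \<psi>"
  shows "c \<le> qinf \<psi>"
  unfolding qinf_def
proof (rule cInf_greatest)
  show "{qavg {..<n::nat} h \<psi> | n h. n > 0} \<noteq> {}"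
  proof -
    have "\<exists>n::nat. n > 0" by blast
    then show ?thesis by blast
  qed
qed (use assms in auto)

lemma qinf_approx:
  assumes "e > 0"
  obtains n :: nat and h where "n > 0" "qavg {..<n} h \<psi> < qinf \<psi> + e"
proof -
  have "\<not> (qinf \<psi> + e \<le> qinf \<psi>)" using assms by simp
  then have "\<not> (\<forall>(n::nat) h. n > 0 \<longrightarrow> qinf \<psi> + e \<le> qavg {..<n} h \<psi>)"
    using qinf_ge by blast
  then show ?thesis using that by (auto simp: not_le)
qed

text \<open>Positivity for the family \<open>h\<close> with coefficient -1 joined to its translate
  by \<open>s\<close> with coefficient 1. In Hilbert space terms, the inner product of two vectors
  of equal norm is at most the squared norm.\<close>

lemma pd_shift_sum:
  assumes "pd \<psi>" "finite I"
  shows "Re (\<Sum>i\<in>I. \<Sum>j\<in>I. \<psi> (h i - h j + s)) \<le> Re (\<Sum>i\<in>I. \<Sum>j\<in>I. \<psi> (h i - h j))"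
proof -
  let ?A = "Re (\<Sum>i\<in>I. \<Sum>j\<in>I. \<psi> (h i - h j))"
  let ?J = "I \<times> {True, False}"
  let ?z = "\<lambda>p::'b \<times> bool. if snd p then 1 else (- 1 :: complex)"
  let ?x = "\<lambda>p::'b \<times> bool. if snd p then h (fst p) + s else h (fst p)"
  have "0 \<le> Re (\<Sum>p\<in>?J. \<Sum>q\<in>?J. ?z p * cnj (?z q) * \<psi> (?x p - ?x q))"
    by (rule pd_sum_nonneg[OF assms(1)]) (use assms(2) in simp)
  also have "(\<Sum>p\<in>?J. \<Sum>q\<in>?J. ?z p * cnj (?z q) * \<psi> (?x p - ?x q)) =
     (\<Sum>i\<in>I. \<Sum>j\<in>I. \<psi> (h i - h j)) + (\<Sum>i\<in>I. \<Sum>j\<in>I. \<psi> (h i - h j))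
     - (\<Sum>i\<in>I. \<Sum>j\<in>I. \<psi> (h i - h j + s)) - (\<Sum>i\<in>I. \<Sum>j\<in>I. \<psi> (h i - h j - s))"
    by (simp add: sum.cartesian_product' sum.distrib sum_subtractf sum_negf algebra_simps)
  also have "(\<Sum>i\<in>I. \<Sum>j\<in>I. \<psi> (h i - h j - s)) = (\<Sum>i\<in>I. \<Sum>j\<in>I. \<psi> (- (h j - h i + s)))"
    by (simp add: algebra_simps)
  also have "\<dots> = cnj (\<Sum>i\<in>I. \<Sum>j\<in>I. \<psi> (h j - h i + s))"
    by (simp only: pd_minus[OF assms(1)] cnj_sum)
  also have "(\<Sum>i\<in>I. \<Sum>j\<in>I. \<psi> (h j - h i + s)) = (\<Sum>i\<in>I. \<Sum>j\<in>I. \<psi> (h i - h j + s))"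
    by (rule sum.swap)
  finally show ?thesis by simp
qed

text \<open>Adding a second family to the first one only improves the average; this makes the
  infimum additive on positive definite functions.\<close>

lemma qavg_sum_family:
  assumes "pd \<psi>" "finite I" "I \<noteq> {}" "finite J" "J \<noteq> {}"
  shows "qavg (I \<times> J) (\<lambda>(i, j). h i + k j) \<psi> \<le> qavg I h \<psi>"
proof -
  have pos: "card I > 0" "card J > 0" using assms by (simp_all add: card_gt_0_iff)
  have "(\<Sum>p\<in>I \<times> J. \<Sum>q\<in>I \<times> J. \<psi> ((case p of (i, j) \<Rightarrow> h i + k j) - (case q of (i, j) \<Rightarrow> h i + k j)))
      = (\<Sum>i\<in>I. \<Sum>j\<in>J. \<Sum>i'\<in>I. \<Sum>j'\<in>J. \<psi> (h i - h i' + (k j - k j')))"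
    by (simp add: sum.cartesian_product' algebra_simps)
  also have "\<dots> = (\<Sum>i\<in>I. \<Sum>j\<in>J. \<Sum>j'\<in>J. \<Sum>i'\<in>I. \<psi> (h i - h i' + (k j - k j')))"
    by (intro sum.cong refl sum.swap)
  also have "\<dots> = (\<Sum>j\<in>J. \<Sum>i\<in>I. \<Sum>j'\<in>J. \<Sum>i'\<in>I. \<psi> (h i - h i' + (k j - k j')))"
    by (rule sum.swap)
  also have "\<dots> = (\<Sum>j\<in>J. \<Sum>j'\<in>J. \<Sum>i\<in>I. \<Sum>i'\<in>I. \<psi> (h i - h i' + (k j - k j')))"
    by (intro sum.cong refl sum.swap)
  also have "Re \<dots> \<le> (\<Sum>j\<in>J. \<Sum>j'\<in>J. Re (\<Sum>i\<in>I. \<Sum>i'\<in>I. \<psi> (h i - h i')))"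
    unfolding Re_sum[of _ J] by (intro sum_mono pd_shift_sum assms)
  finally have "Re (\<Sum>p\<in>I \<times> J. \<Sum>q\<in>I \<times> J. \<psi> ((case p of (i, j) \<Rightarrow> h i + k j) - (case q of (i, j) \<Rightarrow> h i + k j)))
      \<le> (real (card J))\<^sup>2 * Re (\<Sum>i\<in>I. \<Sum>i'\<in>I. \<psi> (h i - h i'))"
    by (simp add: power2_eq_square mult.assoc)
  then show ?thesis
    using pos by (simp add: qavg_def card_cartesian_product power_mult_distrib field_simps)
qed

lemma qavg_mix: "qavg I h (\<lambda>x. of_real s * \<alpha> x + of_real t * \<beta> x) = s * qavg I h \<alpha> + t * qavg I h \<beta>"
proof -
  have "(\<Sum>i\<in>I. \<Sum>j\<in>I. of_real s * \<alpha> (h i - h j) + of_real t * \<beta> (h i - h j))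
    = of_real s * (\<Sum>i\<in>I. \<Sum>j\<in>I. \<alpha> (h i - h j)) + of_real t * (\<Sum>i\<in>I. \<Sum>j\<in>I. \<beta> (h i - h j))"
    by (simp add: sum_distrib_left sum.distrib)
  then show ?thesis by (simp add: qavg_def add_divide_distrib)
qed

text \<open>The sums \<open>h i + k j\<close> of a nearly optimal family for \<open>\<alpha>\<close>
  and one for \<open>\<beta>\<close> are nearly optimal for both at once.\<close>

lemma qinf_mix_le:
  assumes \<alpha>: "pd \<alpha>" and \<beta>: "pd \<beta>" and st: "0 \<le> s" "0 \<le> (t::real)"
  shows "qinf (\<lambda>x. of_real s * \<alpha> x + of_real t * \<beta> x) \<le> s * qinf \<alpha> + t * qinf \<beta>"
proof (rule field_le_epsilon)
  fix e :: real assume "e > 0"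
  \<comment> \<open>The summand 1 keeps the denominator positive when
    \<open>s = t = 0\<close>.\<close>
  define d where "d = e / (s + t + 1)"
  have d: "d > 0" "(s + t) * d \<le> e"
    using \<open>e > 0\<close> st by (simp_all add: d_def field_simps)
  obtain n :: nat and h where h: "n > 0" "qavg {..<n} h \<alpha> < qinf \<alpha> + d" using qinf_approx d(1) by blast
  obtain m :: nat and k where k: "m > 0" "qavg {..<m} k \<beta> < qinf \<beta> + d" using qinf_approx d(1) by blast
  let ?I = "{..<n} \<times> {..<m}" and ?h = "\<lambda>(i, j). h i + k j"
  have ne: "{..<n} \<noteq> {}" "{..<m} \<noteq> {}" using h k by auto
  have A: "qavg ?I ?h \<alpha> \<le> qavg {..<n} h \<alpha>"
    by (rule qavg_sum_family[OF \<alpha>]) (use ne in auto)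
  have "qavg ({..<m} \<times> {..<n}) (\<lambda>(j, i). k j + h i) \<beta> \<le> qavg {..<m} k \<beta>"
    by (rule qavg_sum_family[OF \<beta>]) (use ne in auto)
  also have "qavg ({..<m} \<times> {..<n}) (\<lambda>(j, i). k j + h i) \<beta> = qavg ?I ?h \<beta>"
  proof -
    have b: "bij_betw prod.swap ?I ({..<m} \<times> {..<n})" by (auto simp: bij_betw_def product_swap)
    have "(\<Sum>p\<in>{..<m} \<times> {..<n}. \<Sum>q\<in>{..<m} \<times> {..<n}. \<beta> ((\<lambda>(j, i). k j + h i) p - (\<lambda>(j, i). k j + h i) q))
       = (\<Sum>p\<in>?I. \<Sum>q\<in>?I. \<beta> ((\<lambda>(j, i). k j + h i) (prod.swap p) - (\<lambda>(j, i). k j + h i) (prod.swap q)))"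
      by (simp only: sum.reindex_bij_betw[OF b, symmetric])
    also have "\<dots> = (\<Sum>p\<in>?I. \<Sum>q\<in>?I. \<beta> (?h p - ?h q))"
      by (intro sum.cong refl) (simp add: split_beta add.commute)
    finally show ?thesis by (simp add: qavg_def card_cartesian_product mult.commute)
  qed
  finally have B: "qavg ?I ?h \<beta> \<le> qavg {..<m} k \<beta>" .
  have "qinf (\<lambda>x. of_real s * \<alpha> x + of_real t * \<beta> x) \<le> qavg ?I ?h (\<lambda>x. of_real s * \<alpha> x + of_real t * \<beta> x)"
    by (rule qinf_le[OF pd_mix[OF \<alpha> \<beta> st]]) (use ne in auto)
  also have "\<dots> \<le> s * (qinf \<alpha> + d) + t * (qinf \<beta> + d)"
    unfolding qavg_mix by (intro add_mono mult_left_mono st) (use A B h k in auto)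
  also have "\<dots> \<le> s * qinf \<alpha> + t * qinf \<beta> + e"
    using d(2) by (simp add: algebra_simps)
  finally show "qinf (\<lambda>x. of_real s * \<alpha> x + of_real t * \<beta> x) \<le> s * qinf \<alpha> + t * qinf \<beta> + e" .
qed

section \<open>Faces of the compact convex set of normalised positive definite functions\<close>

definition pd1 :: "('g::ab_group_add \<Rightarrow> complex) set" where
  "pd1 = {\<phi>. pd \<phi> \<and> \<phi> 0 = 1}"

lemma closed_pd1: "closed (pd1 :: ('g::ab_group_add \<Rightarrow> complex) set)"
proof -
  have cc: "continuous_on UNIV (\<lambda>\<phi>::'g \<Rightarrow> complex. \<phi> x)" for x
    by (rule continuous_on_product_coordinates)
  show ?thesis
    unfolding pd1_def pd_def
    by (intro closed_Collect_conj closed_Collect_all closed_Collect_eq closed_Collect_le continuous_intros cc)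
qed

lemma compact_pd1: "compact (pd1 :: ('g::ab_group_add \<Rightarrow> complex) set)"
proof -
  note closed_pd1
  moreover have "pd1 \<subseteq> Pi UNIV (\<lambda>_::'g. cball (0::complex) 1)"
    using pd_norm_le by (fastforce simp: pd1_def)
  ultimately show ?thesis
    using compact_Int_closed[OF compact_PiE_UNIV, of "\<lambda>_::'g. cball (0::complex) 1" pd1]
    by (simp add: Int_absorb1)
qed

text \<open>\<open>face {\<phi>}\<close> says that \<open>\<phi>\<close> is an extreme point.
  Closedness and non-emptiness are carried alongside as separate assumptions.\<close>

definition face :: "('g::ab_group_add \<Rightarrow> complex) set \<Rightarrow> bool" where
  "face D \<longleftrightarrow> D \<subseteq> pd1 \<and> (\<forall>\<alpha>\<in>pd1. \<forall>\<beta>\<in>pd1. \<forall>t::real. 0 < t \<longrightarrow> t < 1 \<longrightarrow>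
     (\<lambda>x. of_real t * \<alpha> x + of_real (1 - t) * \<beta> x) \<in> D \<longrightarrow> \<alpha> \<in> D \<and> \<beta> \<in> D)"

text \<open>A convex combination attains the maximum of a real linear functional only if both of its
  terms do. The factor \<open>c\<close> makes real and imaginary parts of a coordinate available
  alike.\<close>

lemma face_max_Re:
  fixes c :: complex
  assumes D: "face D" "closed D" "D \<noteq> {}"
  shows "\<exists>m. face {\<phi>\<in>D. Re (c * \<phi> x) = m} \<and> closed {\<phi>\<in>D. Re (c * \<phi> x) = m} \<and>
    {\<phi>\<in>D. Re (c * \<phi> x) = m} \<noteq> {}"
proof -
  have cont: "continuous_on A (\<lambda>\<phi>::'a \<Rightarrow> complex. Re (c * \<phi> x))" for A
  proof -
    have "continuous_on A (\<lambda>\<phi>::'a \<Rightarrow> complex. \<phi> x)"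
      by (rule continuous_on_subset[OF continuous_on_product_coordinates]) simp
    then show ?thesis by (intro continuous_intros)
  qed
  have "compact D" using compact_Int_closed[OF compact_pd1 D(2)] D(1) by (simp add: face_def Int_absorb1)
  then obtain \<phi>0 where \<phi>0: "\<phi>0 \<in> D" "\<And>\<phi>. \<phi> \<in> D \<Longrightarrow> Re (c * \<phi> x) \<le> Re (c * \<phi>0 x)"
    using continuous_attains_sup[OF _ D(3) cont] by metis
  define m where "m = Re (c * \<phi>0 x)"
  have m: "\<And>\<phi>. \<phi> \<in> D \<Longrightarrow> Re (c * \<phi> x) \<le> m" using \<phi>0 by (simp add: m_def)
  have "face {\<phi>\<in>D. Re (c * \<phi> x) = m}"
    unfolding face_def
  proof (intro conjI ballI allI impI)
    show "{\<phi>\<in>D. Re (c * \<phi> x) = m} \<subseteq> pd1" using D(1) by (auto simp: face_def)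
    fix \<alpha> \<beta> :: "'a \<Rightarrow> complex" and t :: real
    assume ab: "\<alpha> \<in> pd1" "\<beta> \<in> pd1" and t: "0 < t" "t < 1"
      and in_face: "(\<lambda>x. of_real t * \<alpha> x + of_real (1 - t) * \<beta> x) \<in> {\<phi>\<in>D. Re (c * \<phi> x) = m}"
    then have in_D: "\<alpha> \<in> D" "\<beta> \<in> D" using D(1) unfolding face_def by blast+
    have "Re (c * (of_real t * \<alpha> x + of_real (1 - t) * \<beta> x)) = m" using in_face by blast
    moreover have "Re (c * (of_real t * \<alpha> x + of_real (1 - t) * \<beta> x)) = t * Re (c * \<alpha> x) + (1 - t) * Re (c * \<beta> x)"
      by (simp add: algebra_simps)
    ultimately have eq: "t * Re (c * \<alpha> x) + (1 - t) * Re (c * \<beta> x) = m" by simp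
    have le: "Re (c * \<alpha> x) \<le> m" "Re (c * \<beta> x) \<le> m" using m in_D by auto
    have 1: "t * (m - Re (c * \<alpha> x)) + (1 - t) * (m - Re (c * \<beta> x)) = 0"
      using eq by (simp add: algebra_simps)
    have "0 \<le> t * (m - Re (c * \<alpha> x))" "0 \<le> (1 - t) * (m - Re (c * \<beta> x))"
      using le t by auto
    then have "t * (m - Re (c * \<alpha> x)) = 0" "(1 - t) * (m - Re (c * \<beta> x)) = 0" using 1 by linarith+
    then show "\<alpha> \<in> {\<phi>\<in>D. Re (c * \<phi> x) = m}" "\<beta> \<in> {\<phi>\<in>D. Re (c * \<phi> x) = m}"
      using t in_D by auto
  qed
  moreover have "closed {\<phi>\<in>D. Re (c * \<phi> x) = m}"
    using closed_Int[OF D(2) closed_Collect_eq[OF cont continuous_on_const], of m] by (simp add: Int_def)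
  moreover have "\<phi>0 \<in> {\<phi>\<in>D. Re (c * \<phi> x) = m}" using \<phi>0(1) by (simp add: m_def)
  ultimately show ?thesis by blast
qed

lemma face_Inter:
  assumes "\<And>D. D \<in> C \<Longrightarrow> face D" "C \<noteq> {}"
  shows "face (\<Inter>C)"
  unfolding face_def
proof (intro conjI ballI allI impI)
  show "\<Inter>C \<subseteq> pd1" using assms unfolding face_def by blast
  fix \<alpha> \<beta> and t :: real
  assume ab: "\<alpha> \<in> pd1" "\<beta> \<in> pd1" and t: "0 < t" "t < 1"
    and mix: "(\<lambda>x. of_real t * \<alpha> x + of_real (1 - t) * \<beta> x) \<in> \<Inter>C"
  have "\<alpha> \<in> D \<and> \<beta> \<in> D" if "D \<in> C" for D
    using assms(1)[OF that, unfolded face_def, THEN conjunct2, rule_format, OF ab t] mix that by blast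
  then show "\<alpha> \<in> \<Inter>C" "\<beta> \<in> \<Inter>C" by blast+
qed

text \<open>The argument of Krein and Milman: in a minimal non-empty closed face every functional
  \<open>Re (c * \<phi> x)\<close> is constant by \<open>face_max_Re\<close>, so the face is a
  single point.\<close>

lemma face_contains_extreme:
  assumes D: "face D" "closed D" "D \<noteq> {}"
  obtains \<phi> where "\<phi> \<in> D" "face {\<phi>}"
proof -
  define A where "A = {E. E \<subseteq> D \<and> face E \<and> closed E \<and> E \<noteq> {}}"
  \<comment> \<open>Complements are taken because Zorn's lemma for inclusion yields maximal sets and
    a minimal face is wanted.\<close>
  have "\<exists>M\<in>uminus ` A. \<forall>X\<in>uminus ` A. M \<subseteq> X \<longrightarrow> X = M"
  proof (rule subset_Zorn)
    fix C assume C: "subset.chain (uminus ` A) C"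
    show "\<exists>U\<in>uminus ` A. \<forall>X\<in>C. X \<subseteq> U"
    proof (cases "C = {}")
      case True
      then show ?thesis using D by (auto simp: A_def)
    next
      case False
      let ?C = "uminus ` C"
      have CA: "E \<in> A" if "E \<in> ?C" for E using C that by (auto simp: subset.chain_def)
      have ne: "?C \<noteq> {}" using False by simp
      have tot: "E \<subseteq> E' \<or> E' \<subseteq> E" if "E \<in> ?C" "E' \<in> ?C" for E E'
      proof -
        obtain X X' where X: "E = - X" "X \<in> C" "E' = - X'" "X' \<in> C" using \<open>E \<in> ?C\<close> \<open>E' \<in> ?C\<close> by blast
        then have "X \<subseteq> X' \<or> X' \<subseteq> X" using C unfolding subset.chain_def by blast
        then show ?thesis using X by blast
      qed
      have "compact D" using compact_Int_closed[OF compact_pd1 D(2)] D(1) by (simp add: face_def Int_absorb1)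
      have "D \<inter> \<Inter>?C \<noteq> {}"
      proof (rule compact_imp_fip[OF \<open>compact D\<close>])
        show "closed E" if "E \<in> ?C" for E using CA[OF that] by (simp add: A_def)
        fix F assume F: "finite F" "F \<subseteq> ?C"
        show "D \<inter> \<Inter>F \<noteq> {}"
        proof (cases "F = {}")
          case True
          then show ?thesis using D by simp
        next
          case nF: False
          have "\<exists>E\<in>F. E \<subseteq> \<Inter>F"
            using F(1) nF F(2)
          proof (induction F rule: finite_ne_induct)
            case (insert E F)
            then obtain E' where E': "E' \<in> F" "E' \<subseteq> \<Inter>F" by auto
            have "E \<in> ?C" "E' \<in> ?C" using insert.prems E' by blast+
            then have "E \<subseteq> E' \<or> E' \<subseteq> E" by (rule tot)
            then show ?case
            proof
              assume "E \<subseteq> E'"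
              then have "E \<subseteq> \<Inter>(insert E F)" using E' by blast
              then show ?thesis by blast
            next
              assume "E' \<subseteq> E"
              then have "E' \<subseteq> \<Inter>(insert E F)" using E' by blast
              then show ?thesis using E' by blast
            qed
          qed simp
          then obtain E where E: "E \<in> F" "E \<subseteq> \<Inter>F" by blast
          from F(2) E(1) have "E \<in> A" by (rule CA[OF subsetD])
          then have "E \<subseteq> D" "E \<noteq> {}" by (simp_all add: A_def)
          then show ?thesis using E(2) by blast
        qed
      qed
      then have "\<Inter>?C \<noteq> {}" by blast
      moreover have "\<Inter>?C \<subseteq> D" using ne CA by (auto simp: A_def)
      moreover have "closed (\<Inter>?C)" using CA by (intro closed_Inter) (auto simp: A_def)
      moreover have "face (\<Inter>?C)" using CA ne by (intro face_Inter) (auto simp: A_def)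
      ultimately have "\<Inter>?C \<in> A" by (simp add: A_def)
      then have "- \<Inter>?C \<in> uminus ` A" by blast
      moreover have "\<forall>X\<in>C. X \<subseteq> - \<Inter>?C" by auto
      ultimately show ?thesis by blast
    qed
  qed
  then obtain E where E: "E \<in> A" and min: "\<And>E'. E' \<in> A \<Longrightarrow> E' \<subseteq> E \<Longrightarrow> E' = E"
    by (auto simp: image_iff)
  then obtain \<phi> where \<phi>: "\<phi> \<in> E" by (auto simp: A_def)
  have coord: "Re (c * \<alpha> x) = Re (c * \<phi> x)" if "\<alpha> \<in> E" for \<alpha> c x
  proof -
    have "face E" "closed E" "E \<noteq> {}" using E by (simp_all add: A_def)
    then obtain m where m: "face {\<phi>\<in>E. Re (c * \<phi> x) = m}" "closed {\<phi>\<in>E. Re (c * \<phi> x) = m}"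
      "{\<phi>\<in>E. Re (c * \<phi> x) = m} \<noteq> {}"
      using face_max_Re[of E c x] by blast
    then have "{\<phi>\<in>E. Re (c * \<phi> x) = m} \<in> A" using E by (auto simp: A_def)
    then have "{\<phi>\<in>E. Re (c * \<phi> x) = m} = E" by (rule min) auto
    then have "Re (c * \<alpha> x) = m \<and> Re (c * \<phi> x) = m" using that \<phi> by blast
    then show ?thesis by simp
  qed
  have "\<alpha> = \<phi>" if "\<alpha> \<in> E" for \<alpha>
  proof
    fix x
    show "\<alpha> x = \<phi> x"
      using coord[OF that, of 1 x] coord[OF that, of "\<i>" x] by (simp add: complex_eq_iff)
  qed
  then have "E = {\<phi>}" using \<phi> by blast
  with E have "\<phi> \<in> D" "face {\<phi>}" by (simp_all add: A_def)
  then show ?thesis by (rule that)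
qed

text \<open>If \<open>\<phi>\<close> is the matrix coefficient at a vector \<open>v\<close> and
  \<open>U\<close> is the translation by \<open>x\<close>, the function in the conclusion is half
  the matrix coefficient at \<open>v + b c U v\<close>.\<close>

lemma pd_modulate:
  fixes c :: complex and x :: "'g::ab_group_add" and b :: real
  assumes \<phi>: "pd \<phi>" and c: "norm c = 1" and b: "\<bar>b\<bar> = 1"
  shows "pd (\<lambda>y. \<phi> y + of_real (b / 2) * (c * \<phi> (y + x) + cnj c * \<phi> (y - x)))"
  unfolding pd_def
proof (intro conjI allI)
  fix y
  have 1: "\<phi> (- y + x) = cnj (\<phi> (y - x))" "\<phi> (- y - x) = cnj (\<phi> (y + x))"
  proof -
    have "- y + x = - (y - x)" "- y - x = - (y + x)" by simp_all
    then show "\<phi> (- y + x) = cnj (\<phi> (y - x))" "\<phi> (- y - x) = cnj (\<phi> (y + x))"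
      by (simp_all only: pd_minus[OF \<phi>])
  qed
  show "\<phi> (- y) + of_real (b / 2) * (c * \<phi> (- y + x) + cnj c * \<phi> (- y - x)) =
      cnj (\<phi> y + of_real (b / 2) * (c * \<phi> (y + x) + cnj c * \<phi> (y - x)))"
    unfolding 1 by (simp add: pd_minus[OF \<phi>])
next
  fix n :: nat and z :: "nat \<Rightarrow> complex" and h :: "nat \<Rightarrow> 'g"
  let ?J = "{..<n} \<times> {True, False}"
  let ?z = "\<lambda>p::nat \<times> bool. if snd p then of_real b * c * z (fst p) else z (fst p)"
  let ?x = "\<lambda>p::nat \<times> bool. if snd p then h (fst p) + x else h (fst p)"
  have cc: "c * cnj c = 1" using c by (simp add: complex_norm_square[symmetric])
  have bb: "of_real b * of_real b = (1::complex)"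
    using b by (metis abs_mult_self_eq mult.right_neutral of_real_1 of_real_mult)
  have ccz: "of_real b * c * u * cnj (of_real b * c * v) = u * cnj v" for u v
  proof -
    have "of_real b * c * u * cnj (of_real b * c * v) = (of_real b * of_real b) * (c * cnj c) * (u * cnj v)"
      by (simp add: mult_ac)
    then show ?thesis by (simp add: cc bb)
  qed
  have "0 \<le> Re (\<Sum>p\<in>?J. \<Sum>q\<in>?J. ?z p * cnj (?z q) * \<phi> (?x p - ?x q))"
    by (rule pd_sum_nonneg[OF \<phi>]) simp
  also have "(\<Sum>p\<in>?J. \<Sum>q\<in>?J. ?z p * cnj (?z q) * \<phi> (?x p - ?x q)) =
     (\<Sum>i<n. \<Sum>j<n. (of_real b * c * z i * cnj (of_real b * c * z j)) * \<phi> (h i - h j) +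
        z i * cnj (z j) * \<phi> (h i - h j) +
        z i * cnj (z j) * (of_real b * (c * \<phi> (h i - h j + x))) +
        z i * cnj (z j) * (of_real b * (cnj c * \<phi> (h i - h j - x))))"
    unfolding sum.cartesian_product' by (simp add: sum.distrib algebra_simps)
  also have "\<dots> = 2 * (\<Sum>i<n. \<Sum>j<n. z i * cnj (z j) * (\<phi> (h i - h j) + of_real (b / 2) *
       (c * \<phi> (h i - h j + x) + cnj c * \<phi> (h i - h j - x))))"
    unfolding ccz sum_distrib_left by (intro sum.cong refl) (simp add: algebra_simps)
  finally show "0 \<le> Re (\<Sum>i<n. \<Sum>j<n. z i * cnj (z j) * (\<phi> (h i - h j) + of_real (b / 2) *
       (c * \<phi> (h i - h j + x) + cnj c * \<phi> (h i - h j - x))))"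
    by simp
qed

lemma pd_zero_at_zero: "pd \<phi> \<Longrightarrow> \<phi> 0 = 0 \<Longrightarrow> \<phi> x = 0"
  using pd_norm_le[of \<phi> x] by simp

lemma pd_scale: "pd \<phi> \<Longrightarrow> 0 \<le> s \<Longrightarrow> pd (\<lambda>x. of_real s * \<phi> x)"
  using pd_mix[of \<phi> \<phi> s 0] by simp

text \<open>By \<open>pd_modulate\<close>, \<open>\<phi>\<close> is the midpoint of the positive
  definite functions \<open>\<phi> + \<eta>\<close> and \<open>\<phi> - \<eta>\<close>, where
  \<open>\<eta>\<close> is a symmetrised translate. Extremality makes both proportional to
  \<open>\<phi>\<close>, so \<open>\<eta>\<close> is a real multiple of \<open>\<phi>\<close>.
  Multiplicativity results from the two choices 1 and \<open>\<i>\<close> of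
  \<open>c\<close>.\<close>

lemma extreme_pd_multiplicative:
  assumes ex: "face {\<phi>}"
  shows "\<phi> (x + y) = \<phi> x * \<phi> y" "norm (\<phi> x) = 1"
proof -
  have \<phi>: "pd \<phi>" "\<phi> 0 = 1" using ex by (auto simp: face_def pd1_def)
  have key: "(c * \<phi> (y + x) + cnj c * \<phi> (y - x)) / 2 = of_real (Re (c * \<phi> x)) * \<phi> y"
    if c: "norm c = 1" for c x y
  proof -
    define r where "r = Re (c * \<phi> x)"
    define \<eta> where "\<eta> y = (c * \<phi> (y + x) + cnj c * \<phi> (y - x)) / 2" for y
    have P: "pd (\<lambda>y. \<phi> y + \<eta> y)" and N: "pd (\<lambda>y. \<phi> y - \<eta> y)"
      using pd_modulate[OF \<phi>(1) c, of 1 x] pd_modulate[OF \<phi>(1) c, of "- 1" x] by (simp_all add: \<eta>_def)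
    have "\<eta> 0 = (c * \<phi> x + cnj (c * \<phi> x)) / 2" using pd_minus[OF \<phi>(1), of x] by (simp add: \<eta>_def)
    also have "\<dots> = of_real (2 * r) / 2" by (simp only: complex_add_cnj r_def)
    finally have \<eta>0: "\<eta> 0 = of_real r" by simp
    have "\<bar>r\<bar> \<le> 1"
      using abs_Re_le_cmod[of "c * \<phi> x"] pd_norm_le[OF \<phi>(1), of x] c \<phi>(2) by (simp add: r_def norm_mult)
    \<comment> \<open>At \<open>r = 1\<close> or \<open>r = - 1\<close> one of the two functions
      vanishes at 0 and cannot be normalised; but then it vanishes everywhere.\<close>
    then consider "r = 1" | "r = - 1" | "- 1 < r" "r < 1" by linarith
    then have "\<eta> y = of_real r * \<phi> y"
    proof cases
      case 1
      then show ?thesis using pd_zero_at_zero[OF N, of y] \<phi>(2) \<eta>0 by simp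
    next
      case 2
      then have "\<phi> y + \<eta> y = 0" using pd_zero_at_zero[OF P, of y] \<phi>(2) \<eta>0 by simp
      then show ?thesis using 2 by (simp add: add_eq_0_iff)
    next
      case 3
      define \<alpha> where "\<alpha> y = of_real (1 / (1 + r)) * (\<phi> y + \<eta> y)" for y
      define \<beta> where "\<beta> y = of_real (1 / (1 - r)) * (\<phi> y - \<eta> y)" for y
      have nz: "1 + r \<noteq> 0" "1 - r \<noteq> 0" using 3 by auto
      have nzc: "1 + complex_of_real r \<noteq> 0" "1 - complex_of_real r \<noteq> 0"
        using nz by (metis of_real_1 of_real_add of_real_eq_0_iff, metis of_real_1 of_real_diff of_real_eq_0_iff)
      have "pd \<alpha>" unfolding \<alpha>_def using 3 by (intro pd_scale[OF P]) simp
      moreover have "pd \<beta>" unfolding \<beta>_def using 3 by (intro pd_scale[OF N]) simp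
      moreover have "\<alpha> 0 = 1" "\<beta> 0 = 1"
        unfolding \<alpha>_def \<beta>_def \<phi>(2) \<eta>0 using nzc by simp_all
      ultimately have ab: "\<alpha> \<in> pd1" "\<beta> \<in> pd1" by (auto simp: pd1_def)
      have "of_real ((1 + r) / 2) * \<alpha> y + of_real (1 - (1 + r) / 2) * \<beta> y = \<phi> y" for y
      proof -
        have "of_real ((1 + r) / 2) * \<alpha> y = (\<phi> y + \<eta> y) / 2"
        proof -
          have "((1 + r) / 2) * (1 / (1 + r)) = 1 / 2" using nz by (simp add: field_simps)
          then show ?thesis by (simp only: \<alpha>_def mult.assoc[symmetric] of_real_mult[symmetric]) simp
        qed
        moreover have "of_real (1 - (1 + r) / 2) * \<beta> y = (\<phi> y - \<eta> y) / 2"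
        proof -
          have "(1 - (1 + r) / 2) * (1 / (1 - r)) = 1 / 2" using nz by (simp add: field_simps)
          then show ?thesis by (simp only: \<beta>_def mult.assoc[symmetric] of_real_mult[symmetric]) simp
        qed
        ultimately have "of_real ((1 + r) / 2) * \<alpha> y + of_real (1 - (1 + r) / 2) * \<beta> y
            = (\<phi> y + \<eta> y) / 2 + (\<phi> y - \<eta> y) / 2"
          by (simp only:)
        then show ?thesis by (simp add: add_divide_distrib diff_divide_distrib)
      qed
      then have "(\<lambda>y. of_real ((1 + r) / 2) * \<alpha> y + of_real (1 - (1 + r) / 2) * \<beta> y) \<in> {\<phi>}"
        by (simp add: fun_eq_iff)
      then have "\<alpha> = \<phi>"
        using ex[unfolded face_def, THEN conjunct2, rule_format, OF ab, of "(1 + r) / 2"] 3 by simp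
      then have "\<phi> y = of_real (1 / (1 + r)) * (\<phi> y + \<eta> y)" by (metis \<alpha>_def)
      then have "of_real (1 + r) * \<phi> y = (of_real (1 + r) * of_real (1 / (1 + r))) * (\<phi> y + \<eta> y)"
        by (simp only: mult.assoc)
      also have "of_real (1 + r) * of_real (1 / (1 + r)) = (1 :: complex)"
        using nz by (simp only: of_real_mult[symmetric]) simp
      finally show ?thesis by (simp add: algebra_simps)
    qed
    then show ?thesis by (simp add: \<eta>_def r_def)
  qed
  have mult: "\<phi> (y + x) = \<phi> x * \<phi> y" for x y
  proof -
    have "\<phi> (y + x) + \<phi> (y - x) = 2 * of_real (Re (\<phi> x)) * \<phi> y"
      using key[of 1 y x] by simp
    moreover have "\<i> * \<phi> (y + x) - \<i> * \<phi> (y - x) = - 2 * of_real (Im (\<phi> x)) * \<phi> y"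
      using key[of \<i> y x] by simp
    then have "\<i> * (\<i> * \<phi> (y + x) - \<i> * \<phi> (y - x)) = \<i> * (- 2 * of_real (Im (\<phi> x)) * \<phi> y)" by simp
    then have "\<phi> (y + x) - \<phi> (y - x) = 2 * \<i> * of_real (Im (\<phi> x)) * \<phi> y"
      by (simp add: right_diff_distrib mult.assoc[symmetric]) (simp add: algebra_simps)
    ultimately have "2 * \<phi> (y + x) = 2 * ((of_real (Re (\<phi> x)) + \<i> * of_real (Im (\<phi> x))) * \<phi> y)"
      by (simp add: algebra_simps)
    then show ?thesis by (simp flip: complex_eq)
  qed
  show "\<phi> (x + y) = \<phi> x * \<phi> y" using mult[of x y] by (simp add: mult.commute)
  have "\<phi> x * cnj (\<phi> x) = 1" using mult[of x "- x"] \<phi> by (simp add: pd_minus mult.commute)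
  then have "(norm (\<phi> x))\<^sup>2 = 1"
    by (metis complex_norm_square of_real_1 of_real_eq_iff)
  then show "norm (\<phi> x) = 1" using norm_ge_zero[of "\<phi> x"] by (auto simp: power2_eq_1_iff)
qed

lemma continuous_on_qavg:
  "continuous_on UNIV (\<lambda>\<phi>. qavg I h (\<lambda>x. of_real (F x) * \<phi> x))"
proof -
  have "continuous_on UNIV (\<lambda>\<phi>::'a \<Rightarrow> complex. \<phi> x)" for x
    by (rule continuous_on_product_coordinates)
  then show ?thesis unfolding qavg_def divide_inverse by (intro continuous_intros)
qed

text \<open>The \<open>\<phi>\<close> maximising \<open>qinf (F * \<phi>)\<close> form a face; an extreme point of it is an extreme
  normalised positive definite function, hence multiplicative.\<close>

lemma ex_character:
  fixes F :: "'g::ab_group_add \<Rightarrow> real"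
  assumes spd: "\<And>\<phi>. pd \<phi> \<Longrightarrow> pd (\<lambda>x. of_real (F x) * \<phi> x)"
    and \<phi>0: "\<phi>0 \<in> pd1" "qinf (\<lambda>x. of_real (F x) * \<phi>0 x) > 0"
  shows "\<exists>\<kappa>. (\<forall>x y. \<kappa> (x + y) = \<kappa> x * \<kappa> y) \<and> (\<forall>x. norm (\<kappa> x) = 1) \<and>
    qinf (\<lambda>x. of_real (F x) * \<kappa> x) > 0 \<and> pd \<kappa>"
proof -
  define L where "L \<phi> = qinf (\<lambda>x. of_real (F x) * \<phi> x)" for \<phi>
  define Q where "Q n h \<phi> = qavg {..<n::nat} h (\<lambda>x. of_real (F x) * \<phi> x)" for n h \<phi>
  have LQ: "L \<phi> \<le> Q n h \<phi>" if "\<phi> \<in> pd1" "n > 0" for \<phi> n h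
    unfolding L_def Q_def by (rule qinf_le) (use that spd in \<open>auto simp: pd1_def\<close>)
  have QL: "c \<le> L \<phi>" if "\<And>n h. n > 0 \<Longrightarrow> c \<le> Q n h \<phi>" for c \<phi>
    unfolding L_def by (rule qinf_ge) (use that in \<open>simp add: Q_def\<close>)
  have "L \<phi> \<le> F 0" if "\<phi> \<in> pd1" for \<phi>
    using LQ[OF that, of 1 "\<lambda>_. 0"] that by (simp add: Q_def qavg_def pd1_def)
  then have bdd: "bdd_above (L ` pd1)" by (auto simp: bdd_above_def)
  define s where "s = (SUP \<phi>\<in>pd1. L \<phi>)"
  have Ls: "L \<phi> \<le> s" if "\<phi> \<in> pd1" for \<phi> unfolding s_def by (rule cSUP_upper[OF that bdd])
  \<comment> \<open>\<open>L\<close> is an infimum of continuous functions and need not be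
    continuous. Written through all finite averages, each \<open>D k\<close> is nevertheless closed,
    and the maximisers of \<open>L\<close> are the intersection of the \<open>D k\<close>.\<close>
  define D where "D k = {\<phi> \<in> pd1. \<forall>n h. n > 0 \<longrightarrow> s - inverse (real (Suc k)) \<le> Q n h \<phi>}" for k
  define E where "E = {\<phi> \<in> pd1. s \<le> L \<phi>}"
  have clD: "closed (D k)" for k
  proof -
    have eq: "D k = pd1 \<inter> {\<phi>. \<forall>n h. n > 0 \<longrightarrow> s - inverse (real (Suc k)) \<le> Q n h \<phi>}" by (auto simp: D_def)
    have c2: "closed {\<phi>. \<forall>n h. n > 0 \<longrightarrow> s - inverse (real (Suc k)) \<le> Q n h \<phi>}"
      unfolding Q_def
      by (intro closed_Collect_all closed_Collect_imp open_Collect_const closed_Collect_le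
          continuous_on_const continuous_on_qavg)
    show ?thesis unfolding eq by (rule closed_Int[OF closed_pd1 c2])
  qed
  have Ieq: "pd1 \<inter> \<Inter> (D ` UNIV) = E"
  proof (intro equalityI subsetI)
    fix \<phi> assume \<phi>: "\<phi> \<in> pd1 \<inter> \<Inter> (D ` UNIV)"
    have "s \<le> Q n h \<phi>" if "n > 0" for n h
    proof -
      have "s - inverse (real (Suc k)) \<le> Q n h \<phi>" for k
        using \<phi> that by (auto simp: D_def)
      then have "s - 0 \<le> Q n h \<phi>"
        by (intro LIMSEQ_le_const2[OF tendsto_diff[OF tendsto_const LIMSEQ_inverse_real_of_nat]]) auto
      then show ?thesis by simp
    qed
    then show "\<phi> \<in> E" using QL \<phi> by (auto simp: E_def)
  next
    fix \<phi> assume "\<phi> \<in> E"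
    then have "s \<le> Q n h \<phi>" if "n > 0" for n h using LQ[of \<phi> n h] that by (simp add: E_def)
    then have "s - inverse (real (Suc k)) \<le> Q n h \<phi>" if "n > 0" for n h k
      using that by (meson diff_le_eq dual_order.trans inverse_nonnegative_iff_nonnegative
          le_add_same_cancel1 of_nat_0_le_iff)
    then show "\<phi> \<in> pd1 \<inter> \<Inter> (D ` UNIV)" using \<open>\<phi> \<in> E\<close> by (auto simp: D_def E_def)
  qed
  have "pd1 \<inter> \<Inter> (D ` UNIV) \<noteq> {}"
  proof (rule compact_imp_fip_image[OF compact_pd1])
    fix I :: "nat set" assume I: "finite I" "I \<subseteq> UNIV"
    define k where "k = Max (insert 0 I)"
    obtain \<phi> where \<phi>: "\<phi> \<in> pd1" "s - inverse (real (Suc k)) < L \<phi>"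
      using less_cSUP_iff[OF _ bdd, of "s - inverse (real (Suc k))"] \<phi>0(1) by (auto simp: s_def)
    have "\<phi> \<in> D i" if "i \<in> I" for i
    proof -
      have "i \<le> k" unfolding k_def using I that by (intro Max_ge) auto
      then have "inverse (real (Suc k)) \<le> inverse (real (Suc i))" by simp
      then have "s - inverse (real (Suc i)) \<le> L \<phi>" using \<phi>(2) by linarith
      then show ?thesis using LQ[OF \<phi>(1)] \<phi>(1) by (auto simp: D_def intro: order_trans)
    qed
    then show "pd1 \<inter> \<Inter> (D ` I) \<noteq> {}" using \<phi> by blast
  qed (use clD in auto)
  then have "E \<noteq> {}" using Ieq by simp
  moreover have "closed E" unfolding Ieq[symmetric] using clD closed_pd1 by (intro closed_Int closed_INT) auto
  moreover have "face E"
    unfolding face_def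
  proof (intro conjI ballI allI impI)
    show "E \<subseteq> pd1" by (auto simp: E_def)
    fix \<alpha> \<beta> :: "'g \<Rightarrow> complex" and t :: real
    assume ab: "\<alpha> \<in> pd1" "\<beta> \<in> pd1" and t: "0 < t" "t < 1"
      and "(\<lambda>x. of_real t * \<alpha> x + of_real (1 - t) * \<beta> x) \<in> E"
    then have "s \<le> L (\<lambda>x. of_real t * \<alpha> x + of_real (1 - t) * \<beta> x)" by (simp add: E_def)
    also have "\<dots> = qinf (\<lambda>x. of_real t * (of_real (F x) * \<alpha> x) + of_real (1 - t) * (of_real (F x) * \<beta> x))"
      unfolding L_def by (simp only: distrib_left mult.left_commute)
    also have "\<dots> \<le> t * L \<alpha> + (1 - t) * L \<beta>"
      unfolding L_def by (rule qinf_mix_le) (use ab t spd in \<open>auto simp: pd1_def\<close>)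
    finally have "t * (s - L \<alpha>) + (1 - t) * (s - L \<beta>) \<le> 0" by (simp add: algebra_simps)
    moreover have "0 \<le> t * (s - L \<alpha>)" "0 \<le> (1 - t) * (s - L \<beta>)" using Ls ab t by auto
    ultimately have "t * (s - L \<alpha>) = 0" "(1 - t) * (s - L \<beta>) = 0" by linarith+
    then show "\<alpha> \<in> E" "\<beta> \<in> E" using t ab by (auto simp: E_def)
  qed
  ultimately obtain \<kappa> where \<kappa>: "\<kappa> \<in> E" "face {\<kappa>}"
    using face_contains_extreme by blast
  have "0 < L \<kappa>" using \<kappa>(1) Ls[OF \<phi>0(1)] \<phi>0(2) by (auto simp: E_def L_def)
  moreover have "pd \<kappa>" using \<kappa>(1) by (simp add: E_def pd1_def)
  ultimately show ?thesis
    using extreme_pd_multiplicative[OF \<kappa>(2)] unfolding L_def by (intro exI[of _ \<kappa>]) simp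
qed

text \<open>Uniform continuity passes from \<open>F\<close> to \<open>\<kappa>\<close>. Let
  \<open>A\<close> be the double sum for a nearly optimal family and \<open>B\<close> the one with
  all differences shifted by \<open>x\<close>. Since the family doubled by its translate cannot do
  better than the infimum, \<open>Re B\<close> stays near \<open>Re A\<close>; on the other hand
  \<open>B\<close> differs from \<open>\<kappa> x * A\<close> by at most \<open>\<delta>\<close> per
  term.\<close>

lemma character_oscillation:
  fixes F :: "'g::ab_group_add \<Rightarrow> real"
  assumes mult: "\<And>x y. \<kappa> (x + y) = \<kappa> x * \<kappa> y" and nrm: "\<And>x. norm (\<kappa> x) = 1"
    and pdF: "pd (\<lambda>x. of_real (F x) * \<kappa> x)"
    and pos: "0 \<le> qinf (\<lambda>x. of_real (F x) * \<kappa> x)"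
    and \<delta>: "\<And>y. \<bar>F (y + x) - F y\<bar> \<le> \<delta>"
  shows "qinf (\<lambda>x. of_real (F x) * \<kappa> x) * (1 - Re (\<kappa> x)) \<le> \<delta>"
proof (rule field_le_epsilon)
  fix e :: real assume "e > 0"
  define \<psi> where "\<psi> x = of_real (F x) * \<kappa> x" for x
  define c where "c = qinf \<psi>"
  have pd: "pd \<psi>" using pdF by (simp add: \<psi>_def[abs_def])
  obtain n :: nat and h where h: "n > 0" "qavg {..<n} h \<psi> < c + e / 2"
    unfolding c_def using qinf_approx[of "e / 2"] \<open>e > 0\<close> by auto
  define A where "A = (\<Sum>i<n. \<Sum>j<n. \<psi> (h i - h j))"
  define B where "B = (\<Sum>i<n. \<Sum>j<n. \<psi> (h i - h j + x))"
  have B': "(\<Sum>i<n. \<Sum>j<n. \<psi> (h i - h j - x)) = cnj B"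
  proof -
    have "(\<Sum>i<n. \<Sum>j<n. \<psi> (h i - h j - x)) = (\<Sum>i<n. \<Sum>j<n. \<psi> (- (h j - h i + x)))"
      by (intro sum.cong refl) (simp add: algebra_simps)
    also have "\<dots> = cnj (\<Sum>i<n. \<Sum>j<n. \<psi> (h j - h i + x))"
      by (simp only: pd_minus[OF pd] cnj_sum)
    also have "(\<Sum>i<n. \<Sum>j<n. \<psi> (h j - h i + x)) = B" unfolding B_def by (rule sum.swap)
    finally show ?thesis .
  qed
  have "cnj A = (\<Sum>i<n. \<Sum>j<n. \<psi> (- (h i - h j)))"
    unfolding A_def by (simp only: pd_minus[OF pd] cnj_sum)
  also have "\<dots> = (\<Sum>i<n. \<Sum>j<n. \<psi> (h j - h i))" by simp
  also have "\<dots> = A" unfolding A_def by (rule sum.swap)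
  finally have ImA: "Im A = 0" by (simp add: complex_eq_iff)
  let ?J = "{..<n} \<times> {True, False}" and ?x = "\<lambda>p::nat \<times> bool. if snd p then h (fst p) + x else h (fst p)"
  have "c \<le> qavg ?J ?x \<psi>"
    unfolding c_def by (rule qinf_le[OF pd]) (use h(1) in auto)
  also have "(\<Sum>p\<in>?J. \<Sum>q\<in>?J. \<psi> (?x p - ?x q)) = A + A + B + (\<Sum>i<n. \<Sum>j<n. \<psi> (h i - h j - x))"
    unfolding A_def B_def
    by (simp add: sum.cartesian_product' sum.distrib algebra_simps)
  then have "(\<Sum>p\<in>?J. \<Sum>q\<in>?J. \<psi> (?x p - ?x q)) = A + A + B + cnj B" unfolding B' .
  then have "qavg ?J ?x \<psi> = (2 * Re A + 2 * Re B) / (real n * 2)\<^sup>2"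
    by (simp add: qavg_def card_cartesian_product power_mult_distrib add.commute mult.commute)
  finally have cAB: "2 * c * (real n)\<^sup>2 \<le> Re A + Re B"
    using h(1) by (simp add: pos_le_divide_eq power_mult_distrib)
  have q1: "Re A \<le> (c + e / 2) * (real n)\<^sup>2"
    using h by (simp add: qavg_def A_def pos_divide_less_eq)
  have q2: "c * (real n)\<^sup>2 \<le> Re A"
  proof -
    have "c \<le> qavg {..<n} h \<psi>" unfolding c_def by (rule qinf_le[OF pd]) (use h(1) in auto)
    then show ?thesis using h(1) by (simp add: qavg_def A_def pos_le_divide_eq)
  qed
  have "norm (B - \<kappa> x * A) \<le> (\<Sum>i<n. \<Sum>j<n. \<delta>)"
  proof -
    have shift: "\<psi> (u + x) - \<kappa> x * \<psi> u = \<kappa> x * \<kappa> u * of_real (F (u + x) - F u)" for u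
      by (simp only: \<psi>_def mult of_real_diff) (simp add: algebra_simps)
    have "B - \<kappa> x * A = (\<Sum>i<n. \<Sum>j<n. \<psi> (h i - h j + x) - \<kappa> x * \<psi> (h i - h j))"
      by (simp add: A_def B_def sum_distrib_left sum_subtractf)
    also have "\<dots> = (\<Sum>i<n. \<Sum>j<n. \<kappa> x * \<kappa> (h i - h j) * of_real (F (h i - h j + x) - F (h i - h j)))"
      by (simp only: shift)
    also have "norm \<dots> \<le> (\<Sum>i<n. \<Sum>j<n. \<delta>)"
    proof (intro sum_norm_le)
      fix i j
      show "norm (\<kappa> x * \<kappa> (h i - h j) * of_real (F (h i - h j + x) - F (h i - h j))) \<le> \<delta>"
        using \<delta> by (simp only: norm_mult nrm norm_of_real mult_1)
    qed
    finally show ?thesis .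
  qed
  then have "Re (B - \<kappa> x * A) \<le> \<delta> * (real n)\<^sup>2"
    using complex_Re_le_cmod[of "B - \<kappa> x * A"] by (simp add: power2_eq_square mult_ac)
  then have "Re B \<le> Re (\<kappa> x) * Re A + \<delta> * (real n)\<^sup>2" using ImA by simp
  then have "(1 - Re (\<kappa> x)) * Re A \<le> (\<delta> + e) * (real n)\<^sup>2"
    using cAB q1 by (simp add: algebra_simps)
  moreover have "(1 - Re (\<kappa> x)) * (c * (real n)\<^sup>2) \<le> (1 - Re (\<kappa> x)) * Re A"
    using q2 complex_Re_le_cmod[of "\<kappa> x"] nrm by (intro mult_left_mono) auto
  ultimately have "(c * (1 - Re (\<kappa> x))) * (real n)\<^sup>2 \<le> (\<delta> + e) * (real n)\<^sup>2"
    by (simp add: mult_ac)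
  then have "c * (1 - Re (\<kappa> x)) \<le> \<delta> + e" using h(1) by simp
  then show "qinf (\<lambda>x. of_real (F x) * \<kappa> x) * (1 - Re (\<kappa> x)) \<le> \<delta> + e"
    by (simp add: c_def \<psi>_def[abs_def])
qed

text \<open>The \<open>h i\<close> fall into \<open>card A\<close> cells, each inside a translate of
  \<open>V\<close>, and a pair within one cell contributes at least \<open>c\<close>. By
  Cauchy-Schwarz at least the fraction \<open>1 / card A\<close> of all pairs lies within
  cells.\<close>

lemma qavg_ge_if_cover:
  fixes \<psi> :: "'g::ab_group_add \<Rightarrow> complex"
  assumes A: "finite A" "\<And>x. \<exists>a\<in>A. x - a \<in> V"
    and nonneg: "\<And>x. 0 \<le> Re (\<psi> x)" and c: "\<And>x y. x \<in> V \<Longrightarrow> y \<in> V \<Longrightarrow> c \<le> Re (\<psi> (x - y))" "0 \<le> c"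
    and n: "n > 0"
  shows "c / real (card A) \<le> qavg {..<n::nat} h \<psi>"
proof -
  obtain cell where cell: "\<And>x. cell x \<in> A" "\<And>x. x - cell x \<in> V" using A(2) by metis
  have cA: "card A > 0" using A by (metis card_gt_0_iff empty_iff)
  define N where "N a = {i. i < n \<and> cell (h i) = a}" for a
  have fN: "finite (N a)" for a by (simp add: N_def)
  have U: "(\<Union>a\<in>A. N a) = {..<n}" using cell by (auto simp: N_def)
  have sumN: "(\<Sum>a\<in>A. real (card (N a))) = real n"
  proof -
    have "card (\<Union>a\<in>A. N a) = (\<Sum>a\<in>A. card (N a))"
      by (rule card_UN_disjoint) (auto simp: A(1) N_def)
    then show ?thesis unfolding U by (metis card_lessThan of_nat_sum)
  qed
  have "(real n)\<^sup>2 \<le> (\<Sum>a\<in>A. (real (card (N a)))\<^sup>2) * real (card A)"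
    using sum_squared_le_sum_of_squares[of "\<lambda>a. real (card (N a))" A] sumN by (simp add: mult.commute)
  then have "c * (real n)\<^sup>2 \<le> c * ((\<Sum>a\<in>A. (real (card (N a)))\<^sup>2) * real (card A))"
    using c(2) by (rule mult_left_mono)
  also have "c * ((\<Sum>a\<in>A. (real (card (N a)))\<^sup>2) * real (card A)) = (\<Sum>a\<in>A. \<Sum>i\<in>N a. \<Sum>j\<in>N a. c) * real (card A)"
    by (simp add: sum_distrib_left power2_eq_square mult_ac)
  also have "\<dots> \<le> Re (\<Sum>i<n. \<Sum>j<n. \<psi> (h i - h j)) * real (card A)"
  proof (intro mult_right_mono)
    have "(\<Sum>a\<in>A. \<Sum>i\<in>N a. \<Sum>j\<in>N a. c) \<le> (\<Sum>a\<in>A. \<Sum>i\<in>N a. \<Sum>j<n. Re (\<psi> (h i - h j)))"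
    proof (intro sum_mono)
      fix a i assume i: "i \<in> N a"
      have "c \<le> Re (\<psi> (h i - h j))" if "j \<in> N a" for j
        using c(1)[OF cell(2)[of "h i"] cell(2)[of "h j"]] i that by (simp add: N_def)
      then have "(\<Sum>j\<in>N a. c) \<le> (\<Sum>j\<in>N a. Re (\<psi> (h i - h j)))" by (intro sum_mono)
      also have "\<dots> \<le> (\<Sum>j<n. Re (\<psi> (h i - h j)))"
        by (rule sum_mono2) (use nonneg in \<open>auto simp: N_def\<close>)
      finally show "(\<Sum>j\<in>N a. c) \<le> (\<Sum>j<n. Re (\<psi> (h i - h j)))" .
    qed
    also have "\<dots> = (\<Sum>i\<in>(\<Union>a\<in>A. N a). \<Sum>j<n. Re (\<psi> (h i - h j)))"
      by (rule sum.UNION_disjoint[symmetric]) (auto simp: A(1) fN, auto simp: N_def)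
    also have "\<dots> = Re (\<Sum>i<n. \<Sum>j<n. \<psi> (h i - h j))" unfolding U by simp
    finally show "(\<Sum>a\<in>A. \<Sum>i\<in>N a. \<Sum>j\<in>N a. c) \<le> Re (\<Sum>i<n. \<Sum>j<n. \<psi> (h i - h j))" .
  qed simp
  finally show ?thesis
    using cA n by (simp add: qavg_def field_simps)
qed

section \<open>Pseudonorms and precompactness\<close>

text \<open>What \<open>group_topology\<close> means for a free abelian group whose carrier is its
  whole type; the converse direction is transported to such a group.\<close>

definition top_grp :: "'g::ab_group_add topology \<Rightarrow> bool" where
  "top_grp T \<longleftrightarrow> topspace T = UNIV \<and> Hausdorff_space T \<and>
     continuous_map (prod_topology T T) T (\<lambda>(x, y). x + y) \<and> continuous_map T T uminus"

locale abelian_top_grp =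
  fixes T :: "'g::ab_group_add topology"
  assumes tg: "top_grp T"
begin

lemma top: "topspace T = UNIV" and haus: "Hausdorff_space T"
  and cont_add: "continuous_map (prod_topology T T) T (\<lambda>(x, y). x + y)"
  and cont_minus: "continuous_map T T uminus"
  using tg by (auto simp: top_grp_def)

lemma continuous_map_shift: "continuous_map T T (\<lambda>x. x + a)"
proof -
  have "continuous_map T (prod_topology T T) (\<lambda>x. (x, a))"
    by (simp add: continuous_map_pairwise o_def top)
  from continuous_map_compose[OF this cont_add] show ?thesis by (simp add: o_def)
qed

lemma open_shift: "openin T U \<Longrightarrow> openin T {x. x + a \<in> U}"
  using openin_continuous_map_preimage[OF continuous_map_shift, of U a] by (simp add: top)

lemma open_uminus: "openin T U \<Longrightarrow> openin T {x. - x \<in> U}"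
  using openin_continuous_map_preimage[OF cont_minus, of U] by (simp add: top)

definition nbhd0 :: "'g set \<Rightarrow> bool" where "nbhd0 U \<longleftrightarrow> openin T U \<and> 0 \<in> U"

lemma nbhd0_UNIV: "nbhd0 UNIV"
  using openin_topspace[of T] by (simp add: nbhd0_def top)

lemma nbhd0_Int: "nbhd0 U \<Longrightarrow> nbhd0 V \<Longrightarrow> nbhd0 (U \<inter> V)"
  by (auto simp: nbhd0_def)

lemma nbhd0_add:
  assumes "nbhd0 U"
  obtains V where "nbhd0 V" "\<And>x y. x \<in> V \<Longrightarrow> y \<in> V \<Longrightarrow> x + y \<in> U" "\<And>x. x \<in> V \<Longrightarrow> - x \<in> V"
proof -
  have opn: "openin (prod_topology T T) {p. (case p of (x, y) \<Rightarrow> x + y) \<in> U}"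
    using openin_continuous_map_preimage[OF cont_add, of U] assms by (simp add: top nbhd0_def)
  have z: "(0, 0) \<in> {p. (case p of (x, y) \<Rightarrow> x + y) \<in> U}" using assms by (simp add: nbhd0_def)
  from openin_prod_topology_alt[THEN iffD1, rule_format, OF opn z]
  obtain A B where AB: "openin T A" "openin T B" "0 \<in> A" "0 \<in> B"
    "A \<times> B \<subseteq> {p. (case p of (x, y) \<Rightarrow> x + y) \<in> U}"
    by blast
  define V where "V = (A \<inter> B) \<inter> {x. - x \<in> A \<inter> B}"
  have "nbhd0 V" using AB open_uminus[of "A \<inter> B"] by (auto simp: nbhd0_def V_def)
  moreover have "x + y \<in> U" if "x \<in> V" "y \<in> V" for x y using that AB(5) by (auto simp: V_def)
  moreover have "- x \<in> V" if "x \<in> V" for x using that by (auto simp: V_def)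
  ultimately show ?thesis using that by blast
qed

lemma nbhd0_add3:
  assumes "nbhd0 U"
  obtains V where "nbhd0 V" "\<And>x y z. x \<in> V \<Longrightarrow> y \<in> V \<Longrightarrow> z \<in> V \<Longrightarrow> x + y + z \<in> U"
    "\<And>x. x \<in> V \<Longrightarrow> - x \<in> V"
proof -
  obtain V where V: "nbhd0 V" "\<And>x y. x \<in> V \<Longrightarrow> y \<in> V \<Longrightarrow> x + y \<in> U" "\<And>x. x \<in> V \<Longrightarrow> - x \<in> V"
    using nbhd0_add[OF assms] by metis
  obtain W where W: "nbhd0 W" "\<And>x y. x \<in> W \<Longrightarrow> y \<in> W \<Longrightarrow> x + y \<in> V" "\<And>x. x \<in> W \<Longrightarrow> - x \<in> W"
    using nbhd0_add[OF V(1)] by metis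
  have "z \<in> V" if "z \<in> W" for z using W(2)[of z 0] that W(1) by (auto simp: nbhd0_def)
  then have "x + y + z \<in> U" if "x \<in> W" "y \<in> W" "z \<in> W" for x y z using V(2) W(2) that by blast
  then show ?thesis using that W by blast
qed

definition unif_cont :: "('g \<Rightarrow> real) \<Rightarrow> bool" where
  "unif_cont f \<longleftrightarrow> (\<forall>e>0. \<exists>V. nbhd0 V \<and> (\<forall>x\<in>V. \<forall>y. \<bar>f (y + x) - f y\<bar> < e))"

lemma openin_if_nbhd:
  assumes "\<And>y. y \<in> U \<Longrightarrow> \<exists>V. nbhd0 V \<and> (\<forall>x\<in>V. y + x \<in> U)"
  shows "openin T U"
proof (subst openin_subopen, intro ballI)
  fix y assume "y \<in> U"
  then obtain V where V: "nbhd0 V" "\<forall>x\<in>V. y + x \<in> U" using assms by blast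
  have "openin T {x. x + (- y) \<in> V}" using V(1) by (intro open_shift) (simp add: nbhd0_def)
  moreover have "y \<in> {x. x + (- y) \<in> V}" using V(1) by (simp add: nbhd0_def)
  moreover have "{x. x + (- y) \<in> V} \<subseteq> U"
  proof
    fix x assume "x \<in> {x. x + (- y) \<in> V}"
    then have "y + (x - y) \<in> U" using V(2) by auto
    then show "x \<in> U" by simp
  qed
  ultimately show "\<exists>S. openin T S \<and> y \<in> S \<and> S \<subseteq> U" by blast
qed

lemma nbhd0_if_open: "openin T U \<Longrightarrow> y \<in> U \<Longrightarrow> \<exists>V. nbhd0 V \<and> (\<forall>x\<in>V. y + x \<in> U)"
  using open_shift[of U y] by (intro exI[of _ "{x. x + y \<in> U}"]) (auto simp: nbhd0_def add.commute)

lemma continuous_if_local: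
  fixes f :: "'g \<Rightarrow> 'b::metric_space"
  assumes "\<And>y e. e > 0 \<Longrightarrow> \<exists>V. nbhd0 V \<and> (\<forall>x\<in>V. dist (f (y + x)) (f y) < e)"
  shows "continuous_map T euclidean f"
  unfolding continuous_map_def
proof (intro conjI allI impI)
  fix U :: "'b set" assume "openin euclidean U"
  show "openin T {x \<in> topspace T. f x \<in> U}"
  proof (rule openin_if_nbhd)
    fix y assume "y \<in> {x \<in> topspace T. f x \<in> U}"
    then obtain e where e: "e > 0" "\<And>z. dist z (f y) < e \<Longrightarrow> z \<in> U"
      using \<open>openin euclidean U\<close> by (auto simp: open_dist)
    then show "\<exists>V. nbhd0 V \<and> (\<forall>x\<in>V. y + x \<in> {x \<in> topspace T. f x \<in> U})"
      using assms[OF e(1), of y] by (auto simp: top)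
  qed
qed simp

lemma local_if_continuous:
  fixes f :: "'g \<Rightarrow> 'b::metric_space"
  assumes "continuous_map T euclidean f" "e > 0"
  shows "\<exists>V. nbhd0 V \<and> (\<forall>x\<in>V. dist (f (y + x)) (f y) < e)"
proof -
  have "openin T {x \<in> topspace T. f x \<in> ball (f y) e}"
    by (rule openin_continuous_map_preimage[OF assms(1)]) simp
  then show ?thesis using nbhd0_if_open[of _ y] assms(2) by (force simp: top dist_commute)
qed

lemma unif_cont_continuous: "unif_cont f \<Longrightarrow> continuous_map T euclideanreal f"
  by (rule continuous_if_local) (force simp: unif_cont_def dist_real_def)

definition pnorm :: "('g \<Rightarrow> real) \<Rightarrow> bool" where
  "pnorm d \<longleftrightarrow> d 0 = 0 \<and> (\<forall>x. 0 \<le> d x) \<and> (\<forall>x. d (- x) = d x) \<and> (\<forall>x y. d (x + y) \<le> d x + d y) \<and>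
     (\<forall>e>0. \<exists>V. nbhd0 V \<and> (\<forall>x\<in>V. d x < e))"

text \<open>The summand at which the running cost passes \<open>c\<close>. Cutting at half the total
  leaves two outer parts that each cost at most half.\<close>

lemma list_split_at_cost:
  fixes w :: "'c \<Rightarrow> real"
  assumes "0 \<le> c" "c < sum_list (map w l)"
  shows "\<exists>l1 x l2. l = l1 @ x # l2 \<and> sum_list (map w l1) \<le> c \<and> c < sum_list (map w l1) + w x"
  using assms(2)
proof (induction l rule: rev_induct)
  case Nil
  then show ?case using assms(1) by simp
next
  case (snoc y l)
  show ?case
  proof (cases "c < sum_list (map w l)")
    case True
    then obtain l1 x l2 where "l = l1 @ x # l2" "sum_list (map w l1) \<le> c" "c < sum_list (map w l1) + w x"
      using snoc.IH by blast
    then show ?thesis by (intro exI[of _ l1] exI[of _ x] exI[of _ "l2 @ [y]"]) simp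
  next
    case False
    then show ?thesis using snoc.prems by (intro exI[of _ l] exI[of _ y] exI[of _ "[]"]) simp
  qed
qed

text \<open>The Birkhoff--Kakutani chain argument, with decompositions represented as lists of summands and their levels.\<close>

lemma ex_pnorm:
  assumes "nbhd0 U"
  obtains d where "pnorm d" "\<And>x. d x < 1/2 \<Longrightarrow> x \<in> U"
proof -
  \<comment> \<open>\<open>V 0 = UNIV\<close> gives every element a decomposition, so that the
    infimum defining \<open>d\<close> is over a non-empty set. Sums of three match the cut of a list
    into two parts and a middle summand.\<close>
  have "\<exists>V. \<forall>n. (nbhd0 (V n) \<and> (\<forall>x\<in>V n. - x \<in> V n) \<and> (n = 1 \<longrightarrow> V n \<subseteq> U) \<and> (n = 0 \<longrightarrow> V n = UNIV)) \<and>
     (\<forall>x\<in>V (Suc n). \<forall>y\<in>V (Suc n). \<forall>z\<in>V (Suc n). x + y + z \<in> V n)"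
  proof (rule dependent_nat_choice)
    show "\<exists>V. nbhd0 V \<and> (\<forall>x\<in>V. - x \<in> V) \<and> (0 = (1::nat) \<longrightarrow> V \<subseteq> U) \<and> ((0::nat) = 0 \<longrightarrow> V = UNIV)"
      using nbhd0_UNIV by (intro exI[of _ UNIV]) simp
    fix V and n :: nat
    assume V: "nbhd0 V \<and> (\<forall>x\<in>V. - x \<in> V) \<and> (n = 1 \<longrightarrow> V \<subseteq> U) \<and> (n = 0 \<longrightarrow> V = UNIV)"
    then have VU: "nbhd0 (V \<inter> U)" using assms nbhd0_Int by blast
    obtain W where W: "nbhd0 W" "\<And>x y z. x \<in> W \<Longrightarrow> y \<in> W \<Longrightarrow> z \<in> W \<Longrightarrow> x + y + z \<in> V \<inter> U"
      "\<And>x. x \<in> W \<Longrightarrow> - x \<in> W"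
      using nbhd0_add3[OF VU] by metis
    have "W \<subseteq> U"
    proof
      fix x assume "x \<in> W"
      then have "x + 0 + 0 \<in> V \<inter> U" using W(1) by (intro W(2)) (auto simp: nbhd0_def)
      then show "x \<in> U" by simp
    qed
    then show "\<exists>W. (nbhd0 W \<and> (\<forall>x\<in>W. - x \<in> W) \<and> (Suc n = 1 \<longrightarrow> W \<subseteq> U) \<and> (Suc n = 0 \<longrightarrow> W = UNIV)) \<and>
       (\<forall>x\<in>W. \<forall>y\<in>W. \<forall>z\<in>W. x + y + z \<in> V)"
      using W by (intro exI[of _ W]) auto
  qed
  then obtain V where V: "\<And>n. nbhd0 (V n)" "\<And>n x. x \<in> V n \<Longrightarrow> - x \<in> V n" "V 1 \<subseteq> U" "V 0 = UNIV"
    "\<And>n x y z. x \<in> V (Suc n) \<Longrightarrow> y \<in> V (Suc n) \<Longrightarrow> z \<in> V (Suc n) \<Longrightarrow> x + y + z \<in> V n"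
    by metis
  have V0: "0 \<in> V n" for n using V(1) by (simp add: nbhd0_def)
  have "V (Suc n) \<subseteq> V n" for n
  proof
    fix x assume "x \<in> V (Suc n)"
    then show "x \<in> V n" using V(5)[of x n 0 0] V0 by simp
  qed
  then have mono: "V n \<subseteq> V m" if "m \<le> n" for m n using lift_Suc_antimono_le[of V m n] that by blast
  define w where "w p = (1/2 :: real) ^ fst p" for p :: "nat \<times> 'g"
  define cost where "cost l = sum_list (map w l)" for l
  define tot where "tot l = sum_list (map snd l)" for l :: "(nat \<times> 'g) list"
  define ok where "ok l \<longleftrightarrow> (\<forall>p\<in>set l. snd p \<in> V (fst p))" for l
  have wpos: "0 < w p" for p by (simp add: w_def)
  have cost0: "0 \<le> cost l" for l unfolding cost_def by (intro sum_list_nonneg) (auto intro: less_imp_le wpos)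
  \<comment> \<open>The outer parts cost at most half and fall to the induction hypothesis at
    \<open>Suc m\<close>. The middle summand costs less than \<open>(1/2) ^ m\<close>, so its own
    level exceeds \<open>m\<close>.\<close>
  have chain: "tot l \<in> V m" if "ok l" "cost l < (1/2) ^ m" for l m
    using that
  proof (induction l arbitrary: m rule: length_induct)
    case (1 l)
    show ?case
    proof (cases "l = []")
      case True
      then show ?thesis using V0 by (simp add: tot_def)
    next
      case False
      then obtain p l' where "l = p # l'" by (cases l) auto
      then have pos: "0 < cost l" using wpos[of p] cost0[of l'] by (simp add: cost_def)
      then obtain l1 x l2 where l: "l = l1 @ x # l2" and c1: "cost l1 \<le> cost l / 2" and c2: "cost l / 2 < cost l1 + w x"
        using list_split_at_cost[of "cost l / 2" w l] unfolding cost_def by auto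
      have cl: "cost l = cost l1 + w x + cost l2" by (simp add: l cost_def)
      have half: "cost l / 2 < (1/2) ^ Suc m" using 1(3) by simp
      have "tot l1 \<in> V (Suc m)" using 1(1)[rule_format, of l1 "Suc m"] 1(2) c1 half by (auto simp: l ok_def)
      moreover have "tot l2 \<in> V (Suc m)"
        using 1(1)[rule_format, of l2 "Suc m"] 1(2) c2 cl half by (auto simp: l ok_def)
      moreover have "snd x \<in> V (Suc m)"
      proof -
        have "w x < (1/2) ^ m" using 1(3) cl cost0[of l1] cost0[of l2] by linarith
        then have "m < fst x" unfolding w_def
          by (metis not_less power_decreasing half_gt_zero_iff less_eq_real_def zero_less_one
              divide_le_eq_1_pos one_le_numeral zero_less_numeral linorder_not_less)
        then show ?thesis using 1(2) mono[of "Suc m" "fst x"] by (auto simp: l ok_def)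
      qed
      ultimately have "tot l1 + snd x + tot l2 \<in> V m" by (intro V(5))
      then show ?thesis by (simp add: l tot_def add.assoc)
    qed
  qed
  define d where "d x = Inf {cost l | l. ok l \<and> tot l = x}" for x
  have dle: "d x \<le> cost l" if "ok l" "tot l = x" for x l
    unfolding d_def by (rule cInf_lower) (use that cost0 in \<open>auto simp: bdd_below_def\<close>)
  have single: "ok [(n, x)]" "tot [(n, x)] = x" "cost [(n, x)] = (1/2) ^ n" if "x \<in> V n" for n x
    using that by (auto simp: ok_def tot_def cost_def w_def)
  have dge: "c \<le> d x" if "\<And>l. ok l \<Longrightarrow> tot l = x \<Longrightarrow> c \<le> cost l" for c x
    unfolding d_def
  proof (rule cInf_greatest)
    show "{cost l | l. ok l \<and> tot l = x} \<noteq> {}" using single[of x 0] V(4) by blast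
  qed (use that in auto)
  have dap: "\<exists>l. ok l \<and> tot l = x \<and> cost l < d x + e" if "e > 0" for e x
    using dge[of x "d x + e"] that by (meson add_le_same_cancel1 not_le)
  have "pnorm d"
    unfolding pnorm_def
  proof (intro conjI allI impI)
    show nonneg: "0 \<le> d x" for x using dge[of x 0] cost0 by blast
    have "d 0 \<le> 0" using dle[of "[]" 0] by (simp add: ok_def tot_def cost_def)
    then show "d 0 = 0" using nonneg[of 0] by simp
    have sym: "d (- x) \<le> d x" for x
    proof (rule dge)
      fix l assume l: "ok l" "tot l = x"
      let ?l = "map (\<lambda>(n, y). (n, - y)) l"
      have "ok ?l" using l(1) V(2) by (auto simp: ok_def)
      moreover have "tot ?l = - tot l" unfolding tot_def by (induction l) auto
      moreover have "cost ?l = cost l" unfolding cost_def by (induction l) (auto simp: w_def)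
      ultimately show "d (- x) \<le> cost l" using dle[of ?l "- x"] l(2) by simp
    qed
    show "d (- x) = d x" for x using sym[of x] sym[of "- x"] by simp
    show "d (x + y) \<le> d x + d y" for x y
    proof (rule field_le_epsilon)
      fix e :: real assume "e > 0"
      then obtain l l' where l: "ok l" "tot l = x" "cost l < d x + e / 2" "ok l'" "tot l' = y" "cost l' < d y + e / 2"
        using dap[of "e / 2"] by (metis half_gt_zero)
      then have "d (x + y) \<le> cost (l @ l')" by (intro dle) (auto simp: ok_def tot_def)
      also have "\<dots> = cost l + cost l'" by (simp add: cost_def)
      finally show "d (x + y) \<le> d x + d y + e" using l by linarith
    qed
    fix e :: real assume "e > 0"
    then obtain n where "(1/2) ^ n < e" using real_arch_pow_inv[of e "1/2"] by auto
    then have "\<forall>x\<in>V n. d x < e" using dle single by (metis le_less_trans)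
    then show "\<exists>V. nbhd0 V \<and> (\<forall>x\<in>V. d x < e)" using V(1) by blast
  qed
  moreover have "x \<in> U" if "d x < 1/2" for x
  proof -
    have "\<exists>l. ok l \<and> tot l = x \<and> cost l < 1/2" using dap[of "1/2 - d x" x] that by simp
    then obtain l where "ok l" "tot l = x" "cost l < 1/2" by blast
    then show ?thesis using chain[of l 1] V(3) by auto
  qed
  ultimately show ?thesis using that by blast
qed

lemma pnorm_unif_cont:
  assumes "pnorm d"
  shows "unif_cont (\<lambda>y. d (y + a))"
  unfolding unif_cont_def
proof (intro allI impI)
  fix e :: real assume "e > 0"
  then obtain V where V: "nbhd0 V" "\<forall>x\<in>V. d x < e" using assms unfolding pnorm_def by meson
  have "\<bar>d (y + x + a) - d (y + a)\<bar> < e" if "x \<in> V" for x y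
  proof -
    have tri: "\<And>x y. d (x + y) \<le> d x + d y" and sym: "\<And>x. d (- x) = d x"
      using assms by (auto simp: pnorm_def)
    have "d (y + x + a) \<le> d (y + a) + d x" using tri[of "y + a" x] by (simp add: add_ac)
    moreover have "d (y + a) \<le> d (y + x + a) + d x" using tri[of "y + x + a" "- x"] sym[of x] by (simp add: add_ac)
    ultimately show ?thesis using V(2) that by (smt (verit))
  qed
  then show "\<exists>V. nbhd0 V \<and> (\<forall>x\<in>V. \<forall>y. \<bar>d (y + x + a) - d (y + a)\<bar> < e)" using V(1) by blast
qed

definition precompact :: bool where
  "precompact \<longleftrightarrow> (\<forall>V. nbhd0 V \<longrightarrow> (\<exists>A. finite A \<and> (\<forall>x. \<exists>a\<in>A. x - a \<in> V)))"

lemma precompactD: "precompact \<Longrightarrow> nbhd0 V \<Longrightarrow> \<exists>A. finite A \<and> (\<forall>x. \<exists>a\<in>A. x - a \<in> V)"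
  by (simp add: precompact_def)

text \<open>Without precompactness there is a sequence that is uniformly separated for some
  continuous pseudonorm. Bumps of growing height around its points form a locally finite family,
  whose sum is continuous and unbounded.\<close>

lemma pseudocompact_precompact:
  assumes pc: "pseudocompact_space T"
  shows precompact
proof (rule ccontr)
  assume "\<not> precompact"
  then obtain V where V: "nbhd0 V" and neg: "\<not> (\<exists>A. finite A \<and> (\<forall>x. \<exists>a\<in>A. x - a \<in> V))"
    by (auto simp: precompact_def)
  obtain d where d: "pnorm d" "\<And>x. d x < 1/2 \<Longrightarrow> x \<in> V" using ex_pnorm[OF V] by blast
  have tri: "\<And>x y. d (x + y) \<le> d x + d y" and sym: "\<And>x. d (- x) = d x" and d0: "d 0 = 0" "\<And>x. 0 \<le> d x"
    using d(1) by (auto simp: pnorm_def)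
  have "\<exists>x::nat \<Rightarrow> 'g. \<forall>n. \<forall>m\<in>x ` {..<n}. x n - m \<notin> V"
    proof (rule dependent_wf_choice[OF wf_less_than, of "\<lambda>x n r. \<forall>m\<in>x ` {..<n}. r - m \<notin> V"])
      show "\<exists>r. \<forall>m\<in>f ` {..<n}. r - m \<notin> V" for n and f :: "nat \<Rightarrow> 'g"
        using neg by (metis finite_imageI finite_lessThan)
    next
      fix f g :: "nat \<Rightarrow> 'g" and x r
      assume "\<And>z. (z, x) \<in> less_than \<Longrightarrow> f z = g z"
      then have "f ` {..<x} = g ` {..<x}" by (intro image_cong) auto
      then show "(\<forall>m\<in>f ` {..<x}. r - m \<notin> V) = (\<forall>m\<in>g ` {..<x}. r - m \<notin> V)" by simp
    qed
  then obtain x :: "nat \<Rightarrow> 'g" where x0: "\<And>n m. m \<in> x ` {..<n} \<Longrightarrow> x n - m \<notin> V" by blast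
  have x: "x n - x m \<notin> V" if "m < n" for n m using x0[of "x m" n] that by simp
  have sep: "1/2 \<le> d (x n - x m)" if "n \<noteq> m" for n m
  proof (cases "m < n")
    case True
    then show ?thesis using x d(2) by (metis not_le)
  next
    case False
    then have "\<not> d (x m - x n) < 1/2" using x[of n m] d(2) that by auto
    then show ?thesis using sym[of "x n - x m"] by simp
  qed
  \<comment> \<open>Bumps of radius 1/8 around points at mutual distance at least 1/2. At most one
    of them is non-zero at a given point, so their sum \<open>f\<close> can be written by a
    choice.\<close>
  define g where "g n y = real n * max 0 (1 - 8 * d (y - x n))" for n y
  define f where "f y = (if \<exists>n. g n y \<noteq> 0 then g (SOME n. g n y \<noteq> 0) y else 0)" for y
  have loc: "f y = g n y" if "\<And>m. m \<noteq> n \<Longrightarrow> g m y = 0" for n y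
  proof (cases "g n y = 0")
    case True
    then have "\<not> (\<exists>m. g m y \<noteq> 0)" using that by metis
    then show ?thesis using True by (simp add: f_def)
  next
    case False
    then have "(SOME m. g m y \<noteq> 0) = n" using that by (metis (mono_tags, lifting) someI_ex)
    then show ?thesis using False by (auto simp: f_def)
  qed
  have gz: "g m y = 0" if "1/8 \<le> d (y - x m)" for m y using that by (simp add: g_def)
  \<comment> \<open>\<open>3/16 = 1/8 + 1/16\<close>: if \<open>y0\<close> is at least this far from
    every centre, no bump reaches the ball of radius 1/16 about \<open>y0\<close>; otherwise only
    the bump of a nearby centre can.\<close>
  have local: "\<exists>n. \<forall>y. d (y - y0) < 1/16 \<longrightarrow> f y = g n y" for y0
  proof (cases "\<exists>n. d (y0 - x n) < 3/16")
    case True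
    then obtain n where n: "d (y0 - x n) < 3/16" by blast
    have "f y = g n y" if y: "d (y - y0) < 1/16" for y
    proof (rule loc)
      fix m assume "m \<noteq> n"
      have "d (y - x n) \<le> d (y - y0) + d (y0 - x n)" using tri[of "y - y0" "y0 - x n"] by simp
      moreover have "d (x m - x n) \<le> d (y - x m) + d (y - x n)"
        using tri[of "x m - y" "y - x n"] sym[of "y - x m"] by simp
      ultimately show "g m y = 0" using sep[OF \<open>m \<noteq> n\<close>] n y by (intro gz) linarith
    qed
    then show ?thesis by blast
  next
    case False
    have "f y = g 0 y" if y: "d (y - y0) < 1/16" for y
    proof (rule loc)
      fix m
      have "d (y0 - x m) \<le> d (y - y0) + d (y - x m)"
        using tri[of "y0 - y" "y - x m"] sym[of "y - y0"] by simp
      moreover have "3/16 \<le> d (y0 - x m)" using False by (meson not_le)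
      ultimately show "g m y = 0" using y by (intro gz) linarith
    qed
    then show ?thesis by blast
  qed
  have gcont: "continuous_map T euclideanreal (g n)" for n
  proof -
    have "continuous_map T euclideanreal (\<lambda>y. d (y - x n))"
      using unif_cont_continuous[OF pnorm_unif_cont[OF d(1), of "- x n"]] by simp
    then show ?thesis unfolding g_def by (intro continuous_intros)
  qed
  have "continuous_map T euclideanreal f"
  proof (rule continuous_if_local)
    fix y0 and e :: real assume "e > 0"
    obtain n where n: "\<And>y. d (y - y0) < 1/16 \<Longrightarrow> f y = g n y" using local by blast
    obtain V where V: "nbhd0 V" "\<forall>x\<in>V. dist (g n (y0 + x)) (g n y0) < e"
      using local_if_continuous[OF gcont \<open>e > 0\<close>] by blast
    obtain W where W: "nbhd0 W" "\<forall>x\<in>W. d x < 1/16"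
      using d(1) unfolding pnorm_def by (meson zero_less_divide_1_iff zero_less_numeral)
    have "dist (f (y0 + x)) (f y0) < e" if "x \<in> V \<inter> W" for x
      using n[of "y0 + x"] n[of y0] V(2) W(2) d0 that by simp
    then show "\<exists>V. nbhd0 V \<and> (\<forall>x\<in>V. dist (f (y0 + x)) (f y0) < e)"
      using nbhd0_Int[OF V(1) W(1)] by blast
  qed
  then have "bounded (range f)" using pc top by (simp add: pseudocompact_space_def)
  then obtain B where B: "\<And>y. \<bar>f y\<bar> \<le> B" by (auto simp: bounded_iff)
  obtain n :: nat where n: "B < real n" using reals_Archimedean2 by blast
  have "f (x n) = g n (x n)"
  proof (rule loc)
    fix m assume "m \<noteq> n"
    then show "g m (x n) = 0" using sep[of n m] by (intro gz) simp
  qed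
  then show False using B[of "x n"] n d0 by (simp add: g_def)
qed

end

section \<open>Continuous characters of precompact groups\<close>

definition imean :: "('g::ab_group_add \<Rightarrow> real) \<Rightarrow> real" where
  "imean = (SOME M. invariant_mean M)"

lemma invariant_mean_imean: "invariant_mean (imean :: ('g::ab_group_add \<Rightarrow> real) \<Rightarrow> real)"
  unfolding imean_def by (rule someI_ex[OF ex_invariant_mean])

definition bdd :: "('g \<Rightarrow> real) \<Rightarrow> bool" where "bdd f \<longleftrightarrow> (\<exists>C. \<forall>x. \<bar>f x\<bar> \<le> C)"

lemma bdd_iff: "bdd f \<longleftrightarrow> bounded (range f)"
  by (auto simp: bdd_def bounded_iff)

lemma bddI: "(\<And>x. \<bar>f x\<bar> \<le> C) \<Longrightarrow> bdd f" by (auto simp: bdd_def)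

lemma bdd_add: "bdd f \<Longrightarrow> bdd g \<Longrightarrow> bdd (\<lambda>x. f x + g x)"
  unfolding bdd_iff by (rule bounded_plus_comp)

lemma bdd_const: "bdd (\<lambda>_. c)" by (rule bddI[of _ "\<bar>c\<bar>"]) simp

lemma bdd_mult: "bdd f \<Longrightarrow> bdd g \<Longrightarrow> bdd (\<lambda>x. f x * g x)"
proof -
  assume "bdd f" "bdd g"
  then obtain C D where CD: "\<And>x. \<bar>f x\<bar> \<le> C" "\<And>x. \<bar>g x\<bar> \<le> D" by (auto simp: bdd_def)
  have "\<bar>f x * g x\<bar> \<le> C * D" for x
    unfolding abs_mult by (intro mult_mono CD) (use CD abs_ge_zero order_trans in blast)+
  then show ?thesis by (rule bddI)
qed

lemma bdd_diff: "bdd f \<Longrightarrow> bdd g \<Longrightarrow> bdd (\<lambda>x. f x - g x)"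
  using bdd_add[of f "\<lambda>x. (- 1) * g x"] bdd_mult[OF bdd_const[of "- 1"], of g] by simp

lemma bdd_shift: "bdd f \<Longrightarrow> bdd (\<lambda>x. f (x + h))"
  unfolding bdd_def by blast

lemma bdd_sum: "(\<And>i. i \<in> I \<Longrightarrow> bdd (f i)) \<Longrightarrow> bdd (\<lambda>x. \<Sum>i\<in>I. f i x)"
  by (induction I rule: infinite_finite_induct) (auto intro: bdd_add bdd_const)

lemma imean_add: "bdd f \<Longrightarrow> bdd g \<Longrightarrow> imean (\<lambda>x. f x + g x) = imean f + imean g"
  and imean_scale: "bdd f \<Longrightarrow> imean (\<lambda>x. c * f x) = c * imean f"
  and imean_nonneg: "bdd f \<Longrightarrow> (\<And>x. 0 \<le> f x) \<Longrightarrow> 0 \<le> imean f"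
  and imean_1: "imean (\<lambda>_. 1) = 1"
  and imean_shift: "bdd f \<Longrightarrow> imean (\<lambda>x. f (x + h)) = imean f"
  using invariant_mean_imean unfolding invariant_mean_def bdd_iff by blast+

lemma imean_const: "imean (\<lambda>_. c) = c"
  using imean_scale[OF bdd_const, of c 1] by (simp add: imean_1)

lemma imean_diff: "bdd f \<Longrightarrow> bdd g \<Longrightarrow> imean (\<lambda>x. f x - g x) = imean f - imean g"
  using imean_add[of f "\<lambda>x. (- 1) * g x"] bdd_mult[OF bdd_const[of "- 1"], of g] imean_scale[of g "- 1"] by simp

lemma imean_mono: "bdd f \<Longrightarrow> bdd g \<Longrightarrow> (\<And>x. f x \<le> g x) \<Longrightarrow> imean f \<le> imean g"
  using imean_nonneg[OF bdd_diff[of g f]] by (simp add: imean_diff)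

lemma imean_abs_le:
  assumes "\<And>x. \<bar>f x\<bar> \<le> C"
  shows "\<bar>imean f\<bar> \<le> C"
proof -
  have b: "bdd f" using assms by (rule bddI)
  have le: "f x \<le> C" "- C \<le> f x" for x using assms[of x] by auto
  have "imean f \<le> C" using imean_mono[OF b bdd_const, of C] le(1) by (simp add: imean_const)
  moreover have "- C \<le> imean f" using imean_mono[OF bdd_const b, of "- C"] le(2) by (simp add: imean_const)
  ultimately show ?thesis by auto
qed

lemma imean_sum:
  assumes "\<And>i. i \<in> I \<Longrightarrow> bdd (f i)"
  shows "imean (\<lambda>x. \<Sum>i\<in>I. f i x) = (\<Sum>i\<in>I. imean (f i))"
  using assms
proof (induction I rule: infinite_finite_induct)
  case (insert i I)
  then show ?case by (simp add: imean_add bdd_sum)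
qed (simp_all add: imean_const)

text \<open>The convolution of \<open>f\<close> with its reflection, the invariant mean taking the
  place of the Haar integral.\<close>

definition autocor :: "('g::ab_group_add \<Rightarrow> real) \<Rightarrow> 'g \<Rightarrow> real" where
  "autocor f x = imean (\<lambda>y. f (y + x) * f y)"

lemma autocor_shift:
  assumes "bdd f"
  shows "imean (\<lambda>y. f (y + a) * f (y + b)) = autocor f (a - b)"
  using imean_shift[of "\<lambda>y. f (y + (a - b)) * f y" b] bdd_mult[OF bdd_shift assms] assms
  by (simp add: autocor_def add.assoc)

text \<open>A Schur product: inside the mean over \<open>y\<close> stands the quadratic form of
  \<open>\<phi>\<close> with coefficients \<open>z i * f (y + h i)\<close>, which is non-negative
  for each \<open>y\<close>.\<close>

lemma autocor_pd:
  fixes f :: "'g::ab_group_add \<Rightarrow> real"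
  assumes f: "bdd f" and \<phi>: "pd \<phi>"
  shows "pd (\<lambda>x. of_real (autocor f x) * \<phi> x)"
  unfolding pd_def
proof (intro conjI allI)
  fix x
  have "autocor f (- x) = imean (\<lambda>y. f (y + 0) * f (y + x))" using autocor_shift[OF f, of 0 x] by simp
  also have "\<dots> = autocor f x" by (simp add: autocor_def mult.commute)
  finally show "of_real (autocor f (- x)) * \<phi> (- x) = cnj (of_real (autocor f x) * \<phi> x)"
    by (simp add: pd_minus[OF \<phi>])
next
  fix n :: nat and z :: "nat \<Rightarrow> complex" and h :: "nat \<Rightarrow> 'g"
  define R where "R i j = Re (z i * cnj (z j) * \<phi> (h i - h j))" for i j
  have "Re (\<Sum>i<n. \<Sum>j<n. z i * cnj (z j) * (of_real (autocor f (h i - h j)) * \<phi> (h i - h j)))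
      = (\<Sum>i<n. \<Sum>j<n. R i j * autocor f (h i - h j))"
    by (simp add: R_def algebra_simps)
  also have "\<dots> = (\<Sum>i<n. \<Sum>j<n. imean (\<lambda>y. R i j * (f (y + h i) * f (y + h j))))"
    by (intro sum.cong refl) (simp add: imean_scale autocor_shift f bdd_mult bdd_shift)
  also have "\<dots> = imean (\<lambda>y. \<Sum>i<n. \<Sum>j<n. R i j * (f (y + h i) * f (y + h j)))"
    by (simp add: imean_sum bdd_sum bdd_mult bdd_const bdd_shift f)
  also have "\<dots> \<ge> 0"
  proof (rule imean_nonneg)
    show "bdd (\<lambda>y. \<Sum>i<n. \<Sum>j<n. R i j * (f (y + h i) * f (y + h j)))"
      by (intro bdd_sum bdd_mult bdd_const bdd_shift f)
    fix y
    have "0 \<le> Re (\<Sum>i<n. \<Sum>j<n. (z i * of_real (f (y + h i))) * cnj (z j * of_real (f (y + h j))) * \<phi> (h i - h j))"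
      using pd_sum_nonneg[OF \<phi>, of "{..<n}" "\<lambda>i. z i * of_real (f (y + h i))" h] by simp
    also have "\<dots> = (\<Sum>i<n. \<Sum>j<n. R i j * (f (y + h i) * f (y + h j)))"
    proof -
      have e1: "(z i * of_real (f (y + h i))) * cnj (z j * of_real (f (y + h j))) * \<phi> (h i - h j)
          = of_real (f (y + h i) * f (y + h j)) * (z i * cnj (z j) * \<phi> (h i - h j))" for i j
        by (simp add: mult_ac)
      have e2: "Re (of_real r * w) = r * Re w" for r w by simp
      have "Re ((z i * of_real (f (y + h i))) * cnj (z j * of_real (f (y + h j))) * \<phi> (h i - h j))
          = R i j * (f (y + h i) * f (y + h j))" for i j
        unfolding e1 e2 R_def by (rule mult.commute)
      then show ?thesis by (simp only: Re_sum)
    qed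
    finally show "0 \<le> (\<Sum>i<n. \<Sum>j<n. R i j * (f (y + h i) * f (y + h j)))" .
  qed
  finally show "0 \<le> Re (\<Sum>i<n. \<Sum>j<n. z i * cnj (z j) * (of_real (autocor f (h i - h j)) * \<phi> (h i - h j)))" .
qed

lemma pd_const1: "pd (\<lambda>_. 1)"
  unfolding pd_def
proof (intro conjI allI)
  fix n :: nat and z :: "nat \<Rightarrow> complex" and x :: "nat \<Rightarrow> 'a"
  have "(\<Sum>i<n. \<Sum>j<n. z i * cnj (z j) * 1) = (\<Sum>i<n. z i) * cnj (\<Sum>i<n. z i)"
    by (simp add: sum_product)
  also have "Re \<dots> = (norm (\<Sum>i<n. z i))\<^sup>2" by (metis Re_complex_of_real complex_norm_square)
  finally show "0 \<le> Re (\<Sum>i<n. \<Sum>j<n. z i * cnj (z j) * 1)" by simp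
qed simp

text \<open>The character found for the second difference \<open>2 F - F(\<cdot> + g) - F(\<cdot> - g)\<close> is nontrivial at \<open>g\<close>,
  since otherwise the averages over \<open>0, g, 2 g, \<dots>\<close> telescope.\<close>

lemma second_difference_qinf:
  fixes F F' :: "'g::ab_group_add \<Rightarrow> real"
  assumes F': "\<And>x. F' x = 2 * F x - F (x + g) - F (x - g)" and C: "\<And>x. \<bar>F x\<bar> \<le> C"
    and mult: "\<And>x y. \<kappa> (x + y) = \<kappa> x * \<kappa> y" and nrm: "\<And>x. norm (\<kappa> x) = 1" and g: "\<kappa> g = 1"
    and pd: "pd (\<lambda>x. of_real (F' x) * \<kappa> x)"
  shows "qinf (\<lambda>x. of_real (F' x) * \<kappa> x) \<le> 0"
proof -
  have \<kappa>0: "\<kappa> 0 = 1"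
    using mult[of 0 0] nrm[of 0] by (metis add.right_neutral mult_cancel_left2 norm_zero zero_neq_one)
  have \<kappa>z: "\<kappa> (zs k g) = 1" for k
  proof (induction k rule: int_induct[where k = 0])
    case (step1 i)
    then show ?case by (simp add: zs_Suc mult g)
  next
    case (step2 i)
    have "\<kappa> (zs (i - 1) g) * \<kappa> g = \<kappa> (zs i g)" unfolding mult[symmetric] by (simp add: zs_pred)
    then show ?case using step2 g by simp
  qed (simp add: \<kappa>0)
  have bound: "qinf (\<lambda>x. of_real (F' x) * \<kappa> x) \<le> 4 * C * inverse (real (Suc n))" for n
  proof -
    let ?N = "Suc n"
    define a where "a k = F (zs k g)" for k :: int
    have shift: "F' (zs (int i) g - zs (int j) g) = (a (int i - int j) - a (int i - int j + 1)) - (a (int i - int j - 1) - a (int i - int j))" for i j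
      by (simp add: F' a_def zs_Suc zs_pred zm.scale_left_diff_distrib)
    have inner: "\<bar>\<Sum>j<?N. F' (zs (int i) g - zs (int j) g)\<bar> \<le> 4 * C" for i
    proof -
      define b where "b j = a (int i - int j + 1) - a (int i - int j)" for j
      have "F' (zs (int i) g - zs (int j) g) = b (Suc j) - b j" for j
        unfolding shift b_def by (simp add: algebra_simps)
      then have "(\<Sum>j<?N. F' (zs (int i) g - zs (int j) g)) = b ?N - b 0"
        by (simp only: sum_lessThan_telescope)
      moreover have aC: "\<bar>a k\<bar> \<le> C" for k using C by (simp add: a_def)
      have bC: "\<bar>b j\<bar> \<le> 2 * C" for j
        using aC[of "int i - int j + 1"] aC[of "int i - int j"] unfolding b_def by linarith
      have "\<bar>b ?N - b 0\<bar> \<le> 4 * C" using bC[of ?N] bC[of 0] by linarith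
      ultimately show ?thesis by simp
    qed
    have "qinf (\<lambda>x. of_real (F' x) * \<kappa> x) \<le> qavg {..<?N} (\<lambda>i. zs (int i) g) (\<lambda>x. of_real (F' x) * \<kappa> x)"
      by (rule qinf_le[OF pd]) auto
    also have "\<dots> = (\<Sum>i<?N. \<Sum>j<?N. F' (zs (int i) g - zs (int j) g)) / (real ?N)\<^sup>2"
      unfolding qavg_def by (simp add: zm.scale_left_diff_distrib[symmetric] \<kappa>z del: sum.lessThan_Suc)
    also have "\<dots> \<le> (\<Sum>i<?N. 4 * C) / (real ?N)\<^sup>2"
    proof (intro divide_right_mono sum_mono)
      show "(\<Sum>j<?N. F' (zs (int i) g - zs (int j) g)) \<le> 4 * C" for i using inner[of i] by linarith
    qed simp
    also have "\<dots> = 4 * C * inverse (real ?N)"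
      by (simp add: power2_eq_square field_simps del: of_nat_Suc)
    finally show ?thesis .
  qed
  have "qinf (\<lambda>x. of_real (F' x) * \<kappa> x) \<le> 4 * C * 0"
    by (rule LIMSEQ_le_const[OF tendsto_mult[OF tendsto_const LIMSEQ_inverse_real_of_nat]]) (use bound in auto)
  then show ?thesis by simp
qed

context abelian_top_grp
begin

lemma unif_cont_bump:
  assumes "nbhd0 U"
  obtains f where "unif_cont f" "\<And>x. 0 \<le> f x" "\<And>x. f x \<le> 1" "f 0 = 1" "\<And>x. x \<notin> U \<Longrightarrow> f x = 0"
proof -
  obtain d where d: "pnorm d" "\<And>x. d x < 1/2 \<Longrightarrow> x \<in> U" using ex_pnorm[OF assms] by blast
  define f where "f x = max 0 (1 - 2 * d x)" for x
  have "unif_cont f"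
    unfolding unif_cont_def
  proof (intro allI impI)
    fix e :: real assume "e > 0"
    then obtain V where V: "nbhd0 V" "\<And>x y. x \<in> V \<Longrightarrow> \<bar>d (y + x) - d y\<bar> < e / 2"
      using pnorm_unif_cont[OF d(1), of 0] unfolding unif_cont_def by (metis add.right_neutral half_gt_zero)
    have "\<bar>f (y + x) - f y\<bar> < e" if "x \<in> V" for x y
      using V(2)[OF that, of y] unfolding f_def by (simp add: max_def abs_if split: if_splits)
    then show "\<exists>V. nbhd0 V \<and> (\<forall>x\<in>V. \<forall>y. \<bar>f (y + x) - f y\<bar> < e)" using V(1) by blast
  qed
  moreover have "0 \<le> f x" "f x \<le> 1" "f 0 = 1" for x using d(1) by (auto simp: f_def pnorm_def)
  moreover have "f x = 0" if "x \<notin> U" for x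
  proof -
    have "1/2 \<le> d x" using d(2) that by (meson not_le)
    then show ?thesis by (simp add: f_def)
  qed
  ultimately show ?thesis using that by blast
qed

text \<open>For the autocorrelation \<open>F\<close> of a suitable function, the product of
  \<open>F\<close> with itself is non-negative and bounded below near 0, which by precompactness
  makes its averages positive. Hence \<open>ex_character\<close> applies; the resulting
  \<open>\<kappa>\<close> is continuous by \<open>character_oscillation\<close> and nontrivial at
  \<open>g\<close> by \<open>second_difference_qinf\<close>.\<close>

theorem continuous_characters_separate:
  assumes pc: precompact and g: "g \<noteq> 0"
  shows "\<exists>a :: 'g \<Rightarrow> circle. Modules.additive a \<and> continuous_map T euclidean a \<and> a g \<noteq> 0"
proof -
  have "\<exists>U. nbhd0 U \<and> g \<notin> U"
    using haus g unfolding Hausdorff_space_def top nbhd0_def disjnt_def by (metis IntI UNIV_I empty_iff)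
  then obtain U where U: "nbhd0 U" "g \<notin> U" by blast
  obtain f0 where f0: "unif_cont f0" "\<And>x. 0 \<le> f0 x" "\<And>x. f0 x \<le> 1" "f0 0 = 1" "\<And>x. x \<notin> U \<Longrightarrow> f0 x = 0"
    using unif_cont_bump[OF U(1)] by metis
  \<comment> \<open>Subtracting the translate by \<open>g\<close> turns the autocorrelation into the
    second difference of that of \<open>f0\<close>.\<close>
  define f where "f y = f0 y - f0 (y + g)" for y
  have fle: "\<bar>f y\<bar> \<le> 1" for y using f0(2,3)[of y] f0(2,3)[of "y + g"] by (auto simp: f_def)
  have bf0: "bdd f0" by (rule bddI[of _ 1]) (use f0 in auto)
  have bf: "bdd f" using fle by (rule bddI)
  have ucf: "unif_cont f"
    unfolding unif_cont_def
  proof (intro allI impI)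
    fix e :: real assume "e > 0"
    then obtain V where V: "nbhd0 V" "\<And>x y. x \<in> V \<Longrightarrow> \<bar>f0 (y + x) - f0 y\<bar> < e / 2"
      using f0(1) unfolding unif_cont_def by (metis half_gt_zero)
    have "\<bar>f (y + x) - f y\<bar> < e" if "x \<in> V" for x y
    proof -
      have "f0 (y + x + g) = f0 (y + g + x)" by (simp add: add_ac)
      then show ?thesis using V(2)[OF that, of y] V(2)[OF that, of "y + g"] unfolding f_def by linarith
    qed
    then show "\<exists>V. nbhd0 V \<and> (\<forall>x\<in>V. \<forall>y. \<bar>f (y + x) - f y\<bar> < e)" using V(1) by blast
  qed
  define F where "F = autocor f"
  have Fuc: "\<exists>V. nbhd0 V \<and> (\<forall>v\<in>V. \<forall>x. \<bar>F (x + v) - F x\<bar> \<le> e)" if e: "e > 0" for e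
  proof -
    obtain V where V: "nbhd0 V" "\<And>x y. x \<in> V \<Longrightarrow> \<bar>f (y + x) - f y\<bar> < e"
      using ucf e unfolding unif_cont_def by metis
    have "\<bar>F (x + v) - F x\<bar> \<le> e" if v: "v \<in> V" for x v
    proof -
      have "F (x + v) - F x = imean (\<lambda>y. f (y + (x + v)) * f y - f (y + x) * f y)"
        unfolding F_def autocor_def by (rule imean_diff[symmetric]) (intro bdd_mult bdd_shift bf)+
      also have "\<bar>\<dots>\<bar> \<le> e"
      proof (rule imean_abs_le)
        fix y
        have "\<bar>(f (y + x + v) - f (y + x)) * f y\<bar> \<le> e * 1"
          unfolding abs_mult by (intro mult_mono) (use V(2)[OF v, of "y + x"] fle e in \<open>auto intro: less_imp_le\<close>)
        then show "\<bar>f (y + (x + v)) * f y - f (y + x) * f y\<bar> \<le> e"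
          by (simp add: add.assoc left_diff_distrib)
      qed
      finally show ?thesis .
    qed
    then show ?thesis using V(1) by blast
  qed
  \<comment> \<open>Finitely many translates of \<open>V\<close> cover the group, so the
    corresponding translates of \<open>f\<close> squared sum to at least 1/4 everywhere, and the
    mean of \<open>f\<close> squared cannot vanish.\<close>
  have F0: "0 < F 0"
  proof -
    obtain V where V: "nbhd0 V" "\<And>x y. x \<in> V \<Longrightarrow> \<bar>f (y + x) - f y\<bar> < 1/2"
      using ucf unfolding unif_cont_def by (metis half_gt_zero zero_less_one)
    have f1: "f 0 = 1" using f0 U by (simp add: f_def)
    have half: "1/4 \<le> f x * f x" if "x \<in> V" for x
    proof -
      have "\<bar>f x - 1\<bar> < 1/2" using V(2)[OF that, of 0] f1 by simp
      then have "1/2 \<le> f x" unfolding abs_less_iff by linarith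
      then have "1/2 * (1/2) \<le> f x * f x" by (intro mult_mono) auto
      then show ?thesis by simp
    qed
    obtain A where A: "finite A" "\<And>x. \<exists>a\<in>A. x - a \<in> V" using precompactD[OF pc V(1)] by blast
    have "imean (\<lambda>_::'g. 1/4) \<le> imean (\<lambda>y. \<Sum>a\<in>A. f (y + (- a)) * f (y + (- a)))"
    proof (rule imean_mono)
      show "bdd (\<lambda>_::'g. 1/4 :: real)" by (rule bdd_const)
      show "bdd (\<lambda>y. \<Sum>a\<in>A. f (y + (- a)) * f (y + (- a)))" by (intro bdd_sum bdd_mult bdd_shift bf)
      fix y
      obtain a where a: "a \<in> A" "y - a \<in> V" using A(2) by blast
      have "1/4 \<le> f (y + (- a)) * f (y + (- a))" using half[OF a(2)] by simp
      also have "\<dots> \<le> (\<Sum>a\<in>A. f (y + (- a)) * f (y + (- a)))"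
        by (rule member_le_sum[OF a(1)]) (auto simp: A(1))
      finally show "1/4 \<le> (\<Sum>a\<in>A. f (y + (- a)) * f (y + (- a)))" .
    qed
    also have "\<dots> = (\<Sum>a\<in>A. imean (\<lambda>y. f (y + (- a)) * f (y + (- a))))"
      by (intro imean_sum bdd_mult bdd_shift bf)
    also have "\<dots> = (\<Sum>a\<in>A. F 0)" unfolding F_def by (simp only: autocor_shift[OF bf] diff_self)
    also have "\<dots> = real (card A) * F 0" by simp
    finally have "1/4 \<le> real (card A) * F 0" by (simp add: imean_const)
    then show ?thesis by (metis divide_pos_pos less_le_trans not_less of_nat_0_le_iff
          mult_nonneg_nonpos zero_less_numeral zero_less_one leD)
  qed
  \<comment> \<open>The starting point of the maximisation is \<open>F\<close> itself, normalised at
    0; its product with \<open>F\<close> is non-negative everywhere.\<close>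
  define \<phi>0 where "\<phi>0 x = complex_of_real (1 / F 0) * (of_real (F x) * 1)" for x
  have "pd \<phi>0"
    unfolding \<phi>0_def using pd_scale[OF autocor_pd[OF bf pd_const1], of "1 / F 0"] F0 by (simp add: F_def)
  then have \<phi>0: "\<phi>0 \<in> pd1" using F0 by (simp add: pd1_def \<phi>0_def flip: of_real_mult)
  have pos: "0 < qinf (\<lambda>x. of_real (F x) * \<phi>0 x)"
  proof -
    obtain W where W: "nbhd0 W" "\<And>v x. v \<in> W \<Longrightarrow> \<bar>F (x + v) - F x\<bar> \<le> F 0 / 2"
      using Fuc[of "F 0 / 2"] F0 by auto
    obtain V where V: "nbhd0 V" "\<And>x y. x \<in> V \<Longrightarrow> y \<in> V \<Longrightarrow> x + y \<in> W" "\<And>x. x \<in> V \<Longrightarrow> - x \<in> V"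
      using nbhd0_add[OF W(1)] by metis
    obtain A where A: "finite A" "\<And>x. \<exists>a\<in>A. x - a \<in> V" using precompactD[OF pc V(1)] by blast
    have "F 0 / 4 / real (card A) \<le> qinf (\<lambda>x. of_real (F x) * \<phi>0 x)"
    proof (rule qinf_ge)
      fix n :: nat and h assume n: "n > 0"
      show "F 0 / 4 / real (card A) \<le> qavg {..<n} h (\<lambda>x. of_real (F x) * \<phi>0 x)"
      proof (rule qavg_ge_if_cover[OF A _ _ _ n])
        have eq: "Re (of_real (F x) * \<phi>0 x) = F x * F x / F 0" for x by (simp add: \<phi>0_def)
        show "0 \<le> Re (of_real (F x) * \<phi>0 x)" for x unfolding eq using F0 by simp
        show "F 0 / 4 \<le> Re (of_real (F (x - y)) * \<phi>0 (x - y))" if "x \<in> V" "y \<in> V" for x y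
        proof -
          have "x + - y \<in> W" using V that by blast
          then have "\<bar>F (x - y) - F 0\<bar> \<le> F 0 / 2" using W(2)[of "x - y" 0] by simp
          then have "F 0 / 2 \<le> F (x - y)" unfolding abs_le_iff by linarith
          then have "F 0 / 2 * (F 0 / 2) \<le> F (x - y) * F (x - y)" using F0 by (intro mult_mono) auto
          then show ?thesis unfolding eq using F0 by (simp add: field_simps)
        qed
        show "0 \<le> F 0 / 4" using F0 by simp
      qed
    qed
    moreover have "card A > 0" using A by (metis card_gt_0_iff empty_iff)
    then have "0 < F 0 / 4 / real (card A)" using F0 by simp
    ultimately show ?thesis by (rule less_le_trans[rotated])
  qed
  have spd: "pd (\<lambda>x. of_real (F x) * \<phi> x)" if "pd \<phi>" for \<phi>
    unfolding F_def by (rule autocor_pd[OF bf that])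
  from ex_character[OF spd \<phi>0 pos] obtain \<kappa> where
    "(\<forall>x y. \<kappa> (x + y) = \<kappa> x * \<kappa> y) \<and> (\<forall>x. norm (\<kappa> x) = 1) \<and>
     qinf (\<lambda>x. of_real (F x) * \<kappa> x) > 0 \<and> pd \<kappa>" ..
  then have \<kappa>: "\<And>x y. \<kappa> (x + y) = \<kappa> x * \<kappa> y" "\<And>x. norm (\<kappa> x) = 1"
    "qinf (\<lambda>x. of_real (F x) * \<kappa> x) > 0" "pd \<kappa>" by simp_all
  have pdF: "pd (\<lambda>x. of_real (F x) * \<kappa> x)" unfolding F_def by (rule autocor_pd[OF bf \<kappa>(4)])
  have \<kappa>g: "\<kappa> g \<noteq> 1"
  proof
    assume "\<kappa> g = 1"
    have F': "F x = 2 * autocor f0 x - autocor f0 (x + g) - autocor f0 (x - g)" for x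
    proof -
      have b: "bdd (\<lambda>y. f0 (y + a) * f0 (y + b))" for a b by (intro bdd_mult bdd_shift bf0)
      have "F x = imean (\<lambda>y. (f0 (y + x) * f0 (y + 0) + f0 (y + (x + g)) * f0 (y + g)) -
          (f0 (y + (x + g)) * f0 (y + 0) + f0 (y + x) * f0 (y + g)))"
        unfolding F_def autocor_def f_def by (rule arg_cong[of _ _ imean]) (simp add: fun_eq_iff algebra_simps)
      also have "\<dots> = (autocor f0 (x - 0) + autocor f0 (x + g - g)) - (autocor f0 (x + g - 0) + autocor f0 (x - g))"
        by (simp only: imean_diff imean_add bdd_add b autocor_shift[OF bf0])
      finally show ?thesis by simp
    qed
    have "\<bar>autocor f0 x\<bar> \<le> 1" for x
      unfolding autocor_def
    proof (rule imean_abs_le)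
      fix y
      have "\<bar>f0 (y + x)\<bar> * \<bar>f0 y\<bar> \<le> 1 * 1" by (intro mult_mono) (use f0 in auto)
      then show "\<bar>f0 (y + x) * f0 y\<bar> \<le> 1" by (simp add: abs_mult)
    qed
    then have "qinf (\<lambda>x. of_real (F x) * \<kappa> x) \<le> 0"
      using second_difference_qinf[OF F' _ \<kappa>(1,2) \<open>\<kappa> g = 1\<close> pdF] by blast
    then show False using \<kappa>(3) by simp
  qed
  define a where "a x = Circ (\<kappa> x)" for x
  have cva: "cval (a x) = \<kappa> x" for x using \<kappa>(2) by (simp add: a_def Circ_inverse)
  have add: "Modules.additive a"
    by unfold_locales (simp add: cval_inject_iff[symmetric] cval_add cva \<kappa>(1))
  moreover have "continuous_map T euclidean a"
  proof (rule continuous_if_local)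
    fix y :: 'g and e :: real assume e: "e > 0"
    define c where "c = qinf (\<lambda>x. of_real (F x) * \<kappa> x)"
    have c: "c > 0" using \<kappa>(3) by (simp add: c_def)
    \<comment> \<open>For a unit number the squared distance to 1 is twice \<open>1 - Re\<close>, so
      this \<open>\<delta>\<close> bounds it by half of \<open>e\<^sup>2\<close>.\<close>
    define \<delta> where "\<delta> = c * e\<^sup>2 / 4"
    have \<delta>: "\<delta> > 0" using c e by (simp add: \<delta>_def)
    obtain V where V: "nbhd0 V" "\<And>v x. v \<in> V \<Longrightarrow> \<bar>F (x + v) - F x\<bar> \<le> \<delta>" using Fuc[OF \<delta>] by blast
    have "dist (a (y + x)) (a y) < e" if "x \<in> V" for x
    proof -
      have "c * (1 - Re (\<kappa> x)) \<le> \<delta>"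
        unfolding c_def by (rule character_oscillation) (use \<kappa> pdF V(2)[OF that] in auto)
      also have "\<delta> = c * (e\<^sup>2 / 4)" by (simp add: \<delta>_def)
      finally have le: "1 - Re (\<kappa> x) \<le> e\<^sup>2 / 4" using c by (simp only: mult_le_cancel_left_pos)
      have "(norm (\<kappa> x - 1))\<^sup>2 = 2 * (1 - Re (\<kappa> x))"
      proof -
        have "(Re (\<kappa> x))\<^sup>2 + (Im (\<kappa> x))\<^sup>2 = 1" using \<kappa>(2)[of x] by (metis cmod_power2 one_power2)
        moreover have "(norm (\<kappa> x - 1))\<^sup>2 = (Re (\<kappa> x) - 1)\<^sup>2 + (Im (\<kappa> x))\<^sup>2" by (simp add: cmod_power2)
        ultimately show ?thesis by (simp add: power2_diff)
      qed
      also have "2 * (1 - Re (\<kappa> x)) \<le> 2 * (e\<^sup>2 / 4)" using le by (intro mult_left_mono) auto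
      also have "2 * (e\<^sup>2 / 4) < e\<^sup>2" using e by simp
      finally have "(norm (\<kappa> x - 1))\<^sup>2 < e\<^sup>2" .
      then have "norm (\<kappa> x - 1) < e" using e by (simp add: power_less_imp_less_base)
      moreover have "dist (a (y + x)) (a y) = norm (\<kappa> x - 1)"
      proof -
        have "cval (a (y + x)) - cval (a y) = \<kappa> y * (\<kappa> x - 1)" by (simp add: cva \<kappa>(1) algebra_simps)
        then show ?thesis by (simp add: dist_cval norm_mult \<kappa>(2))
      qed
      ultimately show ?thesis by simp
    qed
    then show "\<exists>V. nbhd0 V \<and> (\<forall>x\<in>V. dist (a (y + x)) (a y) < e)" using V(1) by blast
  qed
  moreover have "a g \<noteq> 0" using \<kappa>g cva[of g] by auto
  ultimately show ?thesis by blast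
qed

end

section \<open>Independent transversals\<close>

definition subgrp :: "'a::ab_group_add set \<Rightarrow> bool" where
  "subgrp N \<longleftrightarrow> 0 \<in> N \<and> (\<forall>x\<in>N. \<forall>y\<in>N. x - y \<in> N)"

definition torsion_free :: "'a::ab_group_add set \<Rightarrow> bool" where
  "torsion_free N \<longleftrightarrow> (\<forall>x\<in>N. \<forall>n. n \<noteq> 0 \<longrightarrow> zs n x = 0 \<longrightarrow> x = 0)"

lemma subgrp_uminus: "subgrp N \<Longrightarrow> x \<in> N \<Longrightarrow> - x \<in> N"
  unfolding subgrp_def by (metis diff_0)

lemma subgrp_add: "subgrp N \<Longrightarrow> x \<in> N \<Longrightarrow> y \<in> N \<Longrightarrow> x + y \<in> N"
  using subgrp_uminus[of N y] unfolding subgrp_def by (metis diff_minus_eq_add)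

lemma subgrp_zs:
  assumes "subgrp N" "x \<in> N"
  shows "zs n x \<in> N"
proof (induction n rule: int_induct[where k = 0])
  case base
  then show ?case using assms by (simp add: subgrp_def)
next
  case (step1 i)
  then show ?case using assms by (simp add: zs_Suc subgrp_add)
next
  case (step2 i)
  then show ?case using assms by (simp add: zs_pred subgrp_def)
qed

section \<open>Size and number of closed sets in powers of circles\<close>

lemma compact_UNIV_circle_fun: "compact (UNIV :: ('w \<Rightarrow> nat \<Rightarrow> circle) set)"
proof -
  have "compact_space (euclidean :: circle topology)"
    using compact_UNIV_circle by (simp add: compact_space_def)
  then have "compact_space (product_topology (\<lambda>_::nat. euclidean :: circle topology) UNIV)"
    by (simp add: compact_space_product_topology)
  then have "compact_space (euclidean :: (nat \<Rightarrow> circle) topology)"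
    by (simp add: euclidean_product_topology)
  then have "compact_space (product_topology (\<lambda>_::'w. euclidean :: (nat \<Rightarrow> circle) topology) UNIV)"
    by (simp add: compact_space_product_topology)
  then show ?thesis by (simp add: euclidean_product_topology compact_space_def)
qed

lemma Hausdorff_fun: "Hausdorff_space (euclidean :: ('w \<Rightarrow> 'b::t2_space) topology)"
  unfolding euclidean_product_topology[symmetric]
  by (simp only: Hausdorff_space_product_topology)
    (simp add: Hausdorff_space_def disjnt_def; metis hausdorff)

lemma closed_imp_compact_fun: "closed C \<Longrightarrow> compact (C :: ('w \<Rightarrow> nat \<Rightarrow> circle) set)"
  using compact_Int_closed[OF compact_UNIV_circle_fun, of C] by simp

lemma continuous_translation: "continuous_on A (\<lambda>x. x + (a :: 'a::topological_ab_group_add))"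
  unfolding continuous_on_def by (intro ballI tendsto_add tendsto_ident_at tendsto_const)

lemma open_translation_vimage:
  assumes "open U"
  shows "open {x. x + (a :: 'a::topological_ab_group_add) \<in> U}"
  using open_vimage[OF assms continuous_translation[of UNIV a]] by (simp add: vimage_def)

lemma infinite_torsion_free:
  assumes "subgrp N" "torsion_free N" "x \<in> N" "x \<noteq> 0"
  shows "infinite N"
proof
  assume "finite N"
  moreover have "range (\<lambda>n. zs n x) \<subseteq> N" using assms by (auto intro: subgrp_zs)
  ultimately have "finite (range (\<lambda>n::int. zs n x))" by (rule rev_finite_subset)
  moreover have "inj (\<lambda>n::int. zs n x)"
  proof (rule injI)
    fix m n :: int assume "zs m x = zs n x"
    then have "zs (m - n) x = 0" by (simp add: zm.scale_left_diff_distrib)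
    then show "m = n" using assms unfolding torsion_free_def by (metis eq_iff_diff_eq_0)
  qed
  ultimately have "finite (UNIV :: int set)" by (rule finite_imageD)
  then show False using infinite_UNIV_int by blast
qed

text \<open>An isolated point could be translated to every point of \<open>N\<close>, and
  compactness would make \<open>N\<close> finite, which is impossible for a nontrivial torsion-free
  group. So \<open>N\<close> is perfect, and non-empty perfect sets in locally compact Hausdorff
  spaces have at least continuum many points.\<close>

lemma closed_subgrp_ge_continuum:
  fixes N :: "('w \<Rightarrow> nat \<Rightarrow> circle) set"
  assumes N: "closed N" "subgrp N" "torsion_free N" "N \<noteq> {0}"
  shows "(UNIV :: real set) \<lesssim> N"
proof -
  obtain x where "x \<in> N" "x \<noteq> 0" using N(2,4) by (auto simp: subgrp_def)
  then have inf: "infinite N" using infinite_torsion_free N by blast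
  have "euclidean derived_set_of N = N"
  proof (intro equalityI subsetI)
    fix x assume "x \<in> euclidean derived_set_of N"
    then have "x \<in> euclidean closure_of N" by (simp add: closure_of)
    then show "x \<in> N" using N(1) by (simp add: closure_of_closedin)
  next
    fix x assume x: "x \<in> N"
    have "\<exists>y. y \<noteq> x \<and> y \<in> N \<and> y \<in> U" if U: "x \<in> U" "open U" for U
    proof (rule ccontr)
      assume "\<not> ?thesis"
      then have iso: "\<And>y. y \<in> N \<Longrightarrow> y \<in> U \<Longrightarrow> y = x" by blast
      have "\<exists>D\<subseteq>N. finite D \<and> N \<subseteq> (\<Union>y\<in>D. {z. z + (x - y) \<in> U})"
      proof (rule compactE_image[OF closed_imp_compact_fun[OF N(1)]])
        show "open {z. z + (x - y) \<in> U}" for y by (rule open_translation_vimage[OF U(2)])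
        show "N \<subseteq> (\<Union>y\<in>N. {z. z + (x - y) \<in> U})" using U(1) by force
      qed blast
      then obtain D where D: "D \<subseteq> N" "finite D" "N \<subseteq> (\<Union>y\<in>D. {z. z + (x - y) \<in> U})" by blast
      have "N \<subseteq> D"
      proof
        fix z assume z: "z \<in> N"
        then obtain y where y: "y \<in> D" "z + (x - y) \<in> U" using D(3) by blast
        have "z + (x - y) \<in> N" using z x y D(1) N(2) by (intro subgrp_add) (auto simp: subgrp_def)
        then have "z + (x - y) = x" using iso y by blast
        then have "z = y" by (simp add: algebra_simps)
        then show "z \<in> D" using y by simp
      qed
      then show False using D(2) inf finite_subset by blast
    qed
    then show "x \<in> euclidean derived_set_of N" by (auto simp: in_derived_set_of)
  qed
  moreover have "locally_compact_space (euclidean :: ('w \<Rightarrow> nat \<Rightarrow> circle) topology)"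
    using compact_UNIV_circle_fun by (intro compact_imp_locally_compact_space) (simp add: compact_space_def)
  ultimately show ?thesis
    using lepoll_perfect_set[of euclidean N] Hausdorff_fun inf by (metis infinite_imp_nonempty)
qed

text \<open>A closed set is determined by the basic open sets that miss it. A basic open set is
  given by finitely many pairs of an index and a member of a countable base, so there are no more of
  them than indices.\<close>

lemma card_closed_sets:
  assumes inf: "infinite (UNIV :: 'w set)"
  shows "|{C :: ('w \<Rightarrow> nat \<Rightarrow> circle) set. closed C}| \<le>o |UNIV :: 'w set set|"
proof -
  obtain B :: "(nat \<Rightarrow> circle) set set" where B: "countable B" "topological_basis B"
    using ex_countable_basis by blast
  define A where "A = (UNIV :: 'w set) \<times> B"
  define U where "U P = {f :: 'w \<Rightarrow> nat \<Rightarrow> circle. \<forall>(w, b)\<in>P. f w \<in> b}" for P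
  have basis: "\<exists>P\<in>Fpow A. f \<in> U P \<and> U P \<subseteq> V" if V: "open V" "f \<in> V" for V f
  proof -
    have "openin (product_topology (\<lambda>_. euclidean) UNIV) V"
      using V(1) by (simp add: euclidean_product_topology)
    then obtain X where X: "f \<in> Pi\<^sub>E UNIV X" "\<And>i. open (X i)" "finite {i. X i \<noteq> UNIV}" "Pi\<^sub>E UNIV X \<subseteq> V"
      using product_topology_open_contains_basis[of "\<lambda>_. euclidean" UNIV V f] V(2) by auto
    have "\<exists>b. b \<in> B \<and> f i \<in> b \<and> b \<subseteq> X i" for i
      using topological_basisE[OF B(2) X(2)[of i], of "f i"] X(1) by (metis PiE_mem UNIV_I)
    then obtain b where b: "\<And>i. b i \<in> B" "\<And>i. f i \<in> b i" "\<And>i. b i \<subseteq> X i" by metis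
    define P where "P = (\<lambda>i. (i, b i)) ` {i. X i \<noteq> UNIV}"
    have "P \<in> Fpow A" using X(3) b(1) by (auto simp: P_def Fpow_def A_def)
    moreover have "f \<in> U P" using b(2) by (auto simp: P_def U_def)
    moreover have "U P \<subseteq> V"
    proof
      fix g assume g: "g \<in> U P"
      have "g i \<in> X i" for i
        using g b(3)[of i] by (cases "X i = UNIV") (auto simp: U_def P_def)
      then show "g \<in> V" using X(4) by (auto simp: PiE_def)
    qed
    ultimately show ?thesis by blast
  qed
  have opU: "f \<in> V" if "f \<in> U P" "U P \<subseteq> V" for f V P using that by blast
  define code where "code C = {P \<in> Fpow A. U P \<subseteq> - C}" for C
  have "inj_on code {C. closed C}"
  proof (rule inj_onI)
    have "- C = (\<Union>P\<in>code C. U P)" if "closed C" for C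
      using basis[of "- C"] that unfolding code_def by (auto simp: open_Compl; blast)
    then show "C = C'" if "C \<in> {C. closed C}" "C' \<in> {C. closed C}" "code C = code C'" for C C'
      using that by (metis double_complement mem_Collect_eq)
  qed
  moreover have "code ` {C. closed C} \<subseteq> Pow (Fpow A)" by (auto simp: code_def)
  ultimately have 1: "|{C :: ('w \<Rightarrow> nat \<Rightarrow> circle) set. closed C}| \<le>o |Pow (Fpow A)|"
    using card_of_ordLeq by blast
  have ne: "B \<noteq> {}" using B(2) topological_basisE[OF B(2), of UNIV undefined] by auto
  have "infinite A" using inf ne by (auto simp: A_def finite_cartesian_product_iff)
  then have "|Fpow A| =o |A|" by (rule card_of_Fpow_infinite)
  moreover have "|B| \<le>o |UNIV :: 'w set|"
  proof -
    have "|B| \<le>o |UNIV :: nat set|"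
      using B(1) unfolding countable_def by (metis card_of_ordLeqI UNIV_I)
    then show ?thesis using inf infinite_iff_card_of_nat ordLeq_transitive by blast
  qed
  then have "|A| \<le>o |UNIV :: 'w set|" unfolding A_def
    using card_of_Times_ordLeq_infinite[OF inf, of UNIV B] ordIso_imp_ordLeq[OF card_of_refl] by blast
  ultimately have "|Fpow A| \<le>o |UNIV :: 'w set|" by (rule ordIso_ordLeq_trans)
  then have "|Pow (Fpow A)| \<le>o |Pow (UNIV :: 'w set)|" by (rule card_of_Pow_mono)
  then show ?thesis using 1 ordLeq_transitive by (metis Pow_UNIV)
qed

section \<open>Integer combinations and the transfinite choice of independent points\<close>

definition lincomb :: "('s \<Rightarrow> 'a::ab_group_add) \<Rightarrow> ('s \<Rightarrow>\<^sub>0 int) \<Rightarrow> 'a" where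
  "lincomb B c = (\<Sum>k\<in>Poly_Mapping.keys c. zs (Poly_Mapping.lookup c k) (B k))"

lemma lincomb_superset:
  assumes "finite A" "Poly_Mapping.keys c \<subseteq> A"
  shows "lincomb B c = (\<Sum>k\<in>A. zs (Poly_Mapping.lookup c k) (B k))"
  unfolding lincomb_def by (rule sum.mono_neutral_left) (use assms in \<open>auto simp: in_keys_iff\<close>)

lemma additive_lincomb: "Modules.additive (lincomb B)"
proof
  fix c d :: "'a \<Rightarrow>\<^sub>0 int"
  let ?A = "Poly_Mapping.keys c \<union> Poly_Mapping.keys d"
  have "Poly_Mapping.keys (c + d) \<subseteq> ?A" by (rule Poly_Mapping.keys_add)
  then show "lincomb B (c + d) = lincomb B c + lincomb B d"
    by (simp add: lincomb_superset[of ?A] lookup_add zs_add_left sum.distrib)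
qed

text \<open>An over-count, sufficient for cardinality bounds. The added 0 keeps the alphabet of the
  lists infinite when \<open>Y\<close> is empty.\<close>

lemma span_subset_lists:
  fixes Y :: "'a::ab_group_add set"
  shows "zm.span Y \<subseteq> (\<lambda>l. sum_list (map (\<lambda>(m, y). zs m y) l)) ` lists ((UNIV :: int set) \<times> insert 0 Y)"
proof -
  define Z where "Z = (UNIV :: int set) \<times> insert 0 Y"
  define f where "f l = sum_list (map (\<lambda>(m, y). zs m y) l)" for l :: "(int \<times> 'a) list"
  have "zm.subspace (f ` lists Z)"
  proof (rule zm.subspaceI)
    show "0 \<in> f ` lists Z" by (rule image_eqI[of _ _ "[]"]) (auto simp: f_def)
    fix x y assume "x \<in> f ` lists Z" "y \<in> f ` lists Z"
    then obtain l l' where l: "x = f l" "l \<in> lists Z" "y = f l'" "l' \<in> lists Z" by blast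
    then have "x + y = f (l @ l')" "l @ l' \<in> lists Z" by (auto simp: f_def)
    then show "x + y \<in> f ` lists Z" by blast
  next
    fix n :: int and x assume "x \<in> f ` lists Z"
    then obtain l where l: "x = f l" "l \<in> lists Z" by blast
    have "zs n (f l) = f (map (\<lambda>(m, y). (n * m, y)) l)"
      by (induction l) (auto simp: f_def zs_add_right zs_zs)
    moreover have "map (\<lambda>(m, y). (n * m, y)) l \<in> lists Z"
      using l(2) by (auto simp: Z_def in_lists_conv_set)
    ultimately show "zs n x \<in> f ` lists Z" using l(1) by blast
  qed
  moreover have "Y \<subseteq> f ` lists Z"
  proof
    fix y assume "y \<in> Y"
    then have "[(1, y)] \<in> lists Z" by (simp add: Z_def)
    moreover have "y = f [(1, y)]" by (simp add: f_def)
    ultimately show "y \<in> f ` lists Z" by blast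
  qed
  ultimately show ?thesis unfolding f_def[abs_def] Z_def by (intro zm.span_minimal)
qed

lemma countable_span: "countable Y \<Longrightarrow> countable (zm.span (Y :: 'a::ab_group_add set))"
  by (rule countable_subset[OF span_subset_lists]) (intro countable_image countable_lists countable_SIGMA; simp)

lemma card_span_less:
  fixes Y :: "'a::ab_group_add set"
  assumes "|Y| <o |S|" "|UNIV :: nat set| <o |S|"
  shows "|zm.span Y| <o |S|"
proof -
  have infS: "infinite S" using assms(2) infinite_iff_card_of_nat ordLess_imp_ordLeq by blast
  define Z where "Z = (UNIV :: int set) \<times> insert 0 Y"
  have infZ: "infinite Z" by (simp add: Z_def finite_cartesian_product_iff)
  have "zm.span Y \<subseteq> (\<lambda>l. sum_list (map (\<lambda>(m, y). zs m y) l)) ` lists Z"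
    unfolding Z_def by (rule span_subset_lists)
  then have "|zm.span Y| \<le>o |lists Z|"
    by (meson card_of_image card_of_mono1 ordLeq_transitive)
  also have "|lists Z| =o |Z|" by (rule card_of_lists_infinite[OF infZ])
  also have "|Z| <o |S|"
  proof -
    have "|UNIV :: int set| <o |S|"
      using assms(2) by (meson card_of_ordIsoI bij_betw_inv_into bij_int_decode ordIso_ordLess_trans)
    moreover have "|insert 0 Y| <o |S|"
      using card_of_Un_ordLess_infinite[OF infS, of "{0}" Y] assms(1) infS by simp
    ultimately show ?thesis unfolding Z_def by (rule card_of_Times_ordLess_infinite[OF infS])
  qed
  finally show ?thesis .
qed

text \<open>Fewer than |S| points precede stage \<open>s\<close>, so their span is smaller than |S|.
  An element with a non-zero multiple in this span is determined by the multiplier and the multiple,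
  as \<open>K\<close> is torsion-free. Hence such elements cannot exhaust a set of size at least
  |S|.\<close>

theorem ex_independent_transversal:
  fixes K :: "'a::ab_group_add set" and S :: "'s set" and \<C> :: "'a set set"
  assumes K: "subgrp K" "torsion_free K"
    and S: "|UNIV :: nat set| <o |S|"
    and \<C>: "|\<C>| \<le>o |S|" "\<C> \<noteq> {}" "\<And>C. C \<in> \<C> \<Longrightarrow> C \<subseteq> K" "\<And>C. C \<in> \<C> \<Longrightarrow> |S| \<le>o |C|"
  obtains B where "\<And>s. s \<in> S \<Longrightarrow> B s \<in> K" "\<And>C. C \<in> \<C> \<Longrightarrow> \<exists>s\<in>S. B s \<in> C"
    "\<And>c. Poly_Mapping.keys c \<subseteq> S \<Longrightarrow> lincomb B c = 0 \<Longrightarrow> c = 0"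
proof -
  have infS: "infinite S" using S infinite_iff_card_of_nat ordLess_imp_ordLeq by blast
  obtain g where g: "g ` S = \<C>" using card_of_ordLeq2[OF \<C>(2), of S] \<C>(1) by blast
  let ?r = "|S|"
  have wo: "wo_rel ?r" by (simp add: wo_rel_def card_of_Well_order)
  have wfr: "wf {(t, s). t \<in> underS ?r s}"
  proof -
    have "{(t, s). t \<in> underS ?r s} = ?r - Id" by (auto simp: underS_def)
    then show ?thesis using card_of_Well_order[of S] by (simp add: well_order_on_def)
  qed
  \<comment> \<open>Only values of \<open>f\<close> below \<open>s\<close> occur, as well-founded
    recursion demands; outside \<open>S\<close> anything is accepted.\<close>
  define P where "P f s r \<longleftrightarrow> s \<in> S \<longrightarrow> r \<in> g s \<and> (\<forall>m. m \<noteq> 0 \<longrightarrow> zs m r \<notin> zm.span (f ` underS ?r s))"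
    for f :: "'s \<Rightarrow> 'a" and s r
  have "\<exists>B. \<forall>s. P B s (B s)"
  proof (rule dependent_wf_choice[OF wfr])
    fix f h :: "'s \<Rightarrow> 'a" and s r
    assume "\<And>t. (t, s) \<in> {(t, s). t \<in> underS ?r s} \<Longrightarrow> f t = h t"
    then have "f ` underS ?r s = h ` underS ?r s" by (intro image_cong) auto
    then show "P f s r = P h s r" by (simp add: P_def)
  next
    fix s and f :: "'s \<Rightarrow> 'a"
    show "\<exists>r. P f s r"
    proof (cases "s \<in> S")
      case True
      define Y where "Y = f ` underS ?r s"
      have "|underS ?r s| <o ?r"
        using card_of_underS[OF card_of_Card_order, of s S] True by (simp add: Field_card_of)
      then have Y: "|Y| <o |S|" unfolding Y_def using card_of_image ordLeq_ordLess_trans by blast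
      define D where "D = {r \<in> K. \<exists>m. m \<noteq> 0 \<and> zs m r \<in> zm.span Y}"
      have "\<forall>r\<in>D. \<exists>m. m \<noteq> 0 \<and> zs m r \<in> zm.span Y" by (simp add: D_def)
      then obtain mm where mm: "\<And>r. r \<in> D \<Longrightarrow> mm r \<noteq> 0 \<and> zs (mm r) r \<in> zm.span Y"
        by (metis bchoice)
      have "inj_on (\<lambda>r. (mm r, zs (mm r) r)) D"
      proof (rule inj_onI)
        fix r r' assume r: "r \<in> D" "r' \<in> D" and eq: "(mm r, zs (mm r) r) = (mm r', zs (mm r') r')"
        then have "zs (mm r) r = zs (mm r) r'" by (metis Pair_inject)
        then have "zs (mm r) (r - r') = 0" by (simp add: zm.scale_right_diff_distrib)
        moreover have "r - r' \<in> K" using r K(1) by (simp add: D_def subgrp_def)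
        ultimately show "r = r'" using K(2) mm[OF r(1)] unfolding torsion_free_def by (metis eq_iff_diff_eq_0)
      qed
      moreover have "(\<lambda>r. (mm r, zs (mm r) r)) ` D \<subseteq> UNIV \<times> zm.span Y" using mm by auto
      ultimately have "|D| \<le>o |(UNIV :: int set) \<times> zm.span Y|" using card_of_ordLeq by blast
      moreover have "|UNIV :: int set| <o |S|"
        using S by (meson card_of_ordIsoI bij_betw_inv_into bij_int_decode ordIso_ordLess_trans)
      then have "|(UNIV :: int set) \<times> zm.span Y| <o |S|"
        using card_span_less[OF Y S] by (intro card_of_Times_ordLess_infinite[OF infS])
      ultimately have "|D| <o |S|" by (rule ordLeq_ordLess_trans)
      moreover have gs: "g s \<in> \<C>" using g True by blast
      ultimately have "|D| <o |g s|" using \<C>(4) ordLess_ordLeq_trans by blast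
      then have "\<not> g s \<subseteq> D" using card_of_mono1 not_ordLess_ordLeq by blast
      then obtain r where "r \<in> g s" "r \<notin> D" by blast
      then have "P f s r" using \<C>(3)[OF gs] by (auto simp: P_def D_def Y_def)
      then show ?thesis by blast
    qed (simp add: P_def)
  qed
  then obtain B where B: "\<And>s. s \<in> S \<Longrightarrow> B s \<in> g s"
    "\<And>s m. s \<in> S \<Longrightarrow> m \<noteq> 0 \<Longrightarrow> zs m (B s) \<notin> zm.span (B ` underS ?r s)"
    unfolding P_def by blast
  show ?thesis
  proof (rule that[of B])
    show "B s \<in> K" if "s \<in> S" for s using B(1)[OF that] \<C>(3) g that by blast
    show "\<exists>s\<in>S. B s \<in> C" if "C \<in> \<C>" for C using B(1) g that by blast
    fix c :: "'s \<Rightarrow>\<^sub>0 int" assume c: "Poly_Mapping.keys c \<subseteq> S" "lincomb B c = 0"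
    show "c = 0"
    proof (rule ccontr)
      assume "c \<noteq> 0"
      then have ne: "Poly_Mapping.keys c \<noteq> {}" by simp
      \<comment> \<open>The largest index in the relation: solving for its term puts a non-zero
        multiple of that point into the span of its predecessors.\<close>
      have "\<exists>k\<in>Poly_Mapping.keys c. \<forall>j\<in>Poly_Mapping.keys c. j \<noteq> k \<longrightarrow> j \<in> underS ?r k"
      proof -
        have "\<exists>k\<in>A. \<forall>j\<in>A. j \<noteq> k \<longrightarrow> j \<in> underS ?r k" if "finite A" "A \<noteq> {}" "A \<subseteq> S" for A
          using that
        proof (induction A rule: finite_ne_induct)
          case (insert a A)
          then obtain k where k: "k \<in> A" "\<forall>j\<in>A. j \<noteq> k \<longrightarrow> j \<in> underS ?r k" by auto
          have tot: "(a, k) \<in> ?r \<or> (k, a) \<in> ?r"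
            using wo_rel.TOTALS[OF wo] insert k by (auto simp: Field_card_of)
          show ?case
          proof (cases "(a, k) \<in> ?r")
            case True
            then have "a \<in> underS ?r k" using insert k by (auto simp: underS_def)
            then show ?thesis using k by auto
          next
            case False
            then have ka: "(k, a) \<in> ?r" using tot by blast
            have "j \<in> underS ?r a" if "j \<in> A" for j
            proof -
              have "(j, k) \<in> ?r" using k that wo_rel.REFL[OF wo] insert
                by (cases "j = k") (auto simp: underS_def refl_on_def Field_card_of)
              then have "(j, a) \<in> ?r" using ka wo_rel.TRANS[OF wo] by (meson transE)
              then show ?thesis using that insert by (auto simp: underS_def)
            qed
            then show ?thesis by auto
          qed
        qed simp
        then show ?thesis using ne c(1) by simp
      qed
      then obtain k where k: "k \<in> Poly_Mapping.keys c"
        "\<And>j. j \<in> Poly_Mapping.keys c \<Longrightarrow> j \<noteq> k \<Longrightarrow> j \<in> underS ?r k" by blast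
      have "lincomb B c = zs (Poly_Mapping.lookup c k) (B k) +
          (\<Sum>j\<in>Poly_Mapping.keys c - {k}. zs (Poly_Mapping.lookup c j) (B j))"
        unfolding lincomb_def by (rule sum.remove) (use k in auto)
      then have "zs (Poly_Mapping.lookup c k) (B k) = - (\<Sum>j\<in>Poly_Mapping.keys c - {k}. zs (Poly_Mapping.lookup c j) (B j))"
        using c(2) by (simp add: eq_neg_iff_add_eq_0)
      also have "\<dots> \<in> zm.span (B ` underS ?r k)"
        by (intro zm.span_neg zm.span_sum zm.span_scale zm.span_base imageI k(2)) auto
      finally show False
        using B(2)[of k "Poly_Mapping.lookup c k"] k(1) c(1) by (auto simp: in_keys_iff)
    qed
  qed
qed

section \<open>Independence modulo a prime and quasicyclic groups\<close>

text \<open>For prime \<open>p\<close> this is the quasicyclic group, realised as the roots of unity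
  of \<open>p\<close>-power order.\<close>

definition prim_part :: "nat \<Rightarrow> circle set" where
  "prim_part p = {z. \<exists>n. zs (int (p ^ n)) z = 0}"

lemma circle_divisible:
  assumes "m > (0::nat)"
  obtains v :: circle where "zs (int m) v = u"
proof -
  obtain t where t: "cval u = cis t"
    using norm_cval[of u] by (metis cis_Arg_unique complex_norm_eq_1_exp cis_conv_exp)
  define v where "v = Circ (cis (t / real m))"
  have "cval (zs (int m) v) = cis (t / real m) ^ m" by (simp add: cval_zs v_def Circ_inverse)
  also have "\<dots> = cis (real m * (t / real m))" by (rule Complex.DeMoivre)
  also have "\<dots> = cval u" using assms t by simp
  finally show ?thesis using that cval_inject_iff by blast
qed

lemma prim_part_le:
  assumes "zs (int (p ^ n)) z = 0" "n \<le> m"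
  shows "zs (int (p ^ m)) z = 0"
proof -
  have "int (p ^ m) = int (p ^ (m - n)) * int (p ^ n)"
    using assms(2) by (metis le_add_diff_inverse2 of_nat_mult power_add)
  then have "zs (int (p ^ m)) z = zs (int (p ^ (m - n))) (zs (int (p ^ n)) z)" by (simp only: zs_zs)
  then show ?thesis using assms(1) by (simp only: zm.scale_zero_right)
qed

lemma subgrp_prim_part: "subgrp (prim_part p)"
  unfolding subgrp_def
proof (intro conjI ballI)
  show "0 \<in> prim_part p" by (simp add: prim_part_def)
  fix x y assume "x \<in> prim_part p" "y \<in> prim_part p"
  then obtain m n where mn: "zs (int (p ^ m)) x = 0" "zs (int (p ^ n)) y = 0" by (auto simp: prim_part_def)
  have "zs (int (p ^ (m + n))) x = 0" "zs (int (p ^ (m + n))) y = 0"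
    using prim_part_le[OF mn(1), of "m + n"] prim_part_le[OF mn(2), of "m + n"] by auto
  then have "zs (int (p ^ (m + n))) (x - y) = 0" by (simp only: zm.scale_right_diff_distrib) simp
  then show "x - y \<in> prim_part p" unfolding prim_part_def by blast
qed

lemma finite_torsion: "m > 0 \<Longrightarrow> finite {z :: circle. zs (int m) z = 0}"
  and card_torsion: "m > 0 \<Longrightarrow> card {z :: circle. zs (int m) z = 0} \<le> m"
proof -
  assume m: "m > 0"
  have sub: "cval ` {z :: circle. zs (int m) z = 0} \<subseteq> {w. w ^ m = 1}"
  proof safe
    fix z :: circle assume "zs (int m) z = 0"
    then have "cval (zs (int m) z) = 1" by simp
    then show "cval z ^ m = 1" by (simp add: cval_zs)
  qed
  have inj: "inj_on cval {z :: circle. zs (int m) z = 0}" by (simp add: inj_on_def cval_inject_iff)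
  have fin: "finite {w::complex. w ^ m = 1}" using finite_roots_unity[of m] m by simp
  show "finite {z :: circle. zs (int m) z = 0}" using finite_subset[OF sub fin] inj by (rule finite_imageD)
  have "card {z :: circle. zs (int m) z = 0} \<le> card {w::complex. w ^ m = 1}"
    using card_mono[OF fin sub] card_image[OF inj] by simp
  also have "\<dots> \<le> m" using card_roots_unity[of m] m by simp
  finally show "card {z :: circle. zs (int m) z = 0} \<le> m" .
qed

lemma countable_prim_part: "prime p \<Longrightarrow> countable (prim_part p)"
proof -
  assume p: "prime p"
  have "prim_part p = (\<Union>n. {z. zs (int (p ^ n)) z = 0})" by (auto simp: prim_part_def)
  moreover have "countable {z :: circle. zs (int (p ^ n)) z = 0}" for n
    using finite_torsion[of "p ^ n"] p by (intro countable_finite) (simp add: prime_gt_0_nat)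
  ultimately show ?thesis by simp
qed

text \<open>Divide \<open>u\<close> by \<open>m\<close> in the circle and remove from the quotient
  the part of order prime to \<open>p\<close>. This is done by a multiple that is 1 modulo a power
  of \<open>p\<close> killing \<open>u\<close> and is divisible by the prime-to-\<open>p\<close>
  part of \<open>m\<close>.\<close>

lemma prim_part_divisible:
  assumes p: "prime p" and u: "u \<in> prim_part p" and m: "m > (0::nat)"
  obtains v where "v \<in> prim_part p" "zs (int m) v = u"
proof -
  obtain n where n: "zs (int (p ^ n)) u = 0" using u by (auto simp: prim_part_def)
  obtain m' where m': "m = p ^ multiplicity p m * m'" "\<not> p dvd m'"
    using multiplicity_decompose'[of m p] m p by (metis not_prime_unit gr_implies_not0)
  define k where "k = multiplicity p m"
  have "coprime p m'" using m'(2) p by (intro prime_imp_coprime)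
  then have "coprime (int m') (int (p ^ (n + k)))" by (simp add: coprime_commute)
  then obtain s t where st: "s * int m' + t * int (p ^ (n + k)) = 1"
    by (metis bezout_int coprime_iff_gcd_eq_1)
  obtain v0 where v0: "zs (int m) v0 = u" using circle_divisible[OF m] .
  define v where "v = zs (s * int m') v0"
  have "zs (int (p ^ (n + k))) v = zs (s * int (p ^ n)) (zs (int m) v0)"
    using m'(1) by (simp add: v_def zs_zs power_add k_def[symmetric] mult_ac)
  also have "\<dots> = zs s (zs (int (p ^ n)) u)" by (simp add: v0 zs_zs)
  also have "\<dots> = 0" by (simp only: n zm.scale_zero_right)
  finally have "v \<in> prim_part p" unfolding prim_part_def by blast
  moreover have "zs (int m) v = u"
  proof -
    have "zs (int m) v = zs (s * int m') u" by (simp add: v_def v0[symmetric] zs_zs mult_ac)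
    also have "\<dots> = zs (s * int m') u + zs t (zs (int (p ^ (n + k))) u)"
      using prim_part_le[OF n, of "n + k"] by simp
    also have "\<dots> = zs (s * int m' + t * int (p ^ (n + k))) u" by (simp add: zs_add_left zs_zs)
    finally show ?thesis using st by simp
  qed
  ultimately show ?thesis using that by blast
qed

text \<open>\<open>D\<close> contains an element of order \<open>p\<close>, and its \<open>p\<close>
  multiples are all solutions of \<open>zs (int p) z = 0\<close>, as the circle has at most
  \<open>p\<close> of them. Divisibility then lifts membership from exponent \<open>n\<close> to
  \<open>Suc n\<close>.\<close>

lemma prim_part_subset:
  assumes p: "prime p" and D: "subgrp D" "D \<subseteq> prim_part p" "D \<noteq> {0}"
    and div: "\<And>z. z \<in> D \<Longrightarrow> \<exists>u\<in>D. zs (int p) u = z"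
  shows "prim_part p \<subseteq> D"
proof -
  obtain z0 where z0: "z0 \<in> D" "z0 \<noteq> 0" using D(1,3) by (auto simp: subgrp_def)
  define n where "n = (LEAST n. zs (int (p ^ n)) z0 = 0)"
  have ex: "\<exists>n. zs (int (p ^ n)) z0 = 0" using z0 D(2) by (auto simp: prim_part_def)
  have n: "zs (int (p ^ n)) z0 = 0" unfolding n_def using ex by (rule LeastI_ex)
  have "n \<noteq> 0" using n z0 by (metis power_0 of_nat_1 zs_1)
  then obtain k where k: "n = Suc k" by (cases n) auto
  define z1 where "z1 = zs (int (p ^ k)) z0"
  have z1: "z1 \<noteq> 0" using not_less_Least[of k "\<lambda>n. zs (int (p ^ n)) z0 = 0"] k by (auto simp: z1_def n_def)
  have pz1: "zs (int p) z1 = 0" using n by (simp add: z1_def zs_zs k)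
  have z1D: "z1 \<in> D" unfolding z1_def using D(1) z0(1) by (rule subgrp_zs)
  have inj: "inj_on (\<lambda>j. zs (int j) z1) {..<p}"
  proof -
    have "zs (int j) z1 \<noteq> zs (int i) z1" if "i < j" "j < p" for i j
    proof
      assume "zs (int j) z1 = zs (int i) z1"
      then have e: "zs (int j - int i) z1 = 0" by (simp add: zm.scale_left_diff_distrib)
      have "\<not> p dvd (j - i)" using that by (auto dest: dvd_imp_le)
      then have "coprime p (j - i)" using p by (intro prime_imp_coprime)
      then have "coprime (int (j - i)) (int p)" by (simp add: coprime_commute)
      then obtain s t where "s * int (j - i) + t * int p = 1" by (metis bezout_int coprime_iff_gcd_eq_1)
      then have "z1 = zs (s * int (j - i) + t * int p) z1" by simp
      also have "\<dots> = zs s (zs (int j - int i) z1) + zs t (zs (int p) z1)"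
        using that by (simp add: zs_add_left zs_zs of_nat_diff)
      finally show False using e pz1 z1 by simp
    qed
    then show ?thesis by (auto simp: inj_on_def) (metis linorder_neqE_nat)
  qed
  have ker: "{z :: circle. zs (int p) z = 0} \<subseteq> D"
  proof -
    have sub: "(\<lambda>j. zs (int j) z1) ` {..<p} \<subseteq> {z :: circle. zs (int p) z = 0}"
    proof safe
      fix j
      have "zs (int p) (zs (int j) z1) = zs (int j) (zs (int p) z1)" by (simp add: zs_zs mult.commute)
      then show "zs (int p) (zs (int j) z1) = 0" using pz1 by simp
    qed
    have "card ((\<lambda>j. zs (int j) z1) ` {..<p}) = p" using card_image[OF inj] by simp
    then have "(\<lambda>j. zs (int j) z1) ` {..<p} = {z :: circle. zs (int p) z = 0}"
      using card_torsion[of p] finite_torsion[of p] sub p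
      by (intro card_seteq) (auto simp: prime_gt_0_nat)
    moreover have "(\<lambda>j. zs (int j) z1) ` {..<p} \<subseteq> D" using z1D D(1) by (auto intro: subgrp_zs)
    ultimately show ?thesis by simp
  qed
  have "z \<in> D" if "zs (int (p ^ n)) z = 0" for n z
    using that
  proof (induction n arbitrary: z)
    case 0
    then show ?case using D(1) by (simp add: subgrp_def)
  next
    case (Suc n)
    have "zs (int (p ^ n)) (zs (int p) z) = 0" using Suc.prems by (simp add: zs_zs mult.commute)
    then have "zs (int p) z \<in> D" by (rule Suc.IH)
    then obtain u where u: "u \<in> D" "zs (int p) u = zs (int p) z" using div by metis
    then have "zs (int p) (z - u) = 0" by (simp add: zm.scale_right_diff_distrib)
    then have "z - u \<in> D" using ker by blast
    then show ?case using subgrp_add[OF D(1) _ u(1), of "z - u"] by simp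
  qed
  then show ?thesis by (auto simp: prim_part_def)
qed

text \<open>The condition under which any assignment of elements killed by \<open>p\<close> respects
  all relations within \<open>X\<close>. It admits elements of infinite order and elements of order
  \<open>p\<close>, so one notion covers both sources of size in an abelian group.\<close>

definition pindep :: "nat \<Rightarrow> 'b::ab_group_add set \<Rightarrow> bool" where
  "pindep p X \<longleftrightarrow> (\<forall>c. Poly_Mapping.keys c \<subseteq> X \<longrightarrow> lincomb (\<lambda>x. x) c = 0 \<longrightarrow>
     (\<forall>x. int p dvd Poly_Mapping.lookup c x))"

lemma ex_maximal_pindep:
  obtains X where "X \<subseteq> A" "pindep p X" "\<And>Y. Y \<subseteq> A \<Longrightarrow> pindep p Y \<Longrightarrow> X \<subseteq> Y \<Longrightarrow> Y = X"
proof -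
  define I where "I = {X. X \<subseteq> A \<and> pindep p X}"
  have "\<exists>M\<in>I. \<forall>X\<in>I. M \<subseteq> X \<longrightarrow> X = M"
  proof (rule subset_Zorn')
    fix C assume C: "subset.chain I C"
    have "pindep p (\<Union>C)"
      unfolding pindep_def
    proof (intro allI impI)
      fix c and x assume c: "Poly_Mapping.keys c \<subseteq> \<Union>C" "lincomb (\<lambda>x. x) c = 0"
      show "int p dvd Poly_Mapping.lookup c x"
      proof (cases "C = {}")
        case True
        then show ?thesis using c(1) by simp
      next
        case False
        then obtain X where "X \<in> C" "Poly_Mapping.keys c \<subseteq> X"
          using finite_subset_Union_chain[OF _ c(1) _ C] by auto
        then show ?thesis using C c(2) by (auto simp: subset.chain_def I_def pindep_def)
      qed
    qed
    moreover have "\<Union>C \<subseteq> A" using C by (auto simp: subset.chain_def I_def)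
    ultimately show "\<Union>C \<in> I" by (simp add: I_def)
  qed
  then show ?thesis using that by (auto simp: I_def)
qed

lemma countable_preimage:
  fixes A :: "'b::ab_group_add set"
  assumes A: "subgrp A" and Y: "countable Y" and ker: "countable {a\<in>A. zs m a = 0}"
  shows "countable {a\<in>A. zs m a \<in> Y}"
proof -
  have "countable {a\<in>A. zs m a = y}" for y
  proof (cases "\<exists>a0\<in>A. zs m a0 = y")
    case True
    then obtain a0 where a0: "a0 \<in> A" "zs m a0 = y" by blast
    have "{a\<in>A. zs m a = y} \<subseteq> (\<lambda>a. a + a0) ` {a\<in>A. zs m a = 0}"
    proof
      fix a assume a: "a \<in> {a\<in>A. zs m a = y}"
      then have "a - a0 \<in> {a\<in>A. zs m a = 0}"
        using a0 A by (simp add: zm.scale_right_diff_distrib subgrp_def)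
      then show "a \<in> (\<lambda>a. a + a0) ` {a\<in>A. zs m a = 0}" by (intro image_eqI[of _ _ "a - a0"]) simp_all
    qed
    then show ?thesis using ker by (meson countable_image countable_subset)
  qed (auto simp: countable_empty intro: countable_subset[of _ "{}"])
  moreover have "{a\<in>A. zs m a \<in> Y} = (\<Union>y\<in>Y. {a\<in>A. zs m a = y})" by blast
  ultimately show ?thesis using Y by simp
qed

text \<open>Otherwise maximal \<open>p\<close>-independent sets are countable for all primes, and so
  is the span \<open>B\<close> of their union. Maximality gives every element a non-zero multiple in
  \<open>B\<close> and puts every element killed by a prime into \<open>B\<close>. Hence the torsion
  is countable, and then \<open>A\<close> is too.\<close>

lemma ex_uncountable_pindep:
  fixes A :: "'b::ab_group_add set"
  assumes A: "subgrp A" "uncountable A"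
  obtains p X where "prime p" "X \<subseteq> A" "pindep p X" "uncountable X"
proof -
  have "\<exists>p X. prime p \<and> X \<subseteq> A \<and> pindep p X \<and> uncountable X"
  proof (rule ccontr)
    assume neg: "\<not> ?thesis"
    have "\<forall>p. \<exists>X. X \<subseteq> A \<and> pindep p X \<and> (\<forall>Y. Y \<subseteq> A \<longrightarrow> pindep p Y \<longrightarrow> X \<subseteq> Y \<longrightarrow> Y = X)"
      using ex_maximal_pindep[of A] by metis
    then obtain X where X: "\<And>p. X p \<subseteq> A" "\<And>p. pindep p (X p)"
      "\<And>p Y. Y \<subseteq> A \<Longrightarrow> pindep p Y \<Longrightarrow> X p \<subseteq> Y \<Longrightarrow> Y = X p" by metis
    define B where "B = zm.span (\<Union>p\<in>{p. prime p}. X p)"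
    have cB: "countable B"
      unfolding B_def using neg X by (intro countable_span countable_UN) auto
    have key: "\<exists>m. m \<noteq> 0 \<and> zs m a \<in> B \<and> (zs (int p) a = 0 \<longrightarrow> a \<in> B)" if a: "a \<in> A" and p: "prime p" for a p
    proof (cases "a \<in> X p")
      case True
      then have "a \<in> B" unfolding B_def using p by (intro zm.span_base) blast
      then show ?thesis by (intro exI[of _ 1]) simp
    next
      case False
      then have "\<not> pindep p (insert a (X p))" using X(3)[of "insert a (X p)" p] X(1) a by blast
      then obtain c x where c: "Poly_Mapping.keys c \<subseteq> insert a (X p)" "lincomb (\<lambda>x. x) c = 0"
        "\<not> int p dvd Poly_Mapping.lookup c x" by (auto simp: pindep_def)
      define m where "m = Poly_Mapping.lookup c a"
      define c' where "c' = c - Poly_Mapping.single a m"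
      have lc': "Poly_Mapping.lookup c' y = (if y = a then 0 else Poly_Mapping.lookup c y)" for y
        by (simp add: c'_def m_def lookup_minus lookup_single)
      have kc': "Poly_Mapping.keys c' \<subseteq> X p" using c(1) by (auto simp: in_keys_iff lc' split: if_splits)
      interpret L: Modules.additive "lincomb (\<lambda>x::'b. x)" by (rule additive_lincomb)
      have single: "lincomb (\<lambda>x. x) (Poly_Mapping.single a m) = zs m a"
        by (simp add: lincomb_superset[of "{a}"])
      have lin: "lincomb (\<lambda>x. x) c' = - zs m a"
        unfolding c'_def L.diff single using c(2) by simp
      have c'B: "lincomb (\<lambda>x. x) c' \<in> B"
        unfolding lincomb_def B_def using kc' p by (intro zm.span_sum zm.span_scale zm.span_base) blast
      have maB: "zs m a \<in> B" using zm.span_neg[OF c'B[unfolded B_def]] lin by (simp add: B_def)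
      have notdvd: "\<not> (zs m a = 0 \<and> int p dvd m)"
      proof
        assume ma: "zs m a = 0 \<and> int p dvd m"
        then have "int p dvd Poly_Mapping.lookup c' y" for y
          using X(2)[of p] kc' lin by (simp add: pindep_def)
        then have "int p dvd Poly_Mapping.lookup c x" using ma lc'[of x] by (metis m_def)
        then show False using c(3) by blast
      qed
      have "m \<noteq> 0" using notdvd by auto
      moreover have "a \<in> B" if pa: "zs (int p) a = 0"
      proof -
        have "\<not> int p dvd m"
        proof
          assume "int p dvd m"
          then obtain k where "m = k * int p" by (metis dvdE mult.commute)
          then have "zs m a = zs k (zs (int p) a)" by (simp add: zs_zs)
          then show False using pa notdvd \<open>int p dvd m\<close> by simp
        qed
        then have "coprime (int p) m" using p by (intro prime_imp_coprime) simp_all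
        then have "coprime m (int p)" by (simp add: coprime_commute)
        then obtain s t where "s * m + t * int p = 1" by (metis bezout_int coprime_iff_gcd_eq_1)
        then have "a = zs (s * m + t * int p) a" by simp
        also have "\<dots> = zs s (zs m a) + zs t (zs (int p) a)" by (simp add: zs_add_left zs_zs)
        also have "\<dots> = zs s (zs m a)" using pa by simp
        finally show ?thesis using zm.span_scale[of "zs m a" _ s] maB unfolding B_def by metis
      qed
      ultimately show ?thesis using maB by blast
    qed
    \<comment> \<open>One prime factor at a time: multiplication by \<open>p\<close> maps the
      \<open>n\<close>-torsion to the \<open>k\<close>-torsion, and its fibres are countable because
      the \<open>p\<close>-torsion lies in \<open>B\<close>.\<close>
    have tors: "countable {a\<in>A. zs (int n) a = 0}" if "n > 0" for n
      using that
    proof (induction n rule: less_induct)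
      case (less n)
      show ?case
      proof (cases "n = 1")
        case True
        have "{a\<in>A. zs (int n) a = 0} \<subseteq> {0}" using True by auto
        then show ?thesis by (rule countable_subset) simp
      next
        case False
        then obtain p k where p: "prime p" "n = p * k" using prime_factor_nat[of n] by (auto elim: dvdE)
        then have "k < n" "k > 0" using less.prems prime_gt_1_nat[of p] by auto
        then have "countable {a\<in>A. zs (int k) a = 0}" by (rule less.IH)
        moreover have "countable {a\<in>A. zs (int p) a = 0}"
          by (rule countable_subset[OF _ cB]) (use key p(1) in blast)
        ultimately have "countable {a\<in>A. zs (int p) a \<in> {a\<in>A. zs (int k) a = 0}}"
          by (intro countable_preimage A(1))
        moreover have "{a\<in>A. zs (int n) a = 0} \<subseteq> {a\<in>A. zs (int p) a \<in> {a\<in>A. zs (int k) a = 0}}"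
          using p(2) by (auto simp: zs_zs mult.commute intro: subgrp_zs[OF A(1)])
        ultimately show ?thesis using countable_subset by blast
      qed
    qed
    have tors': "countable {a\<in>A. zs m a = 0}" if "m \<noteq> 0" for m
    proof -
      have "zs (int (nat \<bar>m\<bar>)) a = 0 \<longleftrightarrow> zs m a = 0" for a :: 'b by (auto simp: abs_if)
      then show ?thesis using tors[of "nat \<bar>m\<bar>"] that by simp
    qed
    have "A \<subseteq> (\<Union>m\<in>{m. m \<noteq> 0}. {a\<in>A. zs m a \<in> B})" using key[OF _ two_is_prime_nat] by blast
    moreover have "countable (\<Union>m\<in>{m::int. m \<noteq> 0}. {a\<in>A. zs m a \<in> B})"
      using tors' cB A(1) by (intro countable_UN countable_preimage) auto
    ultimately show False using A(2) countable_subset by blast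
  qed
  then show ?thesis using that by blast
qed

text \<open>Injectivity of the quasicyclic group, applied to the graph of a partial homomorphism.\<close>

lemma extend_to_prim_part:
  fixes R0 :: "('b::ab_group_add \<times> circle) set"
  assumes p: "prime p" and R0: "subgrp R0" "R0 \<subseteq> UNIV \<times> prim_part p" "\<And>z. (0, z) \<in> R0 \<Longrightarrow> z = 0"
  obtains h where "Modules.additive h" "range h \<subseteq> prim_part p" "\<And>a z. (a, z) \<in> R0 \<Longrightarrow> h a = z"
proof -
  define I where "I = {R. subgrp R \<and> R0 \<subseteq> R \<and> R \<subseteq> UNIV \<times> prim_part p \<and> (\<forall>z. (0, z) \<in> R \<longrightarrow> z = 0)}"
  have "R0 \<in> I" using R0 by (auto simp: I_def)
  have "\<exists>M\<in>I. \<forall>X\<in>I. M \<subseteq> X \<longrightarrow> X = M"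
  proof (rule subset_Zorn)
    fix C assume C: "subset.chain I C"
    show "\<exists>U\<in>I. \<forall>X\<in>C. X \<subseteq> U"
    proof (cases "C = {}")
      case True
      then show ?thesis using \<open>R0 \<in> I\<close> by blast
    next
      case False
      have CI: "X \<in> I" if "X \<in> C" for X using C that by (auto simp: subset.chain_def)
      have "subgrp (\<Union>C)"
        unfolding subgrp_def
      proof (intro conjI ballI)
        show "0 \<in> \<Union>C" using False CI by (auto simp: I_def subgrp_def)
        fix x y assume "x \<in> \<Union>C" "y \<in> \<Union>C"
        then obtain X Y where XY: "X \<in> C" "x \<in> X" "Y \<in> C" "y \<in> Y" by blast
        then have "X \<subseteq> Y \<or> Y \<subseteq> X" using C by (auto simp: subset.chain_def)
        then obtain Z where "Z \<in> C" "x \<in> Z" "y \<in> Z" using XY by blast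
        then show "x - y \<in> \<Union>C" using CI[of Z] by (auto simp: I_def subgrp_def)
      qed
      moreover have "R0 \<subseteq> \<Union>C" using False CI by (fastforce simp: I_def)
      moreover have "\<Union>C \<subseteq> UNIV \<times> prim_part p" using CI unfolding I_def by blast
      moreover have "\<forall>z. (0, z) \<in> \<Union>C \<longrightarrow> z = 0" using CI unfolding I_def by blast
      ultimately have "\<Union>C \<in> I" by (simp add: I_def)
      then show ?thesis by blast
    qed
  qed
  then obtain R where RI: "R \<in> I" and max: "\<And>X. X \<in> I \<Longrightarrow> R \<subseteq> X \<Longrightarrow> X = R" by blast
  have R: "subgrp R" "R0 \<subseteq> R" "R \<subseteq> UNIV \<times> prim_part p" "\<And>z. (0, z) \<in> R \<Longrightarrow> z = 0"
    using RI by (auto simp: I_def)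
  have Radd: "(a + b, z + w) \<in> R" if "(a, z) \<in> R" "(b, w) \<in> R" for a b z w
    using subgrp_add[OF R(1) that] by simp
  have Rdiff: "(a - b, z - w) \<in> R" if "(a, z) \<in> R" "(b, w) \<in> R" for a b z w
    using R(1) that unfolding subgrp_def by (metis diff_Pair)
  have zsP: "zs k (a, z) = (zs k a, zs k z)" for k and a :: 'b and z :: circle
    using zs_additive[of fst k "(a, z)"] zs_additive[of snd k "(a, z)"]
    by (simp add: Modules.additive_def prod_eq_iff)
  have Rzs: "(zs k a, zs k z) \<in> R" if "(a, z) \<in> R" for k a z
    using subgrp_zs[OF R(1) that, of k] by (simp add: zsP)
  have single: "z = w" if "(a, z) \<in> R" "(a, w) \<in> R" for a z w
    using R(4)[of "z - w"] Rdiff[OF that] by simp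
  have total: "\<exists>z. (a, z) \<in> R" for a
  proof (rule ccontr)
    assume nd: "\<not> (\<exists>z. (a, z) \<in> R)"
    \<comment> \<open>A value for \<open>a\<close> that agrees with \<open>R\<close> on all
      multiples of \<open>a\<close> in its domain. If only the zero multiple lies there, 0 will do;
      otherwise the value at the least positive multiple \<open>m\<close> is divided by
      \<open>m\<close>.\<close>
    have "\<exists>v\<in>prim_part p. \<forall>k z. (zs k a, z) \<in> R \<longrightarrow> z = zs k v"
    proof (cases "\<exists>m>(0::nat). \<exists>z. (zs (int m) a, z) \<in> R")
      case False
      have "k = 0" if kR: "(zs k a, z) \<in> R" for k z
      proof (rule ccontr)
        assume "k \<noteq> 0"
        have neg: "(zs (- k) a, zs (- 1) z) \<in> R" using Rzs[OF kR, of "- 1"] by (simp only: zs_zs) simp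
        show False
        proof (cases "0 < k")
          case True
          then have "nat k > 0" "(zs (int (nat k)) a, z) \<in> R" using kR by simp_all
          then show False using False by blast
        next
          case nk: False
          then have "nat (- k) > 0" "(zs (int (nat (- k))) a, zs (- 1) z) \<in> R" using neg \<open>k \<noteq> 0\<close> by simp_all
          then show False using False by blast
        qed
      qed
      then have "\<forall>k z. (zs k a, z) \<in> R \<longrightarrow> z = zs k 0" using R(4) by (metis zm.scale_zero_right zs_0)
      moreover have "0 \<in> prim_part p" using subgrp_prim_part by (simp add: subgrp_def)
      ultimately show ?thesis by blast
    next
      case True
      define m where "m = (LEAST m::nat. m > 0 \<and> (\<exists>z. (zs (int m) a, z) \<in> R))"
      have "m > 0 \<and> (\<exists>z. (zs (int m) a, z) \<in> R)" unfolding m_def using True by (rule LeastI_ex)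
      then obtain u where m: "m > 0" "(zs (int m) a, u) \<in> R" by blast
      have least: "\<not> (\<exists>z. (zs (int j) a, z) \<in> R)" if "0 < j" "j < m" for j
        using not_less_Least[of j "\<lambda>m. m > 0 \<and> (\<exists>z. (zs (int m) a, z) \<in> R)"] that by (auto simp: m_def)
      have "u \<in> prim_part p" using m R(3) by blast
      then obtain v where v: "v \<in> prim_part p" "zs (int m) v = u" using prim_part_divisible[OF p _ m(1)] by blast
      have "z = zs k v" if kR: "(zs k a, z) \<in> R" for k z
      proof -
        define q r where "q = k div int m" and "r = k mod int m"
        have kqr: "k = q * int m + r" by (simp add: q_def r_def)
        have qR: "(zs (q * int m) a, zs q u) \<in> R" using Rzs[OF m(2), of q] by (simp add: zs_zs)
        then have rR: "(zs r a, z - zs q u) \<in> R"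
          using Rdiff[OF kR qR] by (simp add: kqr zs_add_left)
        have "0 \<le> r" "r < int m" using m(1) by (simp_all add: r_def)
        then have "nat r < m" "r = int (nat r)" by auto
        then have "r = 0" using least[of "nat r"] rR by (metis gr0I of_nat_0)
        then have "(0, z - zs q u) \<in> R" using rR by simp
        then have "z - zs q u = 0" by (rule R(4))
        then show ?thesis using \<open>r = 0\<close> kqr v(2) by (simp add: zs_zs[symmetric])
      qed
      then show ?thesis using v(1) by blast
    qed
    then obtain v where v: "v \<in> prim_part p" "\<And>k z. (zs k a, z) \<in> R \<Longrightarrow> z = zs k v" by blast
    define R' where "R' = {(b + zs k a, w + zs k v) | b w k. (b, w) \<in> R}"
    have "R' \<in> I"
      unfolding I_def
    proof (intro CollectI conjI)
      show "subgrp R'"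
        unfolding subgrp_def
      proof (intro conjI ballI)
        have "(0, 0) \<in> R" using R(1) by (simp add: subgrp_def zero_prod_def)
        then have "(0 + zs 0 a, 0 + zs 0 v) \<in> R'" unfolding R'_def by blast
        then show "0 \<in> R'" by (simp add: zero_prod_def)
        fix x y assume "x \<in> R'" "y \<in> R'"
        then obtain b w k b' w' k' where xy: "x = (b + zs k a, w + zs k v)" "(b, w) \<in> R"
          "y = (b' + zs k' a, w' + zs k' v)" "(b', w') \<in> R" unfolding R'_def by blast
        have "x - y = ((b - b') + zs (k - k') a, (w - w') + zs (k - k') v)"
          by (simp add: xy zm.scale_left_diff_distrib algebra_simps)
        then show "x - y \<in> R'" unfolding R'_def using Rdiff[OF xy(2,4)] by blast
      qed
      show "R0 \<subseteq> R'"
      proof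
        fix x assume "x \<in> R0"
        then obtain b w where "x = (b + zs 0 a, w + zs 0 v)" "(b, w) \<in> R" using R(2) by (cases x) auto
        then show "x \<in> R'" unfolding R'_def by blast
      qed
      show "R' \<subseteq> UNIV \<times> prim_part p"
      proof
        fix x assume "x \<in> R'"
        then obtain b w k where x: "x = (b + zs k a, w + zs k v)" "(b, w) \<in> R" unfolding R'_def by blast
        then have "w \<in> prim_part p" using R(3) by blast
        then have "w + zs k v \<in> prim_part p"
          using v(1) subgrp_prim_part by (intro subgrp_add subgrp_zs)
        then show "x \<in> UNIV \<times> prim_part p" using x by simp
      qed
      show "\<forall>z. (0, z) \<in> R' \<longrightarrow> z = 0"
      proof (intro allI impI)
        fix z assume "(0, z) \<in> R'"
        then obtain b w k where x: "b + zs k a = 0" "z = w + zs k v" "(b, w) \<in> R" unfolding R'_def by auto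
        have "zs k a = - b" using x(1) by (simp add: add_eq_0_iff)
        then have "(zs k a, - w) \<in> R" using Rzs[OF x(3), of "- 1"] by simp
        then have "- w = zs k v" by (rule v(2))
        then show "z = 0" using x(2) by (metis add.right_inverse minus_minus)
      qed
    qed
    moreover have "R \<subseteq> R'"
    proof
      fix x assume "x \<in> R"
      then obtain b w where "x = (b + zs 0 a, w + zs 0 v)" "(b, w) \<in> R" by (cases x) auto
      then show "x \<in> R'" unfolding R'_def by blast
    qed
    ultimately have "R' = R" by (rule max)
    moreover have "(0, 0) \<in> R" using R(1) by (simp add: subgrp_def zero_prod_def)
    then have "(0 + zs 1 a, 0 + zs 1 v) \<in> R'" unfolding R'_def by blast
    ultimately show False using nd by auto
  qed
  then obtain h where h: "\<And>a. (a, h a) \<in> R" by metis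
  show ?thesis
  proof (rule that[of h])
    show "Modules.additive h" by unfold_locales (rule single[OF h Radd[OF h h]])
    show "range h \<subseteq> prim_part p" using h R(3) by blast
    show "h a = z" if "(a, z) \<in> R0" for a z using single[OF h] R(2) that by blast
  qed
qed

text \<open>A relation among elements of \<open>X\<close> has coefficients divisible by
  \<open>p\<close>, which \<open>\<epsilon>\<close> sends to 0. So the pairs of combinations in
  \<open>R0\<close> form the graph of a partial homomorphism, and \<open>extend_to_prim_part\<close>
  applies.\<close>

lemma pindep_extend:
  fixes X :: "'b::ab_group_add set"
  assumes p: "prime p" and X: "pindep p X" and \<epsilon>: "\<And>x. zs (int p) (\<epsilon> x) = (0 :: circle)"
  shows "\<exists>h. Modules.additive h \<and> range h \<subseteq> prim_part p \<and> (\<forall>x\<in>X. h x = \<epsilon> x)"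
proof -
  interpret L: Modules.additive "lincomb (\<lambda>x::'b. x)" by (rule additive_lincomb)
  interpret E: Modules.additive "lincomb \<epsilon>" by (rule additive_lincomb)
  define R0 where "R0 = {(lincomb (\<lambda>x. x) c, lincomb \<epsilon> c) | c. Poly_Mapping.keys c \<subseteq> X}"
  have zsE: "zs (int p) (lincomb \<epsilon> c) = 0" for c
    unfolding lincomb_def zm.scale_sum_right
  proof (rule sum.neutral, intro ballI)
    fix k
    have "zs (int p) (zs (Poly_Mapping.lookup c k) (\<epsilon> k)) = zs (Poly_Mapping.lookup c k) (zs (int p) (\<epsilon> k))"
      by (simp only: zs_zs mult.commute)
    then show "zs (int p) (zs (Poly_Mapping.lookup c k) (\<epsilon> k)) = 0" by (simp add: \<epsilon>)
  qed
  have "subgrp R0"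
    unfolding subgrp_def
  proof (intro conjI ballI)
    have "(lincomb (\<lambda>x. x) 0, lincomb \<epsilon> 0) \<in> R0" unfolding R0_def by (rule CollectI, rule exI[of _ 0]) simp
    then show "0 \<in> R0" by (simp add: L.zero E.zero zero_prod_def)
    fix x y assume "x \<in> R0" "y \<in> R0"
    then obtain c d where cd: "x = (lincomb (\<lambda>x. x) c, lincomb \<epsilon> c)" "Poly_Mapping.keys c \<subseteq> X"
      "y = (lincomb (\<lambda>x. x) d, lincomb \<epsilon> d)" "Poly_Mapping.keys d \<subseteq> X" unfolding R0_def by blast
    have "Poly_Mapping.keys (c - d) \<subseteq> X" using cd(2,4) keys_diff[of c d] by blast
    then show "x - y \<in> R0" unfolding R0_def cd by (simp add: L.diff[symmetric] E.diff[symmetric]) blast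
  qed
  moreover have "R0 \<subseteq> UNIV \<times> prim_part p"
  proof -
    have "lincomb \<epsilon> c \<in> prim_part p" for c
      unfolding prim_part_def using zsE[of c] by (intro CollectI exI[of _ 1]) simp
    then show ?thesis by (auto simp: R0_def)
  qed
  moreover have "z = 0" if z0: "(0, z) \<in> R0" for z
  proof -
    obtain c where c': "(0, z) = (lincomb (\<lambda>x. x) c, lincomb \<epsilon> c)" and c: "Poly_Mapping.keys c \<subseteq> X"
      using z0 unfolding R0_def by blast
    note c = c conjunct1[OF c'[unfolded prod.inject], symmetric] conjunct2[OF c'[unfolded prod.inject]]
    have "zs (Poly_Mapping.lookup c k) (\<epsilon> k) = 0" for k
    proof -
      have "int p dvd Poly_Mapping.lookup c k" using X c by (simp add: pindep_def)
      then obtain j where "Poly_Mapping.lookup c k = j * int p" by (metis dvdE mult.commute)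
      then have "zs (Poly_Mapping.lookup c k) (\<epsilon> k) = zs j (zs (int p) (\<epsilon> k))" by (simp only: zs_zs)
      then show ?thesis by (simp add: \<epsilon>)
    qed
    then show ?thesis by (simp add: c(3) lincomb_def)
  qed
  ultimately obtain h where h: "Modules.additive h" "range h \<subseteq> prim_part p" "\<And>a z. (a, z) \<in> R0 \<Longrightarrow> h a = z"
    using extend_to_prim_part[OF p] by metis
  have "h x = \<epsilon> x" if "x \<in> X" for x
  proof (rule h(3))
    have "(lincomb (\<lambda>x. x) (Poly_Mapping.single x 1), lincomb \<epsilon> (Poly_Mapping.single x 1)) \<in> R0"
      unfolding R0_def using that by (intro CollectI exI[of _ "Poly_Mapping.single x 1"]) simp
    then show "(x, \<epsilon> x) \<in> R0" by (simp add: lincomb_superset[of "{x}"])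
  qed
  then show ?thesis using h(1,2) by blast
qed

section \<open>Minimality and separating groups of characters\<close>

lemma continuous_map_euclidean_add:
  fixes f g :: "'a \<Rightarrow> 'h::topological_ab_group_add"
  assumes "continuous_map X euclidean f" "continuous_map X euclidean g"
  shows "continuous_map X euclidean (\<lambda>x. f x + g x)"
proof -
  have "continuous_map X (prod_topology euclidean euclidean) (\<lambda>x. (f x, g x))"
    unfolding continuous_map_paired using assms by blast
  then have pair: "continuous_map X euclidean (\<lambda>x. (f x, g x))"
    by (simp only: prod_topology_euclidean)
  have "continuous_on UNIV (\<lambda>p::'h \<times> 'h. fst p + snd p)"
    by (intro continuous_on_add continuous_on_fst continuous_on_snd continuous_on_id)
  then have "continuous_map euclidean euclidean (\<lambda>p::'h \<times> 'h. fst p + snd p)" by simp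
  from continuous_map_compose[OF pair this] show ?thesis by (simp add: o_def)
qed

lemma continuous_map_euclidean_minus:
  fixes f :: "'a \<Rightarrow> 'h::topological_ab_group_add"
  assumes "continuous_map X euclidean f"
  shows "continuous_map X euclidean (\<lambda>x. - f x)"
proof -
  have "continuous_on UNIV (\<lambda>p::'h. - p)"
    unfolding continuous_on_def by (auto intro: tendsto_minus tendsto_ident_at)
  then have "continuous_map euclidean euclidean (\<lambda>p::'h. - p)" by simp
  from continuous_map_compose[OF assms this] show ?thesis by (simp add: o_def)
qed

lemma continuous_on_zs: "continuous_on UNIV (zs k :: 'h \<Rightarrow> 'h::topological_ab_group_add)"
proof (induction k rule: int_induct[where k = 0])
  case base
  have "zs 0 = (\<lambda>x :: 'h. 0)" by (rule ext) simp
  then show ?case by simp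
next
  case (step1 i)
  have "zs (i + 1) = (\<lambda>x :: 'h. zs i x + x)" by (rule ext) (rule zs_Suc)
  then show ?case using step1 by (simp add: continuous_on_add continuous_on_id)
next
  case (step2 i)
  have "zs (i - 1) = (\<lambda>x :: 'h. zs i x + - x)" by (rule ext) (simp add: zs_pred)
  then show ?case
    using continuous_map_euclidean_add[OF _ continuous_map_euclidean_minus, of euclidean "zs i" "\<lambda>x. x"] step2
    by simp
qed

lemma Hausdorff_pullback:
  assumes "Hausdorff_space Y" "inj_on f A" "f ` A \<subseteq> topspace Y"
  shows "Hausdorff_space (pullback_topology A f Y)"
  unfolding Hausdorff_space_def topspace_pullback_topology
proof (intro allI impI)
  fix x y assume xy: "x \<in> f -` topspace Y \<inter> A \<and> y \<in> f -` topspace Y \<inter> A \<and> x \<noteq> y"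
  then have "f x \<noteq> f y" using assms(2) by (auto simp: inj_on_def)
  then obtain U V where UV: "openin Y U" "openin Y V" "f x \<in> U" "f y \<in> V" "disjnt U V"
    using assms(1) xy unfolding Hausdorff_space_def by (metis IntD1 vimageD)
  show "\<exists>U V. openin (pullback_topology A f Y) U \<and> openin (pullback_topology A f Y) V \<and> x \<in> U \<and> y \<in> V \<and> disjnt U V"
    using UV xy
    by (intro exI[of _ "f -` U \<inter> A"] exI[of _ "f -` V \<inter> A"]) (auto simp: openin_pullback_topology disjnt_def)
qed

lemma top_grp_pullback:
  fixes E :: "'g::ab_group_add \<Rightarrow> 'h::topological_ab_group_add"
  assumes E: "Modules.additive E" "inj E" and H: "Hausdorff_space (euclidean :: 'h topology)"
  shows "top_grp (pullback_topology UNIV E euclidean)"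
proof -
  interpret E: Modules.additive E by fact
  let ?T = "pullback_topology UNIV E (euclidean :: 'h topology)"
  have cE: "continuous_map ?T euclidean E"
    using continuous_map_pullback[OF continuous_map_id, of UNIV E "euclidean :: 'h topology"] by simp
  have "continuous_map (prod_topology ?T ?T) euclidean (\<lambda>p. E (fst p) + E (snd p))"
    using continuous_map_compose[OF continuous_map_fst cE] continuous_map_compose[OF continuous_map_snd cE]
    by (intro continuous_map_euclidean_add) (simp_all add: o_def)
  then have "continuous_map (prod_topology ?T ?T) ?T (\<lambda>(x, y). x + y)"
    by (intro continuous_map_pullback') (simp_all add: o_def E.add split_beta)
  moreover have "continuous_map ?T ?T uminus"
    using continuous_map_euclidean_minus[OF cE]
    by (intro continuous_map_pullback') (simp_all add: o_def E.minus)
  ultimately show ?thesis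
    unfolding top_grp_def using Hausdorff_pullback[OF H, of E UNIV] E(2) by (simp add: topspace_pullback_topology)
qed

text \<open>Translation by an \<open>h\<close> with \<open>a h \<noteq> 0\<close> multiplies the
  integrand by a number different from 1 but preserves the mean. The complex factor
  \<open>\<theta>\<close> lets a real-valued mean treat real and imaginary parts together.\<close>

lemma imean_nontrivial_character:
  fixes a :: "'g::ab_group_add \<Rightarrow> circle"
  assumes a: "Modules.additive a" "a \<noteq> 0"
  shows "imean (\<lambda>x. Re (\<theta> * cval (a x))) = 0"
proof -
  interpret Modules.additive a by fact
  obtain h where h: "a h \<noteq> 0" using a(2) by (auto simp: fun_eq_iff)
  have bd: "bdd (\<lambda>x. Re (\<theta> * cval (a x)))" for \<theta>
    by (rule bddI[of _ "norm \<theta>"]) (use abs_Re_le_cmod in \<open>metis mult.right_neutral norm_cval norm_mult\<close>)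
  have inv: "imean (\<lambda>x. Re ((\<theta> * (cval (a h) - 1)) * cval (a x))) = 0" for \<theta>
  proof -
    have shift: "imean (\<lambda>x. Re (\<theta> * cval (a (x + h)))) = imean (\<lambda>x. Re (\<theta> * cval (a x)))"
      by (rule imean_shift[OF bd])
    have split: "Re (\<theta> * cval (a (x + h))) = Re ((\<theta> * (cval (a h) - 1)) * cval (a x)) + Re (\<theta> * cval (a x))" for x
      unfolding plus_complex.sel[symmetric] by (simp add: add cval_add algebra_simps)
    have "imean (\<lambda>x. Re (\<theta> * cval (a (x + h)))) =
        imean (\<lambda>x. Re ((\<theta> * (cval (a h) - 1)) * cval (a x))) + imean (\<lambda>x. Re (\<theta> * cval (a x)))"
      by (simp only: split imean_add[OF bd bd])
    then show ?thesis unfolding shift by linarith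
  qed
  have nz: "cval (a h) - 1 \<noteq> 0" using h by simp
  then have "\<theta> = \<theta> / (cval (a h) - 1) * (cval (a h) - 1)" by simp
  then show ?thesis using inv[of "\<theta> / (cval (a h) - 1)"] by simp
qed

context abelian_top_grp
begin

definition chars :: "('g \<Rightarrow> circle) set" where
  "chars = {a. Modules.additive a \<and> continuous_map T euclidean a}"

lemma subgrp_chars: "subgrp chars"
  unfolding subgrp_def chars_def
proof (intro conjI ballI CollectI)
  show "Modules.additive (0 :: 'g \<Rightarrow> circle)" by unfold_locales simp
  show "continuous_map T euclidean (0 :: 'g \<Rightarrow> circle)"
    unfolding zero_fun_def by simp
  fix a b :: "'g \<Rightarrow> circle"
  assume "a \<in> {a. Modules.additive a \<and> continuous_map T euclidean a}"
    "b \<in> {a. Modules.additive a \<and> continuous_map T euclidean a}"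
  then have ab: "Modules.additive a" "continuous_map T euclidean a" "Modules.additive b" "continuous_map T euclidean b"
    by auto
  show "Modules.additive (a - b)"
    using ab(1,3) by (auto simp: Modules.additive_def)
  have "continuous_map T euclidean (\<lambda>x. a x + (- b x))"
    by (intro continuous_map_euclidean_add continuous_map_euclidean_minus ab)
  then show "continuous_map T euclidean (a - b)" by (simp add: fun_diff_def)
qed

text \<open>A continuous character outside the group \<open>A'\<close> is orthogonal to all trigonometric polynomials with
  frequencies in \<open>A'\<close>; large powers of \<open>v\<close> concentrate near the identity, where the character is close to 1.\<close>

lemma character_in_subgroup:
  assumes pc: precompact
    and A': "subgrp A'" "A' \<subseteq> chars" and B: "finite B" "B \<subseteq> A'" and e: "e > 0"
    and a: "Modules.additive a" and near: "\<And>x. (\<And>b. b \<in> B \<Longrightarrow> dist (b x) 0 < e) \<Longrightarrow> 1/2 \<le> Re (cval (a x))"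
  shows "a \<in> A'"
proof (rule ccontr)
  assume aA: "a \<notin> A'"
  have Re1: "\<bar>Re (cval z)\<bar> \<le> 1" for z using abs_Re_le_cmod[of "cval z"] by simp
  \<comment> \<open>A factor between 0 and 1 that equals 1 exactly where \<open>b\<close> is
    trivial. Powers of the product \<open>v\<close> serve as an approximate identity with
    frequencies generated by \<open>B\<close>.\<close>
  define u where "u b x = (1 + Re (cval (b x))) / 2" for b :: "'g \<Rightarrow> circle" and x
  have u01: "0 \<le> u b x" "u b x \<le> 1" for b x using Re1[of "b x"] by (auto simp: u_def abs_le_iff)
  define v where "v x = (\<Prod>b\<in>B. u b x)" for x
  have v01: "0 \<le> v x" "v x \<le> 1" for x
    unfolding v_def using u01 by (auto intro: prod_nonneg prod_le_1)
  \<comment> \<open>Orthogonality to every additive map outside \<open>A'\<close>, not only to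
    \<open>a\<close>: multiplication by \<open>u b\<close> replaces \<open>a\<close> by a
    combination of \<open>a\<close>, \<open>a + b\<close> and \<open>a - b\<close>.\<close>
  define orth where "orth w \<longleftrightarrow> bdd w \<and> (\<forall>a \<theta>. Modules.additive a \<longrightarrow> a \<notin> A' \<longrightarrow> imean (\<lambda>x. w x * Re (\<theta> * cval (a x))) = 0)"
    for w :: "'g \<Rightarrow> real"
  have bdRe: "bdd (\<lambda>x. Re (\<theta> * cval (a x)))" for \<theta> and a :: "'g \<Rightarrow> circle"
    by (rule bddI[of _ "norm \<theta>"]) (use abs_Re_le_cmod in \<open>metis mult.right_neutral norm_cval norm_mult\<close>)
  have orth1: "orth (\<lambda>_. 1)"
    unfolding orth_def using imean_nontrivial_character A'(1) by (auto simp: bdd_const subgrp_def)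
  have orthu: "orth (\<lambda>x. w x * u b x)" if w: "orth w" and b: "b \<in> B" for w b
    unfolding orth_def
  proof (intro conjI allI impI)
    have bw: "bdd w" using w by (simp add: orth_def)
    have bu: "bdd (u b)" by (rule bddI[of _ 1]) (use u01 in auto)
    show "bdd (\<lambda>x. w x * u b x)" by (rule bdd_mult[OF bw bu])
    fix a :: "'g \<Rightarrow> circle" and \<theta> assume a: "Modules.additive a" "a \<notin> A'"
    have bA: "b \<in> A'" using b B by blast
    have badd: "Modules.additive b" using bA A'(2) by (auto simp: chars_def)
    have "a + b \<notin> A'"
      using a(2) bA A'(1) by (metis add_diff_cancel_right' subgrp_def)
    moreover have "a - b \<notin> A'"
      using a(2) subgrp_add[OF A'(1) _ bA, of "a - b"] by auto
    moreover have "Modules.additive (a + b)" "Modules.additive (a - b)"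
      using a(1) badd by (auto simp: Modules.additive_def)
    ultimately have z: "imean (\<lambda>x. w x * Re (\<theta> * cval (a x))) = 0"
      "imean (\<lambda>x. w x * Re (\<theta> * cval ((a + b) x))) = 0" "imean (\<lambda>x. w x * Re (\<theta> * cval ((a - b) x))) = 0" for \<theta>
      using w a unfolding orth_def by blast+
    have split: "w x * u b x * Re (\<theta> * cval (a x)) = w x * Re (\<theta> / 2 * cval (a x)) +
        (w x * Re (\<theta> / 4 * cval ((a + b) x)) + w x * Re (\<theta> / 4 * cval ((a - b) x)))" for x
    proof -
      have "cval (b x) + cnj (cval (b x)) = of_real (2 * Re (cval (b x)))" by (rule complex_add_cnj)
      moreover have "\<theta> / 4 * cval ((a + b) x) + \<theta> / 4 * cval ((a - b) x)
          = \<theta> / 4 * cval (a x) * (cval (b x) + cnj (cval (b x)))"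
        by (simp add: cval_add cval_diff algebra_simps)
      ultimately have "\<theta> / 4 * cval ((a + b) x) + \<theta> / 4 * cval ((a - b) x) = of_real (Re (cval (b x)) / 2) * (\<theta> * cval (a x))"
        by simp
      then have "Re (\<theta> / 4 * cval ((a + b) x)) + Re (\<theta> / 4 * cval ((a - b) x)) = Re (cval (b x)) / 2 * Re (\<theta> * cval (a x))"
        by (metis plus_complex.sel(1) Re_complex_of_real Im_complex_of_real times_complex.sel(1) diff_zero mult_zero_left)
      moreover have "Re (\<theta> / 2 * cval (a x)) = Re (\<theta> * cval (a x)) / 2" by (simp add: diff_divide_distrib)
      moreover have "w * ((1 + c) / 2) * p = w * P + (w * q + w * r)"
        if "q + r = c / 2 * p" "P = p / 2" for w c p P q r :: real
      proof -
        have "w * P + (w * q + w * r) = w * (P + (q + r))" by (simp add: algebra_simps)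
        then show ?thesis using that by (simp add: algebra_simps)
      qed
      ultimately show ?thesis unfolding u_def by blast
    qed
    have "imean (\<lambda>x. w x * u b x * Re (\<theta> * cval (a x))) = imean (\<lambda>x. w x * Re (\<theta> / 2 * cval (a x)) +
        (w x * Re (\<theta> / 4 * cval ((a + b) x)) + w x * Re (\<theta> / 4 * cval ((a - b) x))))"
      by (simp only: split)
    also have "\<dots> = imean (\<lambda>x. w x * Re (\<theta> / 2 * cval (a x))) +
        (imean (\<lambda>x. w x * Re (\<theta> / 4 * cval ((a + b) x))) + imean (\<lambda>x. w x * Re (\<theta> / 4 * cval ((a - b) x))))"
      by (simp only: imean_add bdd_add bdd_mult bw bdRe)
    finally show "imean (\<lambda>x. w x * u b x * Re (\<theta> * cval (a x))) = 0" by (simp only: z)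
  qed
  have orthv: "orth (\<lambda>x. w x * (\<Prod>b\<in>C. u b x))" if "orth w" "C \<subseteq> B" for w C
    using finite_subset[OF that(2) B(1)] that
  proof (induction C arbitrary: w rule: finite_induct)
    case (insert b C)
    have "orth (\<lambda>x. (w x * u b x) * (\<Prod>b\<in>C. u b x))"
      using insert by (intro insert.IH orthu) auto
    then show ?case using insert by (simp add: mult.assoc)
  qed simp
  have orthvN: "orth (\<lambda>x. v x ^ N)" for N
  proof (induction N)
    case 0
    then show ?case using orth1 by simp
  next
    case (Suc N)
    then show ?case using orthv[OF Suc, of B] by (simp add: v_def mult.commute)
  qed
  \<comment> \<open>Where some \<open>b\<close> is far from trivial, \<open>v\<close> is at most
    \<open>r2\<close>; near 0 it is at least some \<open>r1 > r2\<close>. Precompactness bounds the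
    mean of \<open>v ^ N\<close> below by \<open>r1 ^ N / m\<close>, orthogonality to
    \<open>a\<close> bounds it above by \<open>4 * r2 ^ N\<close>, and large \<open>N\<close> is a
    contradiction. The maximum with 0 takes care of large \<open>e\<close>.\<close>
  define r2 where "r2 = max 0 (1 - e\<^sup>2 / 4)"
  have r2: "0 \<le> r2" "r2 < 1" using e by (auto simp: r2_def)
  have far: "v x \<le> r2" if fx: "\<not> (\<forall>b\<in>B. dist (b x) 0 < e)" for x
  proof -
    obtain b where b: "b \<in> B" "e \<le> dist (b x) 0" using fx by (meson not_le)
    have "e\<^sup>2 \<le> (norm (cval (b x) - 1))\<^sup>2" using b(2) e by (intro power_mono) (auto simp: dist_cval)
    also have "\<dots> = (Re (cval (b x)) - 1)\<^sup>2 + (Im (cval (b x)))\<^sup>2" by (simp add: cmod_power2)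
    also have "\<dots> = ((Re (cval (b x)))\<^sup>2 + (Im (cval (b x)))\<^sup>2) + 1 - 2 * Re (cval (b x))"
      by (simp add: power2_diff)
    also have "(Re (cval (b x)))\<^sup>2 + (Im (cval (b x)))\<^sup>2 = 1"
      using norm_cval[of "b x"] by (metis cmod_power2 one_power2)
    finally have "u b x \<le> 1 - e\<^sup>2 / 4" by (simp add: u_def)
    moreover have "v x \<le> u b x"
    proof -
      have "v x = u b x * (\<Prod>b\<in>B - {b}. u b x)" unfolding v_def using B(1) b(1) by (rule prod.remove)
      also have "\<dots> \<le> u b x * 1" using u01 by (intro mult_left_mono prod_le_1) auto
      finally show ?thesis by simp
    qed
    ultimately show ?thesis by (simp add: r2_def)
  qed
  define r1 where "r1 = (1 + r2) / 2"
  have r1: "r2 < r1" "0 < r1" "r1 < 1" using r2 by (auto simp: r1_def)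
  have contv: "continuous_map T euclideanreal v"
  proof -
    have "continuous_map T euclideanreal (u b)" if "b \<in> B" for b
    proof -
      have cb: "continuous_map T euclidean b" using that B A' by (auto simp: chars_def)
      have "continuous_on UNIV (\<lambda>z. (1 + Re (cval z)) / 2)" by (intro continuous_intros continuous_on_cval) auto
      then have "continuous_map euclidean euclideanreal (\<lambda>z. (1 + Re (cval z)) / 2)" by simp
      from continuous_map_compose[OF cb this] show ?thesis by (simp add: u_def[abs_def] o_def)
    qed
    then show ?thesis unfolding v_def[abs_def] using B(1) by (intro continuous_map_prod) auto
  qed
  have v0: "v 0 = 1"
  proof -
    have "(1 + Re (cval (b 0))) / 2 = 1" if "b \<in> B" for b
    proof -
      have "b 0 = 0" using that B A' Modules.additive.zero[of b] by (auto simp: chars_def)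
      then show ?thesis by simp
    qed
    then show ?thesis unfolding v_def u_def by (intro prod.neutral ballI)
  qed
  obtain V where V: "nbhd0 V" "\<And>x. x \<in> V \<Longrightarrow> r1 \<le> v x"
  proof -
    obtain V where "nbhd0 V" "\<forall>x\<in>V. dist (v (0 + x)) (v 0) < 1 - r1"
      using local_if_continuous[OF contv, of "1 - r1" 0] r1 by auto
    then show ?thesis using that[of V] v0 by (force simp: dist_real_def abs_less_iff)
  qed
  obtain A where A: "finite A" "\<And>x. \<exists>a\<in>A. x - a \<in> V" using precompactD[OF pc V(1)] by blast
  define m where "m = real (card A)"
  have bdv: "bdd (\<lambda>x. v x ^ N)" for N using orthvN[of N] by (simp add: orth_def)
  have lower: "r1 ^ N \<le> m * imean (\<lambda>x. v x ^ N)" for N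
  proof -
    have "imean (\<lambda>_::'g. r1 ^ N) \<le> imean (\<lambda>y. \<Sum>a\<in>A. v (y + (- a)) ^ N)"
    proof (rule imean_mono)
      show "bdd (\<lambda>_::'g. r1 ^ N)" by (rule bdd_const)
      show "bdd (\<lambda>y. \<Sum>a\<in>A. v (y + (- a)) ^ N)" by (intro bdd_sum bdd_shift[OF bdv])
      fix y
      obtain a where a: "a \<in> A" "y - a \<in> V" using A(2) by blast
      have "r1 ^ N \<le> v (y + (- a)) ^ N" using V(2)[OF a(2)] r1 by (intro power_mono) auto
      also have "\<dots> \<le> (\<Sum>a\<in>A. v (y + (- a)) ^ N)"
        by (rule member_le_sum[OF a(1)]) (auto simp: A(1) v01)
      finally show "r1 ^ N \<le> (\<Sum>a\<in>A. v (y + (- a)) ^ N)" .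
    qed
    also have "\<dots> = (\<Sum>a\<in>A. imean (\<lambda>y. v (y + (- a)) ^ N))" by (intro imean_sum bdd_shift[OF bdv])
    also have "\<dots> = (\<Sum>a\<in>A. imean (\<lambda>y. v y ^ N))" by (simp only: imean_shift[OF bdv])
    finally show ?thesis by (simp add: imean_const m_def)
  qed
  have upper: "imean (\<lambda>x. v x ^ N) \<le> 4 * r2 ^ N" for N
  proof -
    have z: "imean (\<lambda>x. v x ^ N * Re (1 * cval (a x))) = 0"
      using orthvN[of N] a aA unfolding orth_def by blast
    have "imean (\<lambda>x. v x ^ N - v x ^ N * Re (1 * cval (a x))) \<le> imean (\<lambda>x. 1/2 * v x ^ N + 2 * r2 ^ N)"
    proof (rule imean_mono)
      show "bdd (\<lambda>x. v x ^ N - v x ^ N * Re (1 * cval (a x)))" by (intro bdd_diff bdd_mult bdv bdRe)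
      show "bdd (\<lambda>x. 1/2 * v x ^ N + 2 * r2 ^ N)" by (intro bdd_add bdd_mult bdv bdd_const)
      fix x
      have vN: "0 \<le> v x ^ N" using v01 by simp
      show "v x ^ N - v x ^ N * Re (1 * cval (a x)) \<le> 1/2 * v x ^ N + 2 * r2 ^ N"
      proof (cases "\<forall>b\<in>B. dist (b x) 0 < e")
        case True
        then have "1/2 \<le> Re (cval (a x))" using near by blast
        then have "v x ^ N * (1/2) \<le> v x ^ N * Re (cval (a x))" using vN by (rule mult_left_mono)
        moreover have "0 \<le> r2 ^ N" using r2 by simp
        ultimately show ?thesis by simp
      next
        case False
        then have "v x ^ N \<le> r2 ^ N" using far v01 by (intro power_mono) auto
        moreover have "v x ^ N * (- 1) \<le> v x ^ N * Re (cval (a x))"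
          using Re1[of "a x"] vN by (intro mult_left_mono) (auto simp: abs_le_iff)
        ultimately show ?thesis using vN by simp
      qed
    qed
    also have "imean (\<lambda>x. v x ^ N - v x ^ N * Re (1 * cval (a x))) = imean (\<lambda>x. v x ^ N) - 0"
      unfolding z[symmetric] by (intro imean_diff bdd_mult bdv bdRe)
    also have "imean (\<lambda>x. 1/2 * v x ^ N + 2 * r2 ^ N) = 1/2 * imean (\<lambda>x. v x ^ N) + 2 * r2 ^ N"
      by (simp only: imean_add bdd_mult bdv bdd_const imean_scale imean_const)
    finally show ?thesis by simp
  qed
  have m0: "0 \<le> m" by (simp add: m_def)
  have bound: "r1 ^ N \<le> 4 * m * r2 ^ N" for N
    using lower[of N] mult_left_mono[OF upper[of N] m0] by (simp add: mult_ac)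
  have "4 * m > 0" using bound[of 0] by simp
  then obtain N where "(r2 / r1) ^ N < 1 / (4 * m)"
    using real_arch_pow_inv[of "1 / (4 * m)" "r2 / r1"] r1 by auto
  then have "4 * m * r2 ^ N < r1 ^ N"
    using r1 \<open>4 * m > 0\<close> by (simp add: power_divide field_simps)
  then show False using bound[of N] by linarith
qed

definition minimal :: bool where
  "minimal \<longleftrightarrow> (\<forall>T'. top_grp T' \<longrightarrow> (\<forall>U. openin T' U \<longrightarrow> openin T U) \<longrightarrow> T' = T)"

text \<open>The characters in \<open>A'\<close> induce a coarser Hausdorff group topology, which by
  minimality is \<open>T\<close>. So a continuous character is close to 1 on a neighbourhood cut out
  by finitely many members of \<open>A'\<close>, and \<open>character_in_subgroup\<close>
  applies.\<close>

lemma separating_subgroup_eq_chars: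
  assumes min: minimal and pc: precompact
    and A': "subgrp A'" "A' \<subseteq> chars" and sep: "\<And>g. g \<noteq> 0 \<Longrightarrow> \<exists>a\<in>A'. a g \<noteq> 0"
  shows "A' = chars"
proof
  show "A' \<subseteq> chars" by fact
  \<comment> \<open>Coordinates outside \<open>A'\<close> are set to 0 so that the product can be
    taken over the whole function type.\<close>
  define E where "E x a = (if a \<in> A' then a x else 0)" for x :: 'g and a :: "'g \<Rightarrow> circle"
  have addE: "Modules.additive E"
  proof
    fix x y
    have "a (x + y) = a x + a y" if "a \<in> A'" for a
      using that A'(2) by (auto simp: chars_def Modules.additive_def)
    then show "E (x + y) = E x + E y" by (auto simp: E_def fun_eq_iff)
  qed
  then interpret E: Modules.additive E .
  have "inj E"
  proof (rule injI, rule ccontr)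
    fix x y assume "E x = E y" "x \<noteq> y"
    then obtain a where a: "a \<in> A'" "a (x - y) \<noteq> 0" using sep[of "x - y"] by auto
    have "E (x - y) = 0" using \<open>E x = E y\<close> by (simp add: E.diff)
    then have "E (x - y) a = 0" by simp
    then show False using a by (simp add: E_def)
  qed
  let ?T = "pullback_topology UNIV E euclidean"
  have "top_grp ?T"
    by (rule top_grp_pullback[OF addE \<open>inj E\<close> Hausdorff_fun])
  moreover have contE: "continuous_map T euclidean E"
    unfolding euclidean_product_topology[symmetric] continuous_map_componentwise_UNIV
  proof
    fix a
    show "continuous_map T euclidean (\<lambda>x. E x a)"
      using A'(2) by (cases "a \<in> A'") (auto simp: E_def chars_def)
  qed
  have "openin T U" if "openin ?T U" for U
    using that openin_continuous_map_preimage[OF contE] by (auto simp: openin_pullback_topology top vimage_def)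
  ultimately have TT: "?T = T" using min unfolding minimal_def by blast
  show "chars \<subseteq> A'"
  proof
    fix a assume a: "a \<in> chars"
    have "continuous_map T euclidean a" "Modules.additive a" using a by (auto simp: chars_def)
    then have "openin T {x \<in> topspace T. a x \<in> ball 0 (1/2)}"
      by (intro openin_continuous_map_preimage) auto
    then have "openin ?T {x. a x \<in> ball 0 (1/2)}" unfolding TT by (simp add: top)
    then obtain W where W: "open W" "{x. a x \<in> ball 0 (1/2)} = E -` W" by (auto simp: openin_pullback_topology)
    have "a 0 = 0" using \<open>Modules.additive a\<close> by (rule Modules.additive.zero)
    then have "0 \<in> E -` W" unfolding W(2)[symmetric] by simp
    then have "0 \<in> W" by (simp add: E.zero)
    then obtain X where X: "0 \<in> Pi\<^sub>E UNIV X" "\<And>i. open (X i)" "finite {i. X i \<noteq> UNIV}" "Pi\<^sub>E UNIV X \<subseteq> W"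
      using product_topology_open_contains_basis[of "\<lambda>_. euclidean" UNIV W 0] W(1)
      by (auto simp: euclidean_product_topology)
    define B where "B = {i. X i \<noteq> UNIV} \<inter> A'"
    have B: "finite B" "B \<subseteq> A'" using X(3) by (auto simp: B_def)
    have "\<forall>i. \<exists>e>0. ball 0 e \<subseteq> X i"
    proof
      fix i
      have "0 \<in> X i" using X(1) by (auto simp: PiE_def)
      then show "\<exists>e>0. ball 0 e \<subseteq> X i" using X(2) open_contains_ball by blast
    qed
    then obtain \<epsilon> where \<epsilon>: "\<And>i. \<epsilon> i > 0" "\<And>i. ball 0 (\<epsilon> i) \<subseteq> X i" by metis
    define e where "e = Min (insert 1 (\<epsilon> ` B))"
    have e: "e > 0" using B(1) \<epsilon> by (simp add: e_def)
    have "1/2 \<le> Re (cval (a x))" if x: "\<And>b. b \<in> B \<Longrightarrow> dist (b x) 0 < e" for x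
    proof -
      have "E x i \<in> X i" for i
      proof (cases "i \<in> B")
        case True
        then have "e \<le> \<epsilon> i" using B(1) by (simp add: e_def)
        then have "i x \<in> ball 0 (\<epsilon> i)" using x[OF True] by (simp add: dist_commute)
        then have "i x \<in> X i" using \<epsilon>(2) by (rule rev_subsetD)
        then show ?thesis using True B(2) by (auto simp: E_def)
      next
        case False
        then consider "X i = UNIV" | "i \<notin> A'" by (auto simp: B_def)
        then show ?thesis
        proof cases
          case 2
          then show ?thesis using \<epsilon>[of i] by (force simp: E_def)
        qed simp
      qed
      then have "E x \<in> W" using X(4) by (auto simp: PiE_def)
      then have "x \<in> E -` W" by simp
      then have "dist (a x) 0 < 1/2" unfolding W(2)[symmetric] by (simp add: dist_commute)
      then have "norm (cval (a x) - 1) < 1/2" by (simp add: dist_cval)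
      then show ?thesis using abs_Re_le_cmod[of "cval (a x) - 1"] by (simp add: abs_le_iff)
    qed
    then show "a \<in> A'"
      using character_in_subgroup[OF pc A' B e \<open>Modules.additive a\<close>] by blast
  qed
qed

end

section \<open>The character group of a minimal torsion-free group\<close>

context abelian_top_grp
begin

text \<open>The multiples by \<open>n\<close> of the characters still separate points, since
  \<open>zs n g \<noteq> 0\<close> for \<open>g \<noteq> 0\<close>; by minimality they are all
  characters.\<close>

lemma chars_divisible:
  assumes min: minimal and pc: precompact
    and tf: "torsion_free (UNIV :: 'g set)" and n: "n \<noteq> 0" and a: "a \<in> chars"
  shows "\<exists>b\<in>chars. zs n b = a"
proof -
  have eq: "zs n ` chars = chars"
  proof (rule separating_subgroup_eq_chars[OF min pc])
    show "subgrp (zs n ` chars)"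
      unfolding subgrp_def
    proof (intro conjI ballI)
      show "0 \<in> zs n ` chars" using subgrp_chars by (auto simp: subgrp_def intro!: image_eqI[of _ _ 0])
      fix x y assume "x \<in> zs n ` chars" "y \<in> zs n ` chars"
      then obtain b c where "x = zs n b" "y = zs n c" "b \<in> chars" "c \<in> chars" by blast
      then show "x - y \<in> zs n ` chars"
        using subgrp_chars by (auto simp: subgrp_def zm.scale_right_diff_distrib[symmetric])
    qed
    show "zs n ` chars \<subseteq> chars" using subgrp_zs[OF subgrp_chars] by blast
    fix g :: 'g assume "g \<noteq> 0"
    then have "zs n g \<noteq> 0" using tf n by (auto simp: torsion_free_def)
    from continuous_characters_separate[OF pc this] obtain b :: "'g \<Rightarrow> circle" where
      "Modules.additive b \<and> continuous_map T euclidean b \<and> b (zs n g) \<noteq> 0" ..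
    then have b: "Modules.additive b" "continuous_map T euclidean b" "b (zs n g) \<noteq> 0" by simp_all
    then have "(zs n b) g \<noteq> 0" using zs_additive[OF b(1)] by (simp add: zs_fun)
    then show "\<exists>a\<in>zs n ` chars. a g \<noteq> 0" using b by (auto simp: chars_def)
  qed
  from a have "a \<in> zs n ` chars" unfolding eq .
  then show ?thesis by force
qed

text \<open>The kernel of \<open>x\<close> is a proper subgroup of the
  characters, so by minimality it does not separate points.\<close>

lemma quasicyclic_hom_code:
  assumes min: minimal and pc: precompact
    and x: "Modules.additive x" and nz: "\<exists>a\<in>chars. x a \<noteq> (0 :: circle)"
  shows "\<exists>g \<phi>. g \<noteq> 0 \<and> (\<forall>a\<in>chars. a g = (\<phi> (x a) :: circle))"
proof -
  interpret x: Modules.additive x by fact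
  define A' where "A' = {a \<in> chars. x a = 0}"
  have "subgrp A'"
    using subgrp_chars by (auto simp: A'_def subgrp_def x.zero x.diff)
  moreover have "A' \<subseteq> chars" "A' \<noteq> chars" using nz by (auto simp: A'_def)
  ultimately obtain g where g: "g \<noteq> 0" "\<And>a. a \<in> A' \<Longrightarrow> a g = 0"
    using separating_subgroup_eq_chars[OF min pc, of A'] by blast
  have "a g = b g" if "a \<in> chars" "b \<in> chars" "x a = x b" for a b
  proof -
    have "a - b \<in> A'" using that subgrp_chars by (auto simp: A'_def subgrp_def x.diff)
    then have "(a - b) g = 0" by (rule g(2))
    then show ?thesis by simp
  qed
  then have "\<forall>a\<in>chars. a g = (SOME z. \<exists>b\<in>chars. x b = x a \<and> z = b g)"
    by (smt (verit, best) someI_ex)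
  then show ?thesis using g(1) by (intro exI[of _ g] exI[of _ "\<lambda>y. SOME z. \<exists>b\<in>chars. x b = y \<and> z = b g"]) simp
qed

text \<open>Put \<open>w = x - y\<close>. Because \<open>x\<close> is onto the quasicyclic group,
  \<open>\<phi>\<close> vanishes on the values of \<open>w\<close>. A non-zero \<open>w\<close>
  would be onto as well, by divisibility of the character group, so \<open>\<phi>\<close> would
  vanish throughout and every character would be trivial at \<open>g\<close>.\<close>

lemma quasicyclic_hom_unique:
  assumes min: minimal and pc: precompact
    and tf: "torsion_free (UNIV :: 'g set)" and p: "prime p" and g: "g \<noteq> 0"
    and x: "Modules.additive x" "x ` chars \<subseteq> prim_part p" "\<exists>a\<in>chars. x a \<noteq> 0" "\<forall>a\<in>chars. a g = (\<phi> (x a) :: circle)"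
    and y: "Modules.additive y" "y ` chars \<subseteq> prim_part p" "\<exists>a\<in>chars. y a \<noteq> 0" "\<forall>a\<in>chars. a g = \<phi> (y a)"
    and a: "a \<in> chars"
  shows "x a = y a"
proof -
  have p0: "int p \<noteq> 0" using p by (metis not_prime_0 of_nat_eq_0_iff)
  have surj: "prim_part p \<subseteq> h ` chars"
    if h: "Modules.additive h" "h ` chars \<subseteq> prim_part p" "\<exists>a\<in>chars. h a \<noteq> 0" for h
  proof (rule prim_part_subset[OF p])
    interpret h: Modules.additive h by fact
    show "subgrp (h ` chars)"
      unfolding subgrp_def
    proof (intro conjI ballI)
      show "0 \<in> h ` chars" using subgrp_chars h.zero by (auto simp: subgrp_def intro!: image_eqI[of _ _ 0])
      fix u v assume "u \<in> h ` chars" "v \<in> h ` chars"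
      then obtain b c where "u = h b" "v = h c" "b \<in> chars" "c \<in> chars" by blast
      then show "u - v \<in> h ` chars" using subgrp_chars by (auto simp: subgrp_def h.diff[symmetric])
    qed
    show "h ` chars \<subseteq> prim_part p" by fact
    show "h ` chars \<noteq> {0}" using h(3) by blast
    fix z assume "z \<in> h ` chars"
    then obtain a where a: "a \<in> chars" "z = h a" by blast
    then obtain b where "b \<in> chars" "zs (int p) b = a" using chars_divisible[OF min pc tf p0] by blast
    then show "\<exists>u\<in>h ` chars. zs (int p) u = z" using a zs_additive[OF h(1), of "int p" b] by auto
  qed
  define w where "w = x - y"
  have w: "Modules.additive w" using x(1) y(1) by (auto simp: w_def Modules.additive_def)
  have wp: "w ` chars \<subseteq> prim_part p"
    using x(2) y(2) subgrp_prim_part[of p] by (auto simp: w_def subgrp_def)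
  have \<phi>w: "\<phi> (w b) = 0" if b: "b \<in> chars" for b
  proof -
    \<comment> \<open>Chosen so that \<open>x (b - c) = x b - y b = w b\<close>.\<close>
    obtain c where c: "c \<in> chars" "y b = x c" using surj[OF x(1-3)] y(2) b by blast
    have "b - c \<in> chars" using b c subgrp_chars by (auto simp: subgrp_def)
    then have "(b - c) g = \<phi> (x (b - c))" using x(4) by blast
    moreover have "x (b - c) = w b" using c by (simp add: w_def Modules.additive.diff[OF x(1)])
    moreover have "b g = c g" using bspec[OF y(4) b] bspec[OF x(4) c(1)] c(2) by simp
    ultimately show ?thesis by simp
  qed
  have "\<not> (\<exists>a\<in>chars. w a \<noteq> 0)"
  proof
    assume "\<exists>a\<in>chars. w a \<noteq> 0"
    then have "prim_part p \<subseteq> w ` chars" by (rule surj[OF w wp])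
    then have "b g = 0" if "b \<in> chars" for b using x(2,4) \<phi>w that by (metis image_iff image_subset_iff subset_iff)
    moreover from continuous_characters_separate[OF pc g] obtain b :: "'g \<Rightarrow> circle" where
      "Modules.additive b \<and> continuous_map T euclidean b \<and> b g \<noteq> 0" ..
    ultimately show False by (auto simp: chars_def)
  qed
  then show ?thesis using a by (auto simp: w_def)
qed

text \<open>Countably many characters would map the group injectively onto a compact subgroup of the
  metrizable group \<open>nat \<Rightarrow> circle\<close>. Its multiples by \<open>3 ^ n\<close>
  shrink to 0, and \<open>3 ^ n - 1\<close> is even, so \<open>- x\<close> is a limit of doubles.
  The doubles form a compact set, so every element is a double, against \<open>no2\<close>.\<close>

lemma uncountable_chars:
  assumes psc: "pseudocompact_space T" and pc: precompact
    and no3: "\<And>x::'g. (\<And>n. \<exists>y. x = zs (3 ^ n) y) \<Longrightarrow> x = 0" and no2: "\<exists>x::'g. \<forall>y. x \<noteq> zs 2 y"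
  shows "uncountable chars"
proof
  assume count: "countable chars"
  have ne: "chars \<noteq> {}" using subgrp_chars by (auto simp: subgrp_def)
  define e where "e x n = from_nat_into chars n x" for x :: 'g and n :: nat
  have in_chars: "from_nat_into chars n \<in> chars" for n by (rule from_nat_into[OF ne])
  have add: "Modules.additive e"
    using in_chars by (auto simp: Modules.additive_def e_def fun_eq_iff chars_def)
  then interpret e: Modules.additive e .
  have inj: "x = 0" if "e x = 0" for x
  proof (rule ccontr)
    assume "x \<noteq> 0"
    from continuous_characters_separate[OF pc this] obtain a :: "'g \<Rightarrow> circle" where
      a: "Modules.additive a \<and> continuous_map T euclidean a \<and> a x \<noteq> 0" ..
    then have "a \<in> chars" by (simp add: chars_def)
    then obtain n where "from_nat_into chars n = a" using from_nat_into_surj[OF count] by blast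
    then have "e x n \<noteq> 0" using a by (simp add: e_def)
    then show False using that by simp
  qed
  have inj': "x = y" if "e x = e y" for x y using inj[of "x - y"] that by (simp add: e.diff)
  have cont: "continuous_map T euclidean e"
    unfolding euclidean_product_topology[symmetric] continuous_map_componentwise_UNIV
  proof
    fix n
    show "continuous_map T euclidean (\<lambda>x. e x n)" using in_chars[of n] by (simp add: e_def chars_def)
  qed
  \<comment> \<open>At a missing limit point \<open>q\<close> the continuous function
    \<open>1 / dist (e x) q\<close> would be unbounded, against pseudocompactness.\<close>
  have "closed (range e)"
  proof (rule ccontr)
    assume "\<not> closed (range e)"
    then obtain q where q: "q \<in> closure (range e)" "q \<notin> range e"
      by (metis closure_subset closure_subset_eq subsetI)
    have pos: "0 < dist (e x) q" for x using q(2) by auto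
    have "continuous_on (UNIV - {q}) (\<lambda>z. 1 / dist z q)" by (intro continuous_intros) auto
    then have c2: "continuous_map (top_of_set (UNIV - {q})) euclideanreal (\<lambda>z. 1 / dist z q)" by simp
    have c1: "continuous_map T (top_of_set (UNIV - {q})) e"
      using cont q(2) by (auto simp: continuous_map_in_subtopology)
    from continuous_map_compose[OF c1 c2] have "continuous_map T euclideanreal (\<lambda>x. 1 / dist (e x) q)"
      by (simp add: o_def)
    then have "bounded (range (\<lambda>x. 1 / dist (e x) q))" using psc top unfolding pseudocompact_space_def by auto
    then obtain C where C: "\<And>x. \<bar>1 / dist (e x) q\<bar> \<le> C" by (auto simp: bounded_iff)
    define D where "D = \<bar>C\<bar> + 1"
    have "D > 0" by (simp add: D_def)
    then obtain x where x: "dist (e x) q < 1 / D"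
      using q(1) unfolding closure_approachable by (metis rangeE zero_less_divide_1_iff)
    then have "D < 1 / dist (e x) q" using pos[of x] \<open>D > 0\<close> by (simp add: field_simps)
    moreover have "1 / dist (e x) q \<le> C" using C[of x] by (simp add: abs_le_iff)
    ultimately show False by (simp add: D_def)
  qed
  moreover have compU: "compact (UNIV :: (nat \<Rightarrow> circle) set)"
    using compact_PiE_UNIV[of "\<lambda>_::nat. UNIV :: circle set"] compact_UNIV_circle by (simp add: Pi_def)
  ultimately have comp: "compact (range e)" using compact_Int_closed[OF compU] by simp
  have contzs: "continuous_on UNIV (zs k :: (nat \<Rightarrow> circle) \<Rightarrow> _)" for k
    by (rule continuous_on_zs)
  have zs_e: "zs k (e x) = e (zs k x)" for k x using zs_additive[OF add] by simp
  have compzs: "compact (range (\<lambda>x. e (zs k x)))" for k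
  proof -
    have "compact (zs k ` range e)"
      using comp by (intro compact_continuous_image continuous_on_subset[OF contzs]) auto
    then show ?thesis by (simp add: image_image zs_e)
  qed
  have closedzs: "closed (range (\<lambda>x. e (zs k x)))" for k using compzs by (rule compact_imp_closed)
  \<comment> \<open>The images of the multiples by \<open>3 ^ n\<close> are decreasing compact sets
    whose intersection is trivial by \<open>no3\<close>.\<close>
  have small: "\<exists>n. range (\<lambda>x. e (zs (3 ^ n) x)) \<subseteq> W" if W: "open W" "0 \<in> W" for W
  proof (rule ccontr)
    assume neg: "\<not> ?thesis"
    define K where "K n = range (\<lambda>x. e (zs (3 ^ n) x)) - W" for n
    have "compact (K n)" for n unfolding K_def using compzs W(1) by (rule compact_diff)
    then have clK: "closed (K n)" for n by (rule compact_imp_closed)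
    have ne: "K n \<noteq> {}" for n using neg by (auto simp: K_def)
    have anti: "K n \<subseteq> K m" if "m \<le> n" for m n
    proof -
      have "zs (3 ^ n) x = zs (3 ^ m) (zs (3 ^ (n - m)) x)" for x :: 'g
        using that by (simp add: zs_zs power_add[symmetric])
      then have "e (zs (3 ^ n) x) \<in> range (\<lambda>x. e (zs (3 ^ m) x))" for x
        by (metis rangeI)
      then show ?thesis unfolding K_def by blast
    qed
    have "UNIV \<inter> (\<Inter>n. K n) \<noteq> {}"
    proof (rule compact_imp_fip_image[OF compU])
      fix I :: "nat set" assume I: "finite I"
      have "K (Max (insert 0 I)) \<subseteq> (\<Inter>n\<in>I. K n)"
        using I by (intro INT_greatest anti) simp
      then show "UNIV \<inter> (\<Inter>n\<in>I. K n) \<noteq> {}" using ne by blast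
    qed (rule clK)
    then obtain q where q: "\<And>n. q \<in> K n" by blast
    obtain x where x: "q = e x" using q[of 0] by (auto simp: K_def)
    have "\<exists>y. x = zs (3 ^ n) y" for n
    proof -
      obtain y where "q = e (zs (3 ^ n) y)" using q[of n] by (auto simp: K_def)
      then show ?thesis using inj' x by metis
    qed
    then have "x = 0" by (rule no3)
    then have "q = 0" using x e.zero by simp
    then show False using q[of 0] W(2) by (simp add: K_def)
  qed
  have "\<exists>y. x = zs 2 y" for x :: 'g
  proof -
    have tele: "\<exists>y. zs (3 ^ n) x - x = zs 2 y" for n
    proof (induction n)
      case 0
      then show ?case by (intro exI[of _ 0]) simp
    next
      case (Suc n)
      then obtain y where y: "zs (3 ^ n) x - x = zs 2 y" by blast
      have "zs (3 ^ Suc n) x = zs (3 ^ n + 2 * 3 ^ n) x" by simp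
      also have "\<dots> = zs (3 ^ n) x + zs 2 (zs (3 ^ n) x)" by (simp only: zs_add_left zs_zs)
      finally have *: "zs (3 ^ Suc n) x = zs (3 ^ n) x + zs 2 (zs (3 ^ n) x)" .
      have "u - x = (v - x) + w" if "u = v + w" for u v w :: 'g using that by simp
      from this[OF *] have "zs (3 ^ Suc n) x - x = zs 2 y + zs 2 (zs (3 ^ n) x)"
        unfolding y .
      then show ?case by (metis zs_add_right)
    qed
    have "- e x \<in> closure (range (\<lambda>y. e (zs 2 y)))"
      unfolding closure_approachable
    proof (intro allI impI)
      fix r :: real assume "r > 0"
      have "open {z. z + (- e x) \<in> ball (- e x) r}" by (rule open_translation_vimage) simp
      moreover have "0 \<in> {z. z + (- e x) \<in> ball (- e x) r}" using \<open>r > 0\<close> by simp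
      ultimately obtain n where n: "range (\<lambda>x. e (zs (3 ^ n) x)) \<subseteq> {z. z + (- e x) \<in> ball (- e x) r}"
        using small by blast
      then have "e (zs (3 ^ n) x) + (- e x) \<in> ball (- e x) r" by blast
      then have "dist (e (zs (3 ^ n) x - x)) (- e x) < r" by (simp add: e.diff dist_commute)
      moreover obtain y where "zs (3 ^ n) x - x = zs 2 y" using tele by blast
      ultimately show "\<exists>z\<in>range (\<lambda>y. e (zs 2 y)). dist z (- e x) < r" by auto
    qed
    then have "- e x \<in> range (\<lambda>y. e (zs 2 y))" using closedzs[of 2] by simp
    then obtain y where "- e x = e (zs 2 y)" by blast
    then have "e x = e (zs 2 (- y))" by (simp add: e.minus zm.scale_minus_right) (metis minus_minus)
    then show ?thesis using inj' by blast
  qed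
  then show False using no2 by blast
qed

text \<open>Each subset \<open>Y\<close> of the independent set \<open>X\<close> gives a
  homomorphism that is \<open>\<omega>\<close> on \<open>Y\<close> and 0 on the rest of
  \<open>X\<close>, and distinct non-empty sets get distinct codes. The empty set is left out
  because its homomorphism may be zero, and then it has no code.\<close>

theorem minimal_pseudocompact_card:
  assumes min: minimal and psc: "pseudocompact_space T" and tf: "torsion_free (UNIV :: 'g set)"
    and no3: "\<And>x::'g. (\<And>n. \<exists>y. x = zs (3 ^ n) y) \<Longrightarrow> x = 0" and no2: "\<exists>x::'g. \<forall>y. x \<noteq> zs 2 y"
  obtains X :: "('g \<Rightarrow> circle) set" where "uncountable X" "|Pow X - {{}}| \<le>o |(UNIV :: 'g set) \<times> (UNIV :: (nat \<Rightarrow> circle) set)|"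
proof -
  have pc: precompact by (rule pseudocompact_precompact[OF psc])
  have unc: "uncountable chars" by (rule uncountable_chars[OF psc pc no3 no2])
  obtain p X where X: "prime p" "X \<subseteq> chars" "pindep p X" "uncountable X"
    using ex_uncountable_pindep[OF subgrp_chars unc] by metis
  obtain \<omega> :: circle where \<omega>: "\<omega> \<noteq> 0" "zs (int p) \<omega> = 0"
  proof -
    have p1: "1 < p" using X(1) by (rule prime_gt_1_nat)
    define \<omega> where "\<omega> = Circ (cis (2 * pi / real p))"
    have cv: "cval \<omega> = cis (2 * pi / real p)" by (simp add: \<omega>_def Circ_inverse)
    have "cval (zs (int p) \<omega>) = cis (2 * pi / real p) ^ p" by (simp add: cval_zs cv)
    also have "\<dots> = cis (real p * (2 * pi / real p))" by (rule Complex.DeMoivre)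
    also have "\<dots> = 1" using p1 by simp
    finally have "zs (int p) \<omega> = 0" by simp
    moreover have "\<omega> \<noteq> 0"
    proof
      assume "\<omega> = 0"
      then have "cos (2 * pi / real p) = 1" using cv by (simp add: complex_eq_iff)
      then obtain k :: int where "2 * pi / real p = of_int k * 2 * pi" by (auto simp: cos_one_2pi_int)
      then have "1 = of_int k * real p" using p1 by (simp add: field_simps)
      then have "1 = k * int p" by (metis of_int_1 of_int_eq_iff of_int_mult of_int_of_nat_eq)
      then show False using p1 by (metis One_nat_def int_dvd_int_iff dvd_triv_right nat_dvd_1_iff_1 of_nat_1 less_irrefl)
    qed
    ultimately show ?thesis using that by blast
  qed
  have "\<exists>h. Modules.additive h \<and> range h \<subseteq> prim_part p \<and> (\<forall>x\<in>X. h x = (if x \<in> Y then \<omega> else 0))" for Y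
    using pindep_extend[OF X(1,3), of "\<lambda>x. if x \<in> Y then \<omega> else 0"] \<omega>(2) by simp
  then obtain h where h: "\<And>Y. Modules.additive (h Y)" "\<And>Y. range (h Y) \<subseteq> prim_part p"
    "\<And>Y x. x \<in> X \<Longrightarrow> h Y x = (if x \<in> Y then \<omega> else 0)" by metis
  have hnz: "\<exists>a\<in>chars. h Y a \<noteq> 0" if Y: "Y \<in> Pow X - {{}}" for Y
  proof -
    obtain x where x: "x \<in> Y" using Y by blast
    then have "h Y x \<noteq> 0" using h(3)[of x Y] Y \<omega>(1) by auto
    then show ?thesis using x Y X(2) by blast
  qed
  have "\<exists>g \<phi>. g \<noteq> 0 \<and> (\<forall>a\<in>chars. a g = (\<phi> (h Y a) :: circle))" if Y: "Y \<in> Pow X - {{}}" for Y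
    by (rule quasicyclic_hom_code[OF min pc h(1) hnz[OF Y]])
  then obtain g \<phi> where g\<phi>: "\<And>Y. Y \<in> Pow X - {{}} \<Longrightarrow> g Y \<noteq> 0 \<and> (\<forall>a\<in>chars. a (g Y) = (\<phi> Y (h Y a) :: circle))"
    by metis
  define en where "en = from_nat_into (prim_part p)"
  have en: "\<exists>n. en n = z" if "z \<in> prim_part p" for z
    unfolding en_def using from_nat_into_surj[OF countable_prim_part[OF X(1)] that] .
  \<comment> \<open>The factor map matters only on the countable quasicyclic group, so it is
    recorded as a sequence; this is where the factor \<open>nat \<Rightarrow> circle\<close> of the
    bound comes from.\<close>
  define code where "code Y = (g Y, \<lambda>n. \<phi> Y (en n))" for Y
  have "inj_on code (Pow X - {{}})"
  proof (rule inj_onI)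
    fix Y Z assume YZ: "Y \<in> Pow X - {{}}" "Z \<in> Pow X - {{}}" and eq: "code Y = code Z"
    have geq: "g Y = g Z" and peq: "\<And>n. \<phi> Y (en n) = \<phi> Z (en n)"
      using eq by (auto simp: code_def dest: fun_cong)
    have \<phi>eq: "\<phi> Y z = \<phi> Z z" if "z \<in> prim_part p" for z using en[OF that] peq by metis
    have img: "h W ` chars \<subseteq> prim_part p" for W using h(2)[of W] by blast
    have gy: "\<forall>a\<in>chars. a (g Y) = \<phi> Y (h Y a)" using g\<phi>[OF YZ(1)] by blast
    have gz: "\<forall>a\<in>chars. a (g Y) = \<phi> Y (h Z a)"
      using g\<phi>[OF YZ(2)] \<phi>eq img[of Z] unfolding geq by (metis image_subset_iff)
    have "h Y x = h Z x" if xX: "x \<in> X" for x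
      by (rule quasicyclic_hom_unique[OF min pc tf X(1) conjunct1[OF g\<phi>[OF YZ(1)]] h(1) img hnz[OF YZ(1)] gy h(1) img hnz[OF YZ(2)] gz])
        (rule subsetD[OF X(2) xX])
    then have "x \<in> Y \<longleftrightarrow> x \<in> Z" if "x \<in> X" for x
      using h(3)[OF that, of Y] h(3)[OF that, of Z] \<omega>(1) that by (metis (full_types))
    then show "Y = Z" using YZ by blast
  qed
  then have "|Pow X - {{}}| \<le>o |(UNIV :: 'g set) \<times> (UNIV :: (nat \<Rightarrow> circle) set)|"
    by (intro card_of_ordLeq[THEN iffD1] exI[of _ code]) simp
  then show ?thesis by (rule that[OF X(4)])
qed

end

section \<open>Subgroups of uncountable powers\<close>

definition big :: "'a set \<Rightarrow> bool" where "big C \<longleftrightarrow> (UNIV :: real set) \<lesssim> C"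

lemma big_inj: "big C \<Longrightarrow> inj_on f C \<Longrightarrow> f ` C \<subseteq> D \<Longrightarrow> big D"
  unfolding big_def by (metis lepoll_def lepoll_trans)

lemma open_fun_basic:
  fixes W :: "('i \<Rightarrow> 'b::topological_space) set"
  assumes "open W" "x \<in> W"
  obtains Y where "\<And>i. open (Y i)" "\<And>i. x i \<in> Y i" "finite {i. Y i \<noteq> UNIV}" "\<And>y. (\<And>i. y i \<in> Y i) \<Longrightarrow> y \<in> W"
proof -
  have "openin (product_topology (\<lambda>_. euclidean) UNIV) W"
    using assms(1) by (simp add: euclidean_product_topology)
  then obtain Y where Y: "x \<in> Pi\<^sub>E UNIV Y" "\<And>i. open (Y i)" "finite {i. Y i \<noteq> UNIV}" "Pi\<^sub>E UNIV Y \<subseteq> W"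
    using product_topology_open_contains_basis[of "\<lambda>_. euclidean" UNIV W x] assms(2) by auto
  have "y \<in> W" if "\<And>i. y i \<in> Y i" for y using Y(4) that by (auto simp: PiE_def)
  moreover have "x i \<in> Y i" for i using Y(1) by (auto simp: PiE_def)
  ultimately show ?thesis using that Y(2,3) by blast
qed

text \<open>Covers both powers used later: \<open>X\<close> will be the solenoid for connectedness
  and its fibre for zero-dimensionality. As a subset of a function type, \<open>K\<close> inherits
  the product topology.\<close>

locale uncountable_power =
  fixes X :: "(nat \<Rightarrow> circle) set" and K :: "('w \<Rightarrow> nat \<Rightarrow> circle) set"
  assumes unc: "uncountable (UNIV :: 'w set)"
    and X: "closed X" "subgrp X" "torsion_free X" "X \<noteq> {0}"
    and K_def: "K = {f. \<forall>w. f w \<in> X}"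
begin

lemma closedK: "closed K"
proof -
  have "closed {f::'w \<Rightarrow> nat \<Rightarrow> circle. f w \<in> X}" for w
    using closed_vimage[OF X(1) continuous_on_product_coordinates[of w]] by (simp add: vimage_def)
  then show ?thesis unfolding K_def by (intro closed_Collect_all)
qed

lemma compactK: "compact K" using closed_imp_compact_fun[OF closedK] .

lemma subgrpK: "subgrp K" using X(2) by (auto simp: K_def subgrp_def)

lemma torsion_freeK: "torsion_free K"
  unfolding torsion_free_def
proof (intro ballI allI impI)
  fix x and n :: int assume x: "x \<in> K" "n \<noteq> 0" "zs n x = 0"
  show "x = 0"
  proof
    fix w
    have "zs n (x w) = 0" using x(3) zs_fun[of n x w] by simp
    then show "x w = 0 w" using x X(3) by (auto simp: K_def torsion_free_def)
  qed
qed

lemma big_subgrp: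
  assumes "closed N" "subgrp N" "N \<subseteq> K" "N \<noteq> {0}"
  shows "big N"
  unfolding big_def
proof (rule closed_subgrp_ge_continuum[OF assms(1,2) _ assms(4)])
  show "torsion_free N" using torsion_freeK assms(3) by (auto simp: torsion_free_def)
qed

definition Z :: "'w set \<Rightarrow> ('w \<Rightarrow> nat \<Rightarrow> circle) \<Rightarrow> ('w \<Rightarrow> nat \<Rightarrow> circle) set" where
  "Z J q = {y \<in> K. \<forall>w\<in>J. y w = q w}"

lemma closed_Z: "closed (Z J q)"
proof -
  have "closed {y::'w \<Rightarrow> nat \<Rightarrow> circle. y w = q w}" for w
    by (intro closed_Collect_eq continuous_on_product_coordinates continuous_on_const)
  then have "closed {y::'w \<Rightarrow> nat \<Rightarrow> circle. \<forall>w. w \<in> J \<longrightarrow> y w = q w}"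
    by (intro closed_Collect_all closed_Collect_imp open_Collect_const)
  moreover have "Z J q = K \<inter> {y. \<forall>w. w \<in> J \<longrightarrow> y w = q w}" by (auto simp: Z_def)
  ultimately show ?thesis using closed_Int[OF closedK] by simp
qed

text \<open>The slice contains a translate of \<open>Z J 0\<close>, a closed subgroup that is
  nontrivial because it contains functions supported at a single index outside
  \<open>J\<close>.\<close>

lemma big_Z:
  assumes "q \<in> K" "J \<noteq> UNIV"
  shows "big (Z J q)"
proof -
  obtain w0 where w0: "w0 \<notin> J" using assms(2) by blast
  obtain x where x: "x \<in> X" "x \<noteq> 0" using X(2,4) by (auto simp: subgrp_def)
  have X0: "0 \<in> X" using X(2) by (simp add: subgrp_def)
  have "big (Z J 0)"
  proof (rule big_subgrp[OF closed_Z])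
    show "subgrp (Z J 0)" using subgrpK by (auto simp: Z_def subgrp_def)
    show "Z J 0 \<subseteq> K" by (auto simp: Z_def)
    have "(\<lambda>w. if w = w0 then x else 0) \<in> K" using x X0 by (auto simp: K_def)
    then have "(\<lambda>w. if w = w0 then x else 0) \<in> Z J 0" using w0 by (auto simp: Z_def)
    moreover have "(\<lambda>w. if w = w0 then x else 0) \<noteq> 0" using x by (auto simp: fun_eq_iff)
    ultimately show "Z J 0 \<noteq> {0}" by blast
  qed
  then show ?thesis
  proof (rule big_inj)
    show "inj_on (\<lambda>y. y + q) (Z J 0)" by (simp add: inj_on_def)
    show "(\<lambda>y. y + q) ` Z J 0 \<subseteq> Z J q" using subgrp_add[OF subgrpK _ assms(1)] by (auto simp: Z_def)
  qed
qed

end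

text \<open>The \<open>B s\<close> freely generate a subgroup of \<open>K\<close>, onto which
  \<open>h\<close> maps the free group on \<open>S\<close>; \<open>meets\<close> supplies points of
  this subgroup in all closed sets of size at least the continuum.\<close>

locale independent_transversal = uncountable_power X K
  for X :: "(nat \<Rightarrow> circle) set" and K :: "('w \<Rightarrow> nat \<Rightarrow> circle) set" +
  fixes S :: "'s set" and B :: "'s \<Rightarrow> 'w \<Rightarrow> nat \<Rightarrow> circle"
  assumes BK: "\<And>s. s \<in> S \<Longrightarrow> B s \<in> K"
    and meets: "\<And>C. closed C \<Longrightarrow> C \<subseteq> K \<Longrightarrow> big C \<Longrightarrow> \<exists>s\<in>S. B s \<in> C"
    and indep: "\<And>c. Poly_Mapping.keys c \<subseteq> S \<Longrightarrow> lincomb B c = 0 \<Longrightarrow> c = 0"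
begin

abbreviation "h \<equiv> lincomb B"
abbreviation "F \<equiv> free_Abelian_group S"

interpretation h: Modules.additive h by (rule additive_lincomb)

lemma hK: "c \<in> carrier F \<Longrightarrow> h c \<in> K"
proof -
  assume c: "c \<in> carrier F"
  have "(\<Sum>k\<in>A. zs (f k) (B k)) \<in> K" if "finite A" "A \<subseteq> S" for A f
    using that
  proof (induction A rule: finite_induct)
    case empty
    then show ?case using subgrpK unfolding subgrp_def sum.empty by blast
  next
    case (insert a A)
    then have "zs (f a) (B a) + (\<Sum>k\<in>A. zs (f k) (B k)) \<in> K"
      using BK by (intro subgrp_add[OF subgrpK] subgrp_zs[OF subgrpK]) auto
    then show ?case by (simp only: sum.insert[OF insert.hyps])
  qed
  then show ?thesis using c by (simp add: lincomb_def)
qed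

lemma inj_h: "inj_on h (carrier F)"
proof (rule inj_onI)
  fix c d assume cd: "c \<in> carrier F" "d \<in> carrier F" "h c = h d"
  have "Poly_Mapping.keys (c - d) \<subseteq> S" using cd keys_diff[of c d] by auto
  moreover have "h (c - d) = 0" using cd(3) by (simp add: h.diff)
  ultimately have "c - d = 0" by (rule indep)
  then show "c = d" by simp
qed

lemma meets': assumes "closed C" "C \<subseteq> K" "big C" obtains c where "c \<in> carrier F" "h c \<in> C" "c \<noteq> 0"
proof -
  obtain s where s: "s \<in> S" "B s \<in> C" using meets[OF assms] by blast
  have "h (Poly_Mapping.single s 1) = B s" by (simp add: lincomb_superset[of "{s}"])
  then show ?thesis using that[of "Poly_Mapping.single s 1"] s by simp
qed

text \<open>A basic neighbourhood restricts only finitely many coordinates, so it includes a slice,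
  and slices are big closed sets.\<close>

lemma dense:
  assumes "open W" "q \<in> K" "q \<in> W"
  obtains c where "c \<in> carrier F" "h c \<in> W"
proof -
  obtain Y where Y: "\<And>i. open (Y i)" "\<And>i. q i \<in> Y i" "finite {i. Y i \<noteq> UNIV}" "\<And>y. (\<And>i. y i \<in> Y i) \<Longrightarrow> y \<in> W"
    using open_fun_basic[OF assms(1,3)] by metis
  have "{i. Y i \<noteq> UNIV} \<noteq> UNIV" using Y(3) unc countable_finite by metis
  then obtain c where c: "c \<in> carrier F" "h c \<in> Z {i. Y i \<noteq> UNIV} q"
    using meets'[OF closed_Z _ big_Z[OF assms(2)]] by (metis (no_types, lifting) Z_def mem_Collect_eq subsetI)
  have "h c i \<in> Y i" for i using c(2) Y(2) by (cases "Y i = UNIV") (auto simp: Z_def)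
  then show ?thesis using that c(1) Y(4) by blast
qed

definition T :: "('s \<Rightarrow>\<^sub>0 int) topology" where "T = pullback_topology (carrier F) h euclidean"

lemma openin_T: "openin T U \<longleftrightarrow> (\<exists>W. open W \<and> U = {c \<in> carrier F. h c \<in> W})"
  unfolding T_def openin_pullback_topology by (auto simp: vimage_def Int_def conj_commute)

lemma topspace_T: "topspace T = carrier F"
  by (simp add: T_def topspace_pullback_topology)

lemma cont_h: "continuous_map T euclidean h"
  unfolding T_def
  using continuous_map_pullback[OF continuous_map_id, of "carrier F" h "euclidean :: ('w \<Rightarrow> nat \<Rightarrow> circle) topology"] by simp

lemma group_topology_T: "group_topology F T"
  unfolding group_topology_def
proof (intro conjI)
  show "topspace T = carrier F" by (rule topspace_T)
  show "Hausdorff_space T"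
    unfolding T_def by (rule Hausdorff_pullback[OF Hausdorff_fun inj_h]) simp
  have "continuous_map (prod_topology T T) euclidean (\<lambda>p. h (fst p) + h (snd p))"
    using continuous_map_compose[OF continuous_map_fst cont_h] continuous_map_compose[OF continuous_map_snd cont_h]
    by (intro continuous_map_euclidean_add) (simp_all add: o_def)
  moreover have "x + y \<in> carrier F" if "x \<in> carrier F" "y \<in> carrier F" for x y
    using that Poly_Mapping.keys_add[of x y] by auto
  ultimately show "continuous_map (prod_topology T T) T (\<lambda>(x, y). x \<otimes>\<^bsub>F\<^esub> y)"
    unfolding T_def
    by (intro continuous_map_pullback') (auto simp: o_def h.add split_beta topspace_pullback_topology simp del: carrier_free_Abelian_group_iff)
  have "continuous_map T T (\<lambda>x. - x)"
    unfolding T_def using continuous_map_euclidean_minus[OF cont_h[unfolded T_def]]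
    by (intro continuous_map_pullback') (auto simp: o_def h.minus topspace_pullback_topology)
  then show "continuous_map T T (\<lambda>x. inv\<^bsub>F\<^esub> x)"
    by (rule continuous_map_eq) (simp add: topspace_T)
qed

lemma closure_diff_mem:
  fixes P Q :: "('w \<Rightarrow> nat \<Rightarrow> circle) set"
  assumes "x \<in> closure P" "y \<in> closure Q" "\<And>a b. a \<in> P \<Longrightarrow> b \<in> Q \<Longrightarrow> a - b \<in> R"
  shows "x - y \<in> closure R"
proof -
  have "(\<lambda>p. fst p + - snd p) ` closure (P \<times> Q) \<subseteq> closure R"
  proof (rule image_closure_subset)
    have "continuous_map euclidean euclidean (\<lambda>p::('w \<Rightarrow> nat \<Rightarrow> circle) \<times> ('w \<Rightarrow> nat \<Rightarrow> circle). fst p + - snd p)"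
      by (intro continuous_map_euclidean_add continuous_map_euclidean_minus) (simp_all add: continuous_on_fst continuous_on_snd continuous_on_id)
    then have "continuous_on UNIV (\<lambda>p::('w \<Rightarrow> nat \<Rightarrow> circle) \<times> ('w \<Rightarrow> nat \<Rightarrow> circle). fst p + - snd p)" by simp
    then show "continuous_on (closure (P \<times> Q)) (\<lambda>p. fst p + - snd p)" by (rule continuous_on_subset) simp
    show "(\<lambda>p. fst p + - snd p) ` (P \<times> Q) \<subseteq> closure R" using assms(3) closure_subset by fastforce
  qed simp
  moreover have "(x, y) \<in> closure (P \<times> Q)" using assms(1,2) by (simp add: closure_Times)
  ultimately show ?thesis by force
qed

text \<open>For a coarser topology \<open>T'\<close>, the closures in \<open>K\<close> of the
  neighbourhoods of 0 intersect in a closed subgroup \<open>N\<close>. As \<open>T'\<close> is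
  Hausdorff, no non-zero group element is mapped into \<open>N\<close>; so \<open>N\<close> is
  trivial, since otherwise it would be big. Compactness of \<open>K\<close> then puts some
  \<open>T'\<close>-neighbourhood of 0 into any given open set around 0.\<close>

theorem minimal_T: "minimal_group_topology F T"
  unfolding minimal_group_topology_def
proof (intro conjI group_topology_T allI impI)
  fix T' assume "group_topology F T' \<and> (\<forall>U. openin T' U \<longrightarrow> openin T U)"
  then have gt: "group_topology F T'" and le: "\<And>U. openin T' U \<Longrightarrow> openin T U" by auto
  have top': "topspace T' = carrier F" and haus': "Hausdorff_space T'"
    and mult': "continuous_map (prod_topology T' T') T' (\<lambda>(x, y). x + y)"
    using gt by (auto simp: group_topology_def)
  have "continuous_map T' T' (\<lambda>x. inv\<^bsub>F\<^esub> x)" using gt by (simp add: group_topology_def)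
  then have inv': "continuous_map T' T' uminus" by (rule continuous_map_eq) (simp add: top')
  have zero: "0 \<in> carrier F" by simp
  have diff': "continuous_map (prod_topology T' T') T' (\<lambda>p. fst p - snd p)"
  proof -
    have "continuous_map (prod_topology T' T') (prod_topology T' T') (\<lambda>p. (fst p, - snd p))"
      unfolding continuous_map_paired
      using continuous_map_fst continuous_map_compose[OF continuous_map_snd inv'] by (auto simp: o_def)
    from continuous_map_compose[OF this mult'] show ?thesis by (simp add: o_def)
  qed
  define \<U> where "\<U> = {U. openin T' U \<and> 0 \<in> U}"
  have \<U>_carrier: "U \<subseteq> carrier F" if "U \<in> \<U>" for U using that openin_subset top' by (auto simp: \<U>_def)
  have carrier_\<U>: "carrier F \<in> \<U>" using openin_topspace[of T'] top' zero by (simp add: \<U>_def)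
  have \<U>_diff: "\<exists>V\<in>\<U>. \<forall>a\<in>V. \<forall>b\<in>V. a - b \<in> U" if U: "U \<in> \<U>" for U
  proof -
    have op: "openin (prod_topology T' T') {p \<in> topspace (prod_topology T' T'). fst p - snd p \<in> U}"
      using U by (intro openin_continuous_map_preimage[OF diff']) (simp add: \<U>_def)
    have "(0, 0) \<in> {p \<in> topspace (prod_topology T' T'). fst p - snd p \<in> U}"
      using U zero by (simp add: \<U>_def top')
    from openin_prod_topology_alt[THEN iffD1, rule_format, OF op this]
    obtain P Q where "openin T' P" "openin T' Q" "0 \<in> P" "0 \<in> Q"
      "P \<times> Q \<subseteq> {p \<in> topspace (prod_topology T' T'). fst p - snd p \<in> U}" by blast
    then show ?thesis by (intro bexI[of _ "P \<inter> Q"]) (auto simp: \<U>_def)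
  qed
  define N where "N = (\<Inter>U\<in>\<U>. closure (h ` U))"
  have clK: "closure (h ` U) \<subseteq> K" if "U \<in> \<U>" for U
    using \<U>_carrier[OF that] hK closedK by (intro closure_minimal) auto
  have NK: "N \<subseteq> K" using clK carrier_\<U> by (auto simp: N_def)
  have closedN: "closed N" unfolding N_def by (intro closed_INT) auto
  have subgrpN: "subgrp N"
    unfolding subgrp_def
  proof (intro conjI ballI)
    have "0 \<in> closure (h ` U)" if "U \<in> \<U>" for U
      using that closure_subset[of "h ` U"] h.zero by (force simp: \<U>_def)
    then show "0 \<in> N" by (simp add: N_def)
    fix x y assume xy: "x \<in> N" "y \<in> N"
    have "x - y \<in> closure (h ` U)" if U: "U \<in> \<U>" for U
    proof -
      obtain V where V: "V \<in> \<U>" "\<And>a b. a \<in> V \<Longrightarrow> b \<in> V \<Longrightarrow> a - b \<in> U" using \<U>_diff[OF U] by blast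
      show ?thesis
        using xy V(1) by (intro closure_diff_mem[of x "h ` V" y "h ` V"]) (auto simp: N_def h.diff[symmetric] intro: V(2))
    qed
    then show "x - y \<in> N" by (simp add: N_def)
  qed
  have hN: "c = 0" if c: "c \<in> carrier F" "h c \<in> N" for c
  proof (rule ccontr)
    assume "c \<noteq> 0"
    then obtain U V where UV: "openin T' U" "openin T' V" "c \<in> U" "0 \<in> V" "disjnt U V"
      using haus' c(1) zero unfolding Hausdorff_space_def top' by metis
    obtain W where W: "open W" "U = {c \<in> carrier F. h c \<in> W}" using le[OF UV(1)] by (auto simp: openin_T)
    have "h c \<in> closure (h ` V)" using c(2) UV(2,4) by (auto simp: N_def \<U>_def)
    then obtain v where "v \<in> V" "h v \<in> W"
      using open_Int_closure_eq_empty[OF W(1), of "h ` V"] W(2) UV(3) by blast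
    moreover from this have "v \<in> carrier F" using UV(2) openin_subset top' by blast
    ultimately show False using UV(5) W(2) by (auto simp: disjnt_def)
  qed
  have N0: "N = {0}"
  proof (rule ccontr)
    assume "N \<noteq> {0}"
    then have "big N" by (intro big_subgrp closedN subgrpN NK)
    then show False using meets'[OF closedN NK] hN by metis
  qed
  have fine: "\<exists>U\<in>\<U>. h ` U \<subseteq> W" if W: "open W" "0 \<in> W" for W
  proof -
    have "(K - W) \<inter> (\<Inter>U\<in>\<U>. closure (h ` U)) = {}" using N0 W(2) by (auto simp: N_def)
    moreover have "compact (K - W)" using compactK W(1) by (rule compact_diff)
    ultimately obtain \<V> where \<V>: "finite \<V>" "\<V> \<subseteq> \<U>" "(K - W) \<inter> (\<Inter>U\<in>\<V>. closure (h ` U)) = {}"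
      using compact_imp_fip_image[of "K - W" \<U> "\<lambda>U. closure (h ` U)"] by (metis closed_closure)
    have "openin T' (\<Inter>(insert (carrier F) \<V>))"
      using \<V>(1,2) carrier_\<U> by (intro openin_Inter) (auto simp: \<U>_def)
    then have U: "\<Inter>(insert (carrier F) \<V>) \<in> \<U>" using \<V>(2) zero by (auto simp: \<U>_def)
    moreover have "h c \<in> W" if "c \<in> \<Inter>(insert (carrier F) \<V>)" for c
    proof -
      have "h c \<in> K" using that hK by blast
      moreover have "h c \<in> (\<Inter>U\<in>\<V>. closure (h ` U))"
        using that closure_subset by fastforce
      ultimately show ?thesis using \<V>(3) by blast
    qed
    ultimately show ?thesis by blast
  qed
  have "openin T' U" if U: "openin T U" for U
  proof (subst openin_subopen, intro ballI)
    fix c assume c: "c \<in> U"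
    obtain W where W: "open W" "U = {c \<in> carrier F. h c \<in> W}" using U by (auto simp: openin_T)
    have "open {y. y + h c \<in> W}" using W(1) by (rule open_translation_vimage)
    moreover have "0 \<in> {y. y + h c \<in> W}" using c W(2) by simp
    ultimately obtain V where V: "V \<in> \<U>" "h ` V \<subseteq> {y. y + h c \<in> W}" using fine by blast
    have cF: "c \<in> carrier F" using c W(2) by simp
    have "continuous_map T' (prod_topology T' T') (\<lambda>x. (x, c))"
      using cF by (simp add: continuous_map_pairwise o_def top')
    from continuous_map_compose[OF this diff'] have cm: "continuous_map T' T' (\<lambda>x. x - c)" by (simp add: o_def)
    have "openin T' V" using V(1) by (simp add: \<U>_def)
    then have "openin T' {x \<in> topspace T'. x - c \<in> V}" by (rule openin_continuous_map_preimage[OF cm])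
    moreover have "c \<in> {x \<in> topspace T'. x - c \<in> V}" using cF V(1) by (simp add: top' \<U>_def)
    moreover have "{x \<in> topspace T'. x - c \<in> V} \<subseteq> U"
    proof
      fix x assume x: "x \<in> {x \<in> topspace T'. x - c \<in> V}"
      then have "h (x - c) + h c \<in> W" using V(2) by blast
      then show "x \<in> U" using x W(2) by (simp add: h.diff top')
    qed
    ultimately show "\<exists>S. openin T' S \<and> c \<in> S \<and> S \<subseteq> U" by blast
  qed
  then show "T' = T" using le topology_eq by blast
qed

lemma cluster_point:
  assumes "\<And>n::nat. q n \<in> K"
  obtains p where "p \<in> K" "\<And>W m. open W \<Longrightarrow> p \<in> W \<Longrightarrow> \<exists>n\<ge>m. q n \<in> W"
proof -
  have "K \<inter> (\<Inter>m\<in>UNIV. closure (q ` {m..})) \<noteq> {}"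
  proof (rule compact_imp_fip_image[OF compactK])
    fix I :: "nat set" assume I: "finite I" "I \<subseteq> UNIV"
    define m where "m = Max (insert 0 I)"
    have "i \<le> m" if "i \<in> I" for i unfolding m_def using I that by (intro Max_ge) auto
    then have "q m \<in> closure (q ` {i..})" if "i \<in> I" for i
      using that closure_subset[of "q ` {i..}"] by blast
    then show "K \<inter> (\<Inter>m\<in>I. closure (q ` {m..})) \<noteq> {}" using assms by blast
  qed simp
  then obtain p where p: "p \<in> K" "\<And>m. p \<in> closure (q ` {m..})" by blast
  have "\<exists>n\<ge>m. q n \<in> W" if W: "open W" "p \<in> W" for W m
  proof -
    have "W \<inter> q ` {m..} \<noteq> {}" using open_Int_closure_eq_empty[OF W(1), of "q ` {m..}"] W(2) p(2) by blast
    then show ?thesis by auto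
  qed
  then show ?thesis using that p(1) by blast
qed

text \<open>The unboundedness of a function is witnessed on countably many coordinates, and every point of the
  corresponding countable subproduct is the projection of a point of the image of \<open>F\<close>.\<close>

theorem pseudocompact_T: "pseudocompact_space T"
  unfolding pseudocompact_space_def
proof (intro allI impI, rule ccontr)
  fix f assume f: "continuous_map T euclideanreal f" and unb: "\<not> bounded (f ` topspace T)"
  have "\<exists>c\<in>carrier F. real n < \<bar>f c\<bar>" for n :: nat
    using unb unfolding bounded_iff topspace_T by (force simp: not_le)
  then obtain c where c: "\<And>n. c n \<in> carrier F" "\<And>n. real n < \<bar>f (c n)\<bar>" by metis
  have fopen: "\<exists>W. open W \<and> {d \<in> carrier F. f d \<in> U} = {c \<in> carrier F. h c \<in> W}" if "open U" for U
    using openin_continuous_map_preimage[OF f, of U] that by (simp add: openin_T topspace_T)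
  have "\<exists>Y. (\<forall>i. open (Y i) \<and> h (c n) i \<in> Y i) \<and> finite {i. Y i \<noteq> UNIV} \<and>
      (\<forall>d\<in>carrier F. (\<forall>i. h d i \<in> Y i) \<longrightarrow> real n < \<bar>f d\<bar>)" for n
  proof -
    have "open {y::real. real n < \<bar>y\<bar>}" by (intro open_Collect_less continuous_intros)
    then obtain W where W: "open W" "{d \<in> carrier F. f d \<in> {y. real n < \<bar>y\<bar>}} = {c \<in> carrier F. h c \<in> W}"
      using fopen by blast
    then have "h (c n) \<in> W" using c by blast
    then obtain Y where "\<And>i. open (Y i)" "\<And>i. h (c n) i \<in> Y i" "finite {i. Y i \<noteq> UNIV}" "\<And>y. (\<And>i. y i \<in> Y i) \<Longrightarrow> y \<in> W"
      using open_fun_basic[OF W(1)] by metis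
    then show ?thesis using W(2) by (intro exI[of _ Y]) blast
  qed
  then obtain Y where Y: "\<And>n i. open (Y n i)" "\<And>n i. h (c n) i \<in> Y n i" "\<And>n. finite {i. Y n i \<noteq> UNIV}"
    "\<And>n d. d \<in> carrier F \<Longrightarrow> (\<And>i. h d i \<in> Y n i) \<Longrightarrow> real n < \<bar>f d\<bar>" by metis
  define J where "J = (\<Union>n. {i. Y n i \<noteq> UNIV})"
  have "countable J" unfolding J_def by (intro countable_UN[OF countableI_type] countable_finite Y(3))
  then have "J \<noteq> UNIV" using unc by blast
  obtain p where p: "p \<in> K" "\<And>W m. open W \<Longrightarrow> p \<in> W \<Longrightarrow> \<exists>n\<ge>m. h (c n) \<in> W"
    using cluster_point[of "\<lambda>n. h (c n)"] hK c(1) by metis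
  have "Z J p \<subseteq> K" by (auto simp: Z_def)
  then obtain d where d: "d \<in> carrier F" "h d \<in> Z J p"
    using meets'[OF closed_Z _ big_Z[OF p(1) \<open>J \<noteq> UNIV\<close>]] by metis
  define M where "M = \<bar>f d\<bar> + 1"
  have "open {y::real. \<bar>y\<bar> < M}" by (intro open_Collect_less continuous_intros)
  then obtain W where W: "open W" "{d \<in> carrier F. f d \<in> {y. \<bar>y\<bar> < M}} = {c \<in> carrier F. h c \<in> W}"
    using fopen by blast
  then have "h d \<in> W" using d(1) by (auto simp: M_def)
  then obtain D where D: "\<And>i. open (D i)" "\<And>i. h d i \<in> D i" "finite {i. D i \<noteq> UNIV}" "\<And>y. (\<And>i. y i \<in> D i) \<Longrightarrow> y \<in> W"
    using open_fun_basic[OF W(1)] by metis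
  \<comment> \<open>On \<open>J\<close> the point \<open>d\<close> agrees with the cluster point
    \<open>p\<close>, so the constraints of \<open>D\<close> at these coordinates are met by
    \<open>c n\<close> for arbitrarily large \<open>n\<close>.\<close>
  define O' where "O' = {y::'w \<Rightarrow> nat \<Rightarrow> circle. \<forall>i\<in>{i. D i \<noteq> UNIV} \<inter> J. y i \<in> D i}"
  have "open O'"
  proof -
    have "open {y::'w \<Rightarrow> nat \<Rightarrow> circle. y i \<in> D i}" for i
      using open_vimage[OF D(1) continuous_on_product_coordinates[of i]] by (simp add: vimage_def)
    then have "open (\<Inter>i\<in>{i. D i \<noteq> UNIV} \<inter> J. {y::'w \<Rightarrow> nat \<Rightarrow> circle. y i \<in> D i})"
      using D(3) by (intro open_INT) auto
    moreover have "O' = (\<Inter>i\<in>{i. D i \<noteq> UNIV} \<inter> J. {y::'w \<Rightarrow> nat \<Rightarrow> circle. y i \<in> D i})" by (auto simp: O'_def)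
    ultimately show ?thesis by simp
  qed
  moreover have "p \<in> O'"
    unfolding O'_def
  proof (intro CollectI ballI)
    fix i assume "i \<in> {i. D i \<noteq> UNIV} \<inter> J"
    then have "p i = h d i" using d(2) by (auto simp: Z_def)
    then show "p i \<in> D i" using D(2)[of i] by simp
  qed
  moreover obtain m :: nat where m: "M < real m" using reals_Archimedean2 by blast
  ultimately obtain n where n: "n \<ge> m" "h (c n) \<in> O'" using p(2) by blast
  \<comment> \<open>Glued from \<open>c n\<close> on \<open>J\<close> and \<open>d\<close> off
    \<open>J\<close>. It satisfies the constraints \<open>D\<close> by the choice of
    \<open>n\<close>, and the constraints \<open>Y n\<close>, which are void off \<open>J\<close>.
    Group elements mapped close to \<open>y\<close> then have a value of \<open>f\<close> that is
    both too large and too small.\<close>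
  define y where "y i = (if i \<in> J then h (c n) i else h d i)" for i
  have "y \<in> K" using hK[OF c(1), of n] hK[OF d(1)] by (auto simp: K_def y_def)
  have "y i \<in> D i" for i
    using n(2) D(2)[of i] by (cases "D i = UNIV") (auto simp: y_def O'_def)
  then have yW: "y i \<in> D i \<inter> Y n i" for i
    using Y(2)[of n i] by (auto simp: y_def J_def)
  define V where "V = {z::'w \<Rightarrow> nat \<Rightarrow> circle. \<forall>i\<in>{i. D i \<inter> Y n i \<noteq> UNIV}. z i \<in> D i \<inter> Y n i}"
  have "open V"
  proof -
    have "open {y::'w \<Rightarrow> nat \<Rightarrow> circle. y i \<in> D i \<inter> Y n i}" for i
      using open_vimage[OF open_Int[OF D(1) Y(1)] continuous_on_product_coordinates[of i]] by (simp add: vimage_def)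
    moreover have "finite {i. D i \<inter> Y n i \<noteq> UNIV}"
      by (rule finite_subset[of _ "{i. D i \<noteq> UNIV} \<union> {i. Y n i \<noteq> UNIV}"]) (use D(3) Y(3) in auto)
    ultimately have "open (\<Inter>i\<in>{i. D i \<inter> Y n i \<noteq> UNIV}. {y::'w \<Rightarrow> nat \<Rightarrow> circle. y i \<in> D i \<inter> Y n i})"
      by (intro open_INT) auto
    moreover have "V = (\<Inter>i\<in>{i. D i \<inter> Y n i \<noteq> UNIV}. {y::'w \<Rightarrow> nat \<Rightarrow> circle. y i \<in> D i \<inter> Y n i})"
      by (auto simp: V_def)
    ultimately show ?thesis by simp
  qed
  moreover have "y \<in> V" using yW by (simp add: V_def)
  ultimately obtain a where a: "a \<in> carrier F" "h a \<in> V" using dense[OF _ \<open>y \<in> K\<close>] by metis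
  have ai: "h a i \<in> D i \<inter> Y n i" for i using a(2) by (cases "D i \<inter> Y n i = UNIV") (auto simp: V_def)
  then have "real n < \<bar>f a\<bar>" using Y(4)[OF a(1)] by blast
  moreover have "h a \<in> W" using D(4) ai by blast
  then have "\<bar>f a\<bar> < M" using W(2) a(1) by blast
  ultimately show False using m n(1) by linarith
qed

text \<open>Each circle coordinate of \<open>X\<close> takes finitely many values, so prescribing
  one of them is a clopen condition, and finitely many such conditions refine any basic
  neighbourhood.\<close>

theorem zero_dimensional_T:
  assumes fin: "\<And>n. finite ((\<lambda>x. x n) ` X)"
  shows "zero_dimensional_space T"
  unfolding zero_dimensional_space_def
proof (intro exI[of _ "{U. openin T U \<and> closedin T U}"] conjI ballI)
  have "openin T U \<longleftrightarrow> (arbitrary union_of (\<lambda>U. U \<in> {U. openin T U \<and> closedin T U})) U" for U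
    unfolding arbitrary_union_of_alt
  proof
    assume U: "openin T U"
    show "\<forall>c\<in>U. \<exists>V. V \<in> {U. openin T U \<and> closedin T U} \<and> c \<in> V \<and> V \<subseteq> U"
    proof
      fix c assume c: "c \<in> U"
      obtain W where W: "open W" "U = {c \<in> carrier F. h c \<in> W}" using U by (auto simp: openin_T)
      have cF: "c \<in> carrier F" and cW: "h c \<in> W" using c W(2) by auto
      obtain Y where Y: "\<And>i. open (Y i)" "\<And>i. h c i \<in> Y i" "finite {i. Y i \<noteq> UNIV}" "\<And>y. (\<And>i. y i \<in> Y i) \<Longrightarrow> y \<in> W"
        using open_fun_basic[OF W(1) cW] by metis
      have "\<exists>I. finite I \<and> (\<forall>z. (\<forall>n\<in>I. z n = h c i n) \<longrightarrow> z \<in> Y i)" for i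
      proof -
        obtain D where D: "\<And>n. open (D n)" "\<And>n. h c i n \<in> D n" "finite {n. D n \<noteq> UNIV}" "\<And>z. (\<And>n. z n \<in> D n) \<Longrightarrow> z \<in> Y i"
          using open_fun_basic[OF Y(1) Y(2), of i] by metis
        have "z \<in> Y i" if z: "\<forall>n\<in>{n. D n \<noteq> UNIV}. z n = h c i n" for z
        proof (rule D(4))
          fix n show "z n \<in> D n" using z D(2)[of n] by (cases "D n = UNIV") auto
        qed
        then show ?thesis using D(3) by blast
      qed
      then obtain I where I: "\<And>i. finite (I i)" "\<And>i z. (\<And>n. n \<in> I i \<Longrightarrow> z n = h c i n) \<Longrightarrow> z \<in> Y i" by metis
      define P where "P = (SIGMA i:{i. Y i \<noteq> UNIV}. I i)"
      have finP: "finite P" unfolding P_def using Y(3) I(1) by (intro finite_SigmaI) auto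
      define V where "V = {d \<in> carrier F. \<forall>(i, n)\<in>P. h d i n = h c i n}"
      have coord: "continuous_on UNIV (\<lambda>y::'w \<Rightarrow> nat \<Rightarrow> circle. y i n)" for i n
        by (rule continuous_on_product_then_coordinatewise[OF continuous_on_product_coordinates])
      have "openin T V"
        unfolding openin_T
      proof (intro exI conjI)
        let ?W = "\<Inter>(i, n)\<in>P. {y::'w \<Rightarrow> nat \<Rightarrow> circle. y i n \<in> - ((\<lambda>x. x n) ` X - {h c i n})}"
        have "open {y::'w \<Rightarrow> nat \<Rightarrow> circle. y i n \<in> - ((\<lambda>x. x n) ` X - {h c i n})}" for i n
        proof -
          have "closed ((\<lambda>x. x n) ` X - {h c i n})" using fin[of n] by (intro finite_imp_closed) simp
          from open_vimage[OF open_Compl[OF this] coord[of i n]] show ?thesis by (simp add: vimage_def)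
        qed
        then show "open ?W" using finP by (intro open_INT) auto
        show "V = {c \<in> carrier F. h c \<in> ?W}"
        proof -
          have "h d i n \<in> (\<lambda>x. x n) ` X" if "d \<in> carrier F" for d i n
            using hK[OF that] by (auto simp: K_def)
          then show ?thesis by (fastforce simp: V_def)
        qed
      qed
      moreover have "closedin T V"
      proof -
        have "continuous_map T euclidean (\<lambda>d. h d i n)" for i n
        proof -
          have "continuous_map euclidean euclidean (\<lambda>y::'w \<Rightarrow> nat \<Rightarrow> circle. y i n)" using coord by simp
          from continuous_map_compose[OF cont_h this] show ?thesis by (simp add: o_def)
        qed
        then have cl: "closedin T {d \<in> topspace T. h d i n \<in> {h c i n}}" for i n
          by (intro closedin_continuous_map_preimage) auto
        have "V = topspace T \<inter> (\<Inter>(i, n)\<in>P. {d \<in> topspace T. h d i n \<in> {h c i n}})"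
          by (auto simp: V_def topspace_T)
        moreover have "closedin T (topspace T \<inter> (\<Inter>(i, n)\<in>P. {d \<in> topspace T. h d i n \<in> {h c i n}}))"
        proof (cases "P = {}")
          case False
          then show ?thesis using cl by (intro closedin_Int closedin_INT) auto
        qed simp
        ultimately show ?thesis by simp
      qed
      moreover have "c \<in> V" using cF by (auto simp: V_def)
      moreover have "V \<subseteq> U"
      proof
        fix d assume d: "d \<in> V"
        have "h d i \<in> Y i" for i
        proof (cases "Y i = UNIV")
          case False
          then show ?thesis using d by (intro I(2)) (auto simp: V_def P_def)
        qed simp
        then have "h d \<in> W" by (rule Y(4))
        then show "d \<in> U" using d W(2) by (simp add: V_def)
      qed
      ultimately show "\<exists>V. V \<in> {U. openin T U \<and> closedin T U} \<and> c \<in> V \<and> V \<subseteq> U" by blast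
    qed
  next
    assume "\<forall>c\<in>U. \<exists>V. V \<in> {U. openin T U \<and> closedin T U} \<and> c \<in> V \<and> V \<subseteq> U"
    then show "openin T U" by (subst openin_subopen) blast
  qed
  then show "openin T = arbitrary union_of (\<lambda>U. U \<in> {U. openin T U \<and> closedin T U})" by (rule ext)
qed auto

text \<open>A separator of \<open>K\<close> misses the image of \<open>F\<close>, so it cannot be big; but it must meet either all slices in
  one direction or many slices in the other.\<close>

theorem connected_T:
  assumes conn: "connected X" and Xbig: "\<And>x W. x \<in> X \<Longrightarrow> open W \<Longrightarrow> x \<in> W \<Longrightarrow> big (X \<inter> W)"
  shows "connected_space T"
  unfolding connected_space_def
proof (rule notI, elim exE conjE)
  fix E1 E2
  assume E: "openin T E1" "openin T E2" "topspace T \<subseteq> E1 \<union> E2" "E1 \<inter> E2 = {}" "E1 \<noteq> {}" "E2 \<noteq> {}"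
  obtain U where U: "open U" "E1 = {c \<in> carrier F. h c \<in> U}" using E(1) by (auto simp: openin_T)
  obtain V where V: "open V" "E2 = {c \<in> carrier F. h c \<in> V}" using E(2) by (auto simp: openin_T)
  define C where "C = K - (U \<union> V)"
  have "closed C" unfolding C_def using closedK U(1) V(1) by (intro closed_Diff open_Un)
  moreover have "C \<subseteq> K" by (auto simp: C_def)
  ultimately have notbig: "\<not> big C"
    using meets'[of C] E(3) U(2) V(2) unfolding topspace_T C_def by (metis (mono_tags, lifting) DiffD2 UnCI UnE mem_Collect_eq subsetD)
  have disj: "K \<inter> U \<inter> V = {}"
  proof (rule ccontr)
    assume "K \<inter> U \<inter> V \<noteq> {}"
    then obtain q where "q \<in> K" "q \<in> U \<inter> V" by blast
    then obtain c where "c \<in> carrier F" "h c \<in> U \<inter> V" using dense[OF open_Int[OF U(1) V(1)]] by metis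
    then show False using E(4) U(2) V(2) by blast
  qed
  fix w0 :: 'w
  have sliceA: "connected {b(w0 := x) | x. x \<in> X}" for b :: "'w \<Rightarrow> nat \<Rightarrow> circle"
  proof -
    have "continuous_on X (\<lambda>x. b(w0 := x))"
    proof (rule continuous_on_coordinatewise_then_product)
      fix i
      show "continuous_on X (\<lambda>x. (b(w0 := x)) i)" by (cases "i = w0") (auto simp: continuous_on_id)
    qed
    then have "connected ((\<lambda>x. b(w0 := x)) ` X)" using conn by (rule connected_continuous_image)
    then show ?thesis by (simp add: Setcompr_eq_image)
  qed
  have sliceB: "connected {y \<in> K. y w0 = a}" if "a \<in> X" for a
  proof -
    have "connectedin (product_topology (\<lambda>_. euclidean) UNIV) (Pi\<^sub>E UNIV (\<lambda>w. if w = w0 then {a} else X))"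
      unfolding connectedin_PiE using conn by auto
    moreover have "Pi\<^sub>E UNIV (\<lambda>w. if w = w0 then {a} else X) = {y \<in> K. y w0 = a}"
      using that by (auto simp: K_def PiE_def Pi_def split: if_splits)
    ultimately show ?thesis by (simp add: euclidean_product_topology)
  qed
  have split: "D \<subseteq> U \<or> D \<subseteq> V" if D: "connected D" "D \<subseteq> K" "D \<inter> C = {}" for D
  proof -
    have "D \<subseteq> U \<union> V" "U \<inter> V \<inter> D = {}" using D(2,3) disj by (auto simp: C_def)
    then show ?thesis using connectedD[OF D(1) U(1) V(1)] by blast
  qed
  have upd: "b(w0 := x) \<in> K" if "b \<in> K" "x \<in> X" for b x using that by (auto simp: K_def)
  \<comment> \<open>When the line through \<open>b\<close> in direction \<open>w0\<close> lies in
    \<open>U'\<close>, every slice \<open>y w0 = x\<close> that also has a point in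
    \<open>V'\<close> must meet \<open>C\<close>, as it is connected. Moving \<open>v\<close> along
    \<open>w0\<close> gives a big set of such \<open>x\<close>.\<close>
  have bigC: "big C" if b: "b \<in> K" "{b(w0 := x) | x. x \<in> X} \<subseteq> U'" and UV': "(U' = U \<and> V' = V) \<or> (U' = V \<and> V' = U)"
    and v: "v \<in> K" "v \<in> V'" for b v U' V'
  proof -
    have oV': "open V'" using UV' U(1) V(1) by blast
    have "open {x. v(w0 := x) \<in> V'}"
    proof -
      have "continuous_on UNIV (\<lambda>x. v(w0 := x))"
      proof (rule continuous_on_coordinatewise_then_product)
        fix i
        show "continuous_on UNIV (\<lambda>x. (v(w0 := x)) i)" by (cases "i = w0") (auto simp: continuous_on_id)
      qed
      from open_vimage[OF oV' this] show ?thesis by (simp add: vimage_def)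
    qed
    moreover have "v w0 \<in> X" using v(1) by (simp add: K_def)
    ultimately have bigO: "big (X \<inter> {x. v(w0 := x) \<in> V'})" using v(2) by (intro Xbig[of "v w0"]) auto
    have "\<exists>y\<in>C. y w0 = x" if x: "x \<in> X \<inter> {x. v(w0 := x) \<in> V'}" for x
    proof (rule ccontr)
      assume "\<not> ?thesis"
      then have "{y \<in> K. y w0 = x} \<inter> C = {}" by blast
      then have "{y \<in> K. y w0 = x} \<subseteq> U \<or> {y \<in> K. y w0 = x} \<subseteq> V" using x by (intro split sliceB) auto
      moreover have "b(w0 := x) \<in> {y \<in> K. y w0 = x}" "v(w0 := x) \<in> {y \<in> K. y w0 = x}"
        using upd[OF b(1)] upd[OF v(1)] x by auto
      moreover have "b(w0 := x) \<in> U'" using b(2) x by blast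
      moreover have "v(w0 := x) \<in> V'" using x by blast
      ultimately show False using UV' disj by blast
    qed
    then obtain y where y: "\<And>x. x \<in> X \<inter> {x. v(w0 := x) \<in> V'} \<Longrightarrow> y x \<in> C \<and> y x w0 = x" by metis
    have "inj_on y (X \<inter> {x. v(w0 := x) \<in> V'})"
      by (rule inj_on_inverseI[of _ "\<lambda>y. y w0"]) (use y in blast)
    then show ?thesis using y by (intro big_inj[OF bigO]) auto
  qed
  obtain u where u: "u \<in> K" "u \<in> U" using E(5) U(2) hK by blast
  obtain v where v: "v \<in> K" "v \<in> V" using E(6) V(2) hK by blast
  show False
  proof (cases "\<exists>b\<in>K. {b(w0 := x) | x. x \<in> X} \<inter> C = {}")
    case True
    then obtain b where b: "b \<in> K" "{b(w0 := x) | x. x \<in> X} \<inter> C = {}" by blast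
    have "{b(w0 := x) | x. x \<in> X} \<subseteq> K" using upd[OF b(1)] by blast
    then have "{b(w0 := x) | x. x \<in> X} \<subseteq> U \<or> {b(w0 := x) | x. x \<in> X} \<subseteq> V"
      using split[OF sliceA] b(2) by blast
    then show False
    proof
      assume "{b(w0 := x) | x. x \<in> X} \<subseteq> U"
      then have "big C" by (rule bigC[OF b(1) _ _ v]) blast
      then show False using notbig by blast
    next
      assume "{b(w0 := x) | x. x \<in> X} \<subseteq> V"
      then have "big C" by (rule bigC[OF b(1) _ _ u]) blast
      then show False using notbig by blast
    qed
  next
    case False
    \<comment> \<open>Now every line in direction \<open>w0\<close> meets \<open>C\<close>, and the
      big set \<open>Z {w0} 0\<close> picks one point on each line.\<close>
    have "{w0} \<noteq> (UNIV :: 'w set)" using unc by (metis countable_finite finite.emptyI finite.insertI)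
    moreover have "0 \<in> K" using subgrpK by (simp add: subgrp_def)
    ultimately have bigZ: "big (Z {w0} 0)" by (intro big_Z)
    have "\<exists>x. b(w0 := x) \<in> C" if "b \<in> Z {w0} 0" for b
      using False that by (auto simp: Z_def)
    then obtain x where x: "\<And>b. b \<in> Z {w0} 0 \<Longrightarrow> b(w0 := x b) \<in> C" by metis
    have "inj_on (\<lambda>b. b(w0 := x b)) (Z {w0} 0)"
    proof (rule inj_onI)
      fix b b' assume b: "b \<in> Z {w0} 0" "b' \<in> Z {w0} 0" and eq: "b(w0 := x b) = b'(w0 := x b')"
      show "b = b'"
      proof
        fix w show "b w = b' w"
          using b fun_cong[OF eq, of w] by (cases "w = w0") (auto simp: Z_def)
      qed
    qed
    then have "big C" using x by (intro big_inj[OF bigZ]) auto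
    then show False using notbig by blast
  qed
qed

end

section \<open>Solenoids\<close>

text \<open>A one-parameter subgroup of the solenoid; the factorials make consecutive coordinates
  match.\<close>

definition winding :: "real \<Rightarrow> nat \<Rightarrow> circle" where
  "winding t n = Circ (cis (t / fact n))"

text \<open>The inverse limit of circles along multiplication by 1, 2, 3, ...: the Pontryagin dual
  of the rationals, which is connected and torsion-free.\<close>

definition solenoid :: "(nat \<Rightarrow> circle) set" where
  "solenoid = {x. \<forall>n. zs (int (Suc n)) (x (Suc n)) = x n}"

lemma cval_winding: "cval (winding t n) = cis (t / fact n)"
  by (simp add: winding_def Circ_inverse)

lemma winding_solenoid: "winding t \<in> solenoid"
proof -
  have "zs (int (Suc n)) (winding t (Suc n)) = winding t n" for n
  proof -
    have "cval (zs (int (Suc n)) (winding t (Suc n))) = cis (t / fact (Suc n)) ^ Suc n"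
      unfolding cval_zs cval_winding power_int_of_nat ..
    also have "\<dots> = cis (real (Suc n) * (t / fact (Suc n)))" by (rule Complex.DeMoivre)
    also have "real (Suc n) * (t / fact (Suc n)) = t / fact n" by (simp add: field_simps del: of_nat_Suc)
    finally show ?thesis by (simp only: cval_winding[symmetric] cval_inject_iff)
  qed
  then show ?thesis by (simp add: solenoid_def)
qed

lemma winding_add: "winding (s + t) = winding s + winding t"
proof
  fix n
  have "cval (winding (s + t) n) = cval ((winding s + winding t) n)"
    by (simp add: cval_add cval_winding cis_mult add_divide_distrib)
  then show "winding (s + t) n = (winding s + winding t) n" by (simp only: cval_inject_iff)
qed

lemma continuous_winding: "continuous_on UNIV winding"
proof (rule continuous_on_coordinatewise_then_product)
  fix n
  show "continuous_on UNIV (\<lambda>t. winding t n)"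
    unfolding continuous_on_iff
  proof (intro ballI allI impI)
    fix t e :: real assume "e > 0"
    have "continuous_on UNIV (\<lambda>t::real. cis (t / fact n))" by (intro continuous_intros) auto
    then obtain d where "d > 0" "\<And>t'. dist t' t < d \<Longrightarrow> dist (cis (t' / fact n)) (cis (t / fact n)) < e"
      using \<open>e > 0\<close> unfolding continuous_on_iff by (metis UNIV_I)
    then show "\<exists>d>0. \<forall>t'\<in>UNIV. dist t' t < d \<longrightarrow> dist (winding t' n) (winding t n) < e"
      by (auto simp: dist_cval cval_winding dist_norm intro!: exI[of _ d])
  qed
qed

lemma closed_solenoid: "closed solenoid"
proof -
  have "continuous_on UNIV (\<lambda>x::nat \<Rightarrow> circle. zs k (x n))" for k n
    using continuous_on_compose2[OF continuous_on_zs continuous_on_product_coordinates[of n]] by simp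
  then show ?thesis
    unfolding solenoid_def by (intro closed_Collect_all closed_Collect_eq continuous_on_product_coordinates)
qed

lemma subgrp_solenoid: "subgrp solenoid"
  by (auto simp: subgrp_def solenoid_def zm.scale_right_diff_distrib)

text \<open>The multiplier is the product of the numbers from \<open>n + 1\<close> to
  \<open>n + m\<close>. Its last factor is recorded because the level \<open>n + m\<close> can be
  chosen as a multiple of any given integer.\<close>

lemma solenoid_divide:
  "\<exists>d. (\<forall>y\<in>solenoid. y n = zs (int d) (y (n + m))) \<and> (0 < m \<longrightarrow> (n + m) dvd d)"
proof (induction m)
  case 0
  show ?case by (rule exI[of _ 1]) simp
next
  case (Suc m)
  then obtain d where d: "\<forall>y\<in>solenoid. y n = zs (int d) (y (n + m))" by blast
  have "y n = zs (int (d * Suc (n + m))) (y (n + Suc m))" if "y \<in> solenoid" for y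
  proof -
    have "y n = zs (int d) (y (n + m))" using d that ..
    also have "y (n + m) = zs (int (Suc (n + m))) (y (Suc (n + m)))"
      using that by (simp add: solenoid_def del: of_nat_Suc)
    finally show ?thesis by (simp only: zs_zs of_nat_mult add_Suc_right)
  qed
  then show ?case by (intro exI[of _ "d * Suc (n + m)"] conjI ballI) (simp_all del: of_nat_mult mult_Suc_right)
qed

lemma torsion_free_solenoid: "torsion_free solenoid"
  unfolding torsion_free_def
proof (intro ballI allI impI)
  fix x and k :: int assume x: "x \<in> solenoid" and k: "k \<noteq> 0" "zs k x = 0"
  have mult: "\<exists>d. x n = zs (int (d * m)) (x m)" if "0 < m" "n < m" for n m
  proof -
    have nm: "n + (m - n) = m" using \<open>n < m\<close> by simp
    from solenoid_divide[of n "m - n"]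
    obtain d where d: "(\<forall>y\<in>solenoid. y n = zs (int d) (y m)) \<and> (0 < m - n \<longrightarrow> m dvd d)"
      unfolding nm ..
    then have "m dvd d" using \<open>n < m\<close> by simp
    then obtain e where "d = e * m" by (metis dvd_def mult.commute)
    moreover have "x n = zs (int d) (x m)" using d[THEN conjunct1] x by (rule bspec)
    ultimately show ?thesis by blast
  qed
  show "x = 0"
  proof
    fix n
    \<comment> \<open>A level above \<open>n\<close> that is a multiple of \<open>k\<close>, so that
      \<open>x n\<close> becomes a multiple of \<open>zs k (x m) = 0\<close>.\<close>
    define m where "m = nat \<bar>k\<bar> * Suc n"
    have m: "0 < m" "n < m"
    proof -
      have "1 \<le> nat \<bar>k\<bar>" using k(1) by simp
      then have "1 * Suc n \<le> nat \<bar>k\<bar> * Suc n" by (rule mult_right_mono) simp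
      then show "0 < m" "n < m" using k(1) by (simp_all add: m_def)
    qed
    obtain d where "x n = zs (int (d * m)) (x m)" using mult[OF m] by blast
    also have "int (d * m) = (int d * int (Suc n) * sgn k) * k"
      by (simp add: m_def sgn_if algebra_simps)
    also have "zs \<dots> (x m) = zs (int d * int (Suc n) * sgn k) (zs k (x m))" by (simp only: zs_zs)
    also have "zs k (x m) = 0" using k(2) zs_fun[of k x m] by simp
    finally show "x n = 0 n" by simp
  qed
qed

text \<open>The image of the real line under \<open>winding\<close> is dense: finitely many
  coordinates of a point are determined by the last one, which is attained at a suitable
  parameter.\<close>

lemma connected_solenoid: "connected solenoid"
proof -
  have "solenoid \<subseteq> closure (range winding)"
  proof
    fix x assume x: "x \<in> solenoid"
    have "range winding \<inter> W \<noteq> {}" if W: "open W" "x \<in> W" for W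
    proof -
      obtain Y where Y: "\<And>i. open (Y i)" "\<And>i. x i \<in> Y i" "finite {i. Y i \<noteq> UNIV}" "\<And>y. (\<And>i. y i \<in> Y i) \<Longrightarrow> y \<in> W"
        using open_fun_basic[OF W] by metis
      define N where "N = Max (insert 0 {i. Y i \<noteq> UNIV})"
      have N: "i \<le> N" if "Y i \<noteq> UNIV" for i unfolding N_def using Y(3) that by (intro Max_ge) auto
      obtain s where s: "cval (x N) = cis s"
        using norm_cval[of "x N"] by (metis cis_Arg_unique complex_norm_eq_1_exp cis_conv_exp)
      define t where "t = s * fact N"
      have "cval (winding t N) = cval (x N)" by (simp add: cval_winding t_def s)
      then have eq: "winding t N = x N" by (simp only: cval_inject_iff)
      have "winding t i = x i" if "i \<le> N" for i
      proof -
        have "i + (N - i) = N" using that by simp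
        from solenoid_divide[of i "N - i", unfolded this]
        obtain d where d: "(\<forall>y\<in>solenoid. y i = zs (int d) (y N)) \<and> (0 < N - i \<longrightarrow> N dvd d)" ..
        have "x i = zs (int d) (x N)" "winding t i = zs (int d) (winding t N)"
          by (rule bspec[OF d[THEN conjunct1] x], rule bspec[OF d[THEN conjunct1] winding_solenoid])
        then show ?thesis using eq by simp
      qed
      then have "winding t i \<in> Y i" for i using N[of i] Y(2)[of i] by (cases "Y i = UNIV") auto
      then have "winding t \<in> W" by (rule Y(4))
      then show ?thesis by blast
    qed
    then show "x \<in> closure (range winding)" unfolding closure_iff_nhds_not_empty by (metis Int_commute Int_mono subset_empty order_refl)
  qed
  moreover have "closure (range winding) \<subseteq> solenoid"
    using winding_solenoid closed_solenoid by (intro closure_minimal) auto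
  moreover have "connected (range winding)"
    by (rule connected_continuous_image[OF continuous_winding]) simp
  ultimately show ?thesis using connected_imp_connected_closure by (metis subset_antisym)
qed

lemma winding_pi_nonzero: "winding (2 * pi) \<noteq> 0"
proof
  assume "winding (2 * pi) = 0"
  then have "cval (winding (2 * pi) 2) = 1" by simp
  then show False by (simp add: cval_winding)
qed

lemma big_open_solenoid:
  assumes "x \<in> solenoid" "open W" "x \<in> W"
  shows "big (solenoid \<inter> W)"
proof -
  have "open (winding -` {z. z + x \<in> W})"
    by (rule open_vimage[OF open_translation_vimage[OF assms(2)] continuous_winding])
  moreover have "winding 0 = 0" using winding_add[of 0 0] by simp
  then have "0 \<in> winding -` {z. z + x \<in> W}" using assms(3) by simp
  ultimately obtain r where r: "r > 0" "ball 0 r \<subseteq> winding -` {z. z + x \<in> W}"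
    using open_contains_ball by metis
  \<comment> \<open>With radius at most 1 two parameters differ by less than \<open>2 * pi\<close>,
    so that coordinate 0 already separates them.\<close>
  define \<rho> where "\<rho> = min r 1"
  have "{-\<rho><..<\<rho>} \<approx> (UNIV :: real set)"
    using r(1) by (intro open_interval_eqpoll_reals[THEN iffD2]) (auto simp: \<rho>_def)
  then have "big {-\<rho><..<\<rho>}" unfolding big_def by (meson eqpoll_imp_lepoll eqpoll_sym)
  then show ?thesis
  proof (rule big_inj)
    show "inj_on (\<lambda>t. winding t + x) {-\<rho><..<\<rho>}"
    proof (rule inj_onI)
      fix s t assume st: "s \<in> {-\<rho><..<\<rho>}" "t \<in> {-\<rho><..<\<rho>}" "winding s + x = winding t + x"
      then have "cval (winding s 0) = cval (winding t 0)" by simp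
      then have "cis s = cis t" by (simp add: cval_winding)
      then have "cis (s - t) = 1" by (metis cis_divide cis_neq_zero divide_self)
      then have "cos (s - t) = 1" by (simp add: complex_eq_iff)
      then obtain k :: int where k: "s - t = of_int k * 2 * pi" by (auto simp: cos_one_2pi_int)
      have "\<bar>s - t\<bar> < 2" using st(1,2) by (auto simp: \<rho>_def)
      moreover have "2 < 2 * pi" using pi_gt3 by simp
      ultimately have "\<bar>of_int k * (2 * pi)\<bar> < 1 * (2 * pi)" using k by (simp add: mult.assoc)
      then have "\<bar>of_int k :: real\<bar> < 1" unfolding abs_mult using pi_gt_zero by simp
      then have "k = 0" by linarith
      then show "s = t" using k by simp
    qed
    show "(\<lambda>t. winding t + x) ` {-\<rho><..<\<rho>} \<subseteq> solenoid \<inter> W"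
    proof safe
      fix t assume "t \<in> {-\<rho><..<\<rho>}"
      then have "t \<in> ball 0 r" by (auto simp: \<rho>_def dist_real_def)
      then show "winding t + x \<in> W" using r(2) by blast
      show "winding t + x \<in> solenoid" by (rule subgrp_add[OF subgrp_solenoid winding_solenoid assms(1)])
    qed
  qed
qed

text \<open>The kernel of the projection to coordinate 0, isomorphic to the profinite
  integers.\<close>

definition solenoid0 :: "(nat \<Rightarrow> circle) set" where "solenoid0 = {x \<in> solenoid. x 0 = 0}"

lemma solenoid0_props:
  "closed solenoid0" "subgrp solenoid0" "torsion_free solenoid0" "solenoid0 \<noteq> {0}"
  "finite ((\<lambda>x. x n) ` solenoid0)"
proof -
  have "closed {x::nat \<Rightarrow> circle. x 0 = 0}"
    by (intro closed_Collect_eq continuous_on_product_coordinates continuous_on_const)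
  then have "closed (solenoid \<inter> {x. x 0 = 0})" by (rule closed_Int[OF closed_solenoid])
  moreover have "solenoid \<inter> {x. x 0 = 0} = solenoid0" by (auto simp: solenoid0_def)
  ultimately show "closed solenoid0" by metis
  show "subgrp solenoid0" using subgrp_solenoid by (auto simp: subgrp_def solenoid0_def)
  show "torsion_free solenoid0" using torsion_free_solenoid by (auto simp: torsion_free_def solenoid0_def)
  have "cval (winding (2 * pi) 0) = 1" by (simp add: cval_winding)
  then have "winding (2 * pi) \<in> solenoid0" using winding_solenoid by (simp add: solenoid0_def)
  then show "solenoid0 \<noteq> {0}" using winding_pi_nonzero by blast
  have "zs (int (fact n)) (x n) = 0" if x: "x \<in> solenoid0" for x
  proof -
    have "zs (int (fact n)) (x n) = x 0"
    proof (induction n)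
      case (Suc n)
      have "zs (int (fact (Suc n))) (x (Suc n)) = zs (int (fact n)) (zs (int (Suc n)) (x (Suc n)))"
        by (simp only: zs_zs fact_Suc of_nat_mult mult.commute of_nat_id)
      also have "zs (int (Suc n)) (x (Suc n)) = x n" using x by (simp add: solenoid0_def solenoid_def del: of_nat_Suc)
      finally show ?case using Suc by simp
    qed simp
    then show ?thesis using x by (simp add: solenoid0_def)
  qed
  then have "(\<lambda>x. x n) ` solenoid0 \<subseteq> {z. zs (int (fact n)) z = 0}" by blast
  then show "finite ((\<lambda>x. x n) ` solenoid0)"
    by (rule finite_subset) (rule finite_torsion, simp)
qed

section \<open>Free abelian groups and cardinals\<close>

lemma homeomorphic_maps_pullback:
  assumes "\<And>x. x \<in> A \<Longrightarrow> f x \<in> topspace T \<and> g (f x) = x"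
    and "\<And>y. y \<in> topspace T \<Longrightarrow> g y \<in> A \<and> f (g y) = y"
  shows "homeomorphic_maps (pullback_topology A f T) T f g"
  unfolding homeomorphic_maps_def
proof (intro conjI)
  show "continuous_map (pullback_topology A f T) T f"
    using continuous_map_pullback[OF continuous_map_id, of A f T] by simp
  have "continuous_map T T (f \<circ> g)"
    by (rule continuous_map_eq[OF continuous_map_id]) (simp add: assms)
  then show "continuous_map T (pullback_topology A f T) g"
    by (rule continuous_map_pullback') (use assms in auto)
qed (use assms in \<open>auto simp: topspace_pullback_topology\<close>)

lemma group_topology_pullback:
  assumes G: "group G" and H: "group H" and \<psi>: "\<psi> \<in> iso H G" and T: "group_topology G T"
  shows "group_topology H (pullback_topology (carrier H) \<psi> T)"
    and "homeomorphic_maps (pullback_topology (carrier H) \<psi> T) T \<psi> (inv_into (carrier H) \<psi>)"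
proof -
  define \<phi> where "\<phi> = inv_into (carrier H) \<psi>"
  let ?T = "pullback_topology (carrier H) \<psi> T"
  have bij: "bij_betw \<psi> (carrier H) (carrier G)" using \<psi> by (simp add: iso_def)
  have topT: "topspace T = carrier G" using T by (simp add: group_topology_def)
  have \<psi>H: "\<psi> x \<in> carrier G" "\<phi> (\<psi> x) = x" if "x \<in> carrier H" for x
    using bij that by (auto simp: \<phi>_def bij_betw_def)
  have \<phi>G: "\<phi> y \<in> carrier H" "\<psi> (\<phi> y) = y" if "y \<in> carrier G" for y
    using bij that by (auto simp: \<phi>_def bij_betw_def inv_into_into f_inv_into_f)
  have hm: "homeomorphic_maps ?T T \<psi> \<phi>"
    by (rule homeomorphic_maps_pullback) (simp_all add: topT \<psi>H \<phi>G)
  then show "homeomorphic_maps ?T T \<psi> (inv_into (carrier H) \<psi>)" by (simp add: \<phi>_def)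
  have c\<psi>: "continuous_map ?T T \<psi>" and c\<phi>: "continuous_map T ?T \<phi>"
    using hm by (simp_all add: homeomorphic_maps_def)
  have top: "topspace ?T = carrier H" using \<psi>H by (auto simp: topspace_pullback_topology topT)
  interpret group_hom H G \<psi>
    using G H \<psi> by (simp add: group_hom_def group_hom_axioms_def iso_def)
  show "group_topology H ?T"
    unfolding group_topology_def
  proof (intro conjI)
    show "topspace ?T = carrier H" by (rule top)
    show "Hausdorff_space ?T"
      using homeomorphic_Hausdorff_space[OF homeomorphic_maps_imp_homeomorphic_space[OF hm]] T
      by (simp add: group_topology_def)
    have "continuous_map (prod_topology ?T ?T) (prod_topology T T) (\<lambda>p. (\<psi> (fst p), \<psi> (snd p)))"
      using continuous_map_compose[OF continuous_map_fst c\<psi>] continuous_map_compose[OF continuous_map_snd c\<psi>]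
      by (intro continuous_map_pairedI) (simp_all add: o_def)
    moreover have "continuous_map (prod_topology T T) T (\<lambda>(x, y). x \<otimes>\<^bsub>G\<^esub> y)"
      using T by (simp add: group_topology_def)
    ultimately have "continuous_map (prod_topology ?T ?T) T (\<lambda>p. \<psi> (fst p) \<otimes>\<^bsub>G\<^esub> \<psi> (snd p))"
      by (rule continuous_map_compose[THEN continuous_map_eq]) auto
    from continuous_map_compose[OF this c\<phi>]
    have "continuous_map (prod_topology ?T ?T) ?T (\<lambda>p. \<phi> (\<psi> (fst p) \<otimes>\<^bsub>G\<^esub> \<psi> (snd p)))"
      by (simp add: o_def)
    then show "continuous_map (prod_topology ?T ?T) ?T (\<lambda>(x, y). x \<otimes>\<^bsub>H\<^esub> y)"
      by (rule continuous_map_eq) (auto simp: top \<psi>H hom_mult[symmetric] simp del: hom_mult)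
    have "continuous_map ?T ?T (\<lambda>x. \<phi> (inv\<^bsub>G\<^esub> (\<psi> x)))"
      using continuous_map_compose[OF continuous_map_compose[OF c\<psi>] c\<phi>, of "\<lambda>x. inv\<^bsub>G\<^esub> x"] T
      by (simp add: o_def group_topology_def)
    then show "continuous_map ?T ?T (\<lambda>x. inv\<^bsub>H\<^esub> x)"
      by (rule continuous_map_eq) (auto simp: top \<psi>H hom_inv[symmetric] simp del: hom_inv)
  qed
qed

lemma minimal_group_topology_pullback:
  assumes G: "group G" and H: "group H" and \<psi>: "\<psi> \<in> iso H G" and T: "minimal_group_topology G T"
  shows "minimal_group_topology H (pullback_topology (carrier H) \<psi> T)" (is "minimal_group_topology H ?T")
proof -
  have gT: "group_topology G T" using T by (simp add: minimal_group_topology_def)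
  then have topT: "topspace T = carrier G" by (simp add: group_topology_def)
  have gT': "group_topology H ?T" by (rule group_topology_pullback(1)[OF G H \<psi> gT])
  have "T' = ?T" if T': "group_topology H T'" and le: "\<forall>U. openin T' U \<longrightarrow> openin ?T U" for T'
  proof -
  have topT': "topspace T' = carrier H" using T' by (simp add: group_topology_def)
  define \<phi> where "\<phi> = inv_into (carrier H) \<psi>"
  have bij: "bij_betw \<psi> (carrier H) (carrier G)" using \<psi> by (simp add: iso_def)
  have \<psi>H: "\<psi> x \<in> carrier G" "\<phi> (\<psi> x) = x" if "x \<in> carrier H" for x
    using bij that by (auto simp: \<phi>_def bij_betw_def)
  have \<phi>G: "\<phi> y \<in> carrier H" "\<psi> (\<phi> y) = y" if "y \<in> carrier G" for y
    using bij that by (auto simp: \<phi>_def bij_betw_def inv_into_into f_inv_into_f)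
  have \<phi>: "\<phi> \<in> iso G H" unfolding \<phi>_def by (rule group.iso_set_sym[OF H \<psi>])
  let ?S = "pullback_topology (carrier G) \<phi> T'"
  have "group_topology G ?S" by (rule group_topology_pullback(1)[OF H G \<phi> T'])
  moreover have "openin T U" if S: "openin ?S U" for U
  proof -
    obtain V where V: "openin T' V" "U = \<phi> -` V \<inter> carrier G"
      using S by (auto simp: openin_pullback_topology)
    then obtain W where W: "openin T W" "V = \<psi> -` W \<inter> carrier H"
      using le by (auto simp: openin_pullback_topology)
    have "U = W" using V(2) W \<phi>G openin_subset[OF W(1)] topT by auto
    then show ?thesis using W(1) by simp
  qed
  ultimately have S: "?S = T" using T by (auto simp: minimal_group_topology_def)
  have "openin T' V" if V: "openin ?T V" for V
  proof -
    obtain W where W: "openin T W" "V = \<psi> -` W \<inter> carrier H"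
      using V by (auto simp: openin_pullback_topology)
    then obtain V' where V': "openin T' V'" "W = \<phi> -` V' \<inter> carrier G"
      by (auto simp: openin_pullback_topology S[symmetric])
    have "V = V'" using V'(2) W(2) \<psi>H openin_subset[OF V'(1)] topT' by auto
    then show ?thesis using V'(1) by simp
  qed
  then show "T' = ?T" using le by (auto simp: topology_eq)
  qed
  then show ?thesis using gT' by (simp add: minimal_group_topology_def)
qed

lemma pseudocompact_space_homeomorphic:
  assumes hm: "homeomorphic_maps X Y f g" and psc: "pseudocompact_space Y"
  shows "pseudocompact_space X"
  unfolding pseudocompact_space_def
proof (intro allI impI)
  fix k assume "continuous_map X euclideanreal k"
  then have "continuous_map Y euclideanreal (k \<circ> g)"
    using hm continuous_map_compose unfolding homeomorphic_maps_def by blast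
  then have "bounded ((k \<circ> g) ` topspace Y)" using psc unfolding pseudocompact_space_def by blast
  moreover have "k ` topspace X \<subseteq> (k \<circ> g) ` topspace Y"
  proof (rule image_subsetI)
    fix x assume "x \<in> topspace X"
    then have "f x \<in> topspace Y" "g (f x) = x"
      using hm by (auto simp: homeomorphic_maps_def continuous_map_def)
    then show "k x \<in> (k \<circ> g) ` topspace Y" by (metis comp_apply imageI)
  qed
  ultimately show "bounded (k ` topspace X)" by (rule bounded_subset)
qed

lemma group_topology_free_UNIV:
  "group_topology (free_Abelian_group (UNIV :: 's set)) T \<longleftrightarrow> top_grp T"
proof -
  have "carrier (free_Abelian_group (UNIV :: 's set)) = UNIV" by auto
  moreover have "(\<lambda>x. inv\<^bsub>free_Abelian_group (UNIV :: 's set)\<^esub> x) = uminus" by (rule ext) simp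
  ultimately show ?thesis by (simp add: group_topology_def top_grp_def)
qed

lemma torsion_free_poly_mapping: "torsion_free (UNIV :: ('s \<Rightarrow>\<^sub>0 int) set)"
  unfolding torsion_free_def
proof (intro ballI allI impI)
  fix x :: "'s \<Rightarrow>\<^sub>0 int" and n :: int assume n: "n \<noteq> 0" "zs n x = 0"
  show "x = 0"
  proof (rule poly_mapping_eqI)
    fix k
    have "n * Poly_Mapping.lookup x k = 0" using n(2) by (metis lookup_zs lookup_zero)
    then show "Poly_Mapping.lookup x k = Poly_Mapping.lookup 0 k" using n(1) by simp
  qed
qed

lemma poly_mapping_not_3_divisible:
  fixes x :: "'s \<Rightarrow>\<^sub>0 int"
  assumes "\<And>n. \<exists>y. x = zs (3 ^ n) y"
  shows "x = 0"
proof (rule poly_mapping_eqI)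
  fix k
  let ?m = "Poly_Mapping.lookup x k"
  \<comment> \<open>This exponent suffices, since an integer is smaller in absolute value than 3 to
    the power of its absolute value.\<close>
  define n where "n = nat \<bar>?m\<bar>"
  obtain y where "x = zs (3 ^ n) y" using assms by blast
  then have "3 ^ n dvd ?m" by (simp add: lookup_zs)
  moreover have "\<bar>?m\<bar> < 3 ^ n"
  proof -
    have "n < 3 ^ n" by (rule less_exp[THEN less_le_trans]) (simp add: power_mono)
    then have "int n < int (3 ^ n)" by (simp only: of_nat_less_iff)
    then show ?thesis by (simp add: n_def)
  qed
  ultimately show "?m = Poly_Mapping.lookup 0 k"
    using dvd_imp_le_int[of ?m "3 ^ n"] by auto
qed

lemma poly_mapping_not_2_divisible:
  "\<exists>x :: 's \<Rightarrow>\<^sub>0 int. \<forall>y. x \<noteq> zs 2 y"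
proof (intro exI allI notI)
  fix y :: "'s \<Rightarrow>\<^sub>0 int" and a :: 's
  assume "Poly_Mapping.single undefined 1 = zs 2 y"
  then have "1 = 2 * Poly_Mapping.lookup y undefined"
    by (metis lookup_single_eq lookup_zs)
  then show False by presburger
qed

section \<open>Cardinal arithmetic and Lusin's Hypothesis\<close>

lemma ctwo_cexp: "ctwo ^c r =o |Pow (Field r)|"
proof -
  have "ctwo ^c r = |Func (Field r) (UNIV :: bool set)|" by (simp add: cexp_def ctwo_def)
  then show ?thesis using ordIso_symmetric[OF card_of_Pow_Func[of "Field r"]] by simp
qed

lemma continuum_nat_sets: "continuum =o |UNIV :: nat set set|"
  using ctwo_cexp[of natLeq] by (simp add: continuum_def Field_natLeq)

text \<open>The opposite inequality always holds, because the power set of a countable set embeds in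
  that of a larger one.\<close>

lemma Lusin_hypothesis_iff: "Lusin_hypothesis \<longleftrightarrow> |Pow (Field (cardSuc natLeq))| \<le>o |UNIV :: nat set set|"
proof -
  let ?\<omega>1 = "Field (cardSuc natLeq)"
  have "|UNIV :: nat set| \<le>o |?\<omega>1|"
    using card_of_mono2[OF cardSuc_ordLeq[OF natLeq_Card_order]] by (simp add: Field_natLeq)
  from card_of_Pow_mono[OF this] have ge: "|UNIV :: nat set set| \<le>o |Pow ?\<omega>1|" by simp
  have "Lusin_hypothesis \<longleftrightarrow> |Pow ?\<omega>1| =o |UNIV :: nat set set|"
    unfolding Lusin_hypothesis_def
    using ctwo_cexp[of "cardSuc natLeq"] continuum_nat_sets
    by (meson ordIso_symmetric ordIso_transitive)
  then show ?thesis using ge by (meson ordIso_iff_ordLeq)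
qed

lemma cardSuc_natLeq_le_uncountable:
  assumes "uncountable X"
  shows "|Field (cardSuc natLeq)| \<le>o |X|"
proof -
  have "natLeq <o |X|"
    proof (rule ccontr)
    assume "\<not> natLeq <o |X|"
    then have "|X| \<le>o natLeq"
      using not_ordLess_iff_ordLeq[OF card_of_Well_order natLeq_Well_order] by blast
    then have "|X| \<le>o |UNIV :: nat set|"
      using card_of_nat ordIso_symmetric ordLeq_ordIso_trans by blast
    then have "countable X" unfolding countable_def card_of_ordLeq[symmetric] by blast
    then show False using assms by blast
  qed
  then have "cardSuc natLeq \<le>o |X|"
    using cardSuc_ordLess_ordLeq[OF natLeq_Card_order card_of_Card_order] by blast
  then show ?thesis using card_of_mono2 by fastforce
qed

text \<open>A point is determined by the members of a countable base that contain it.\<close>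

lemma card_fun_circle: "|UNIV :: (nat \<Rightarrow> circle) set| \<le>o |UNIV :: nat set set|"
proof -
  obtain B :: "(nat \<Rightarrow> circle) set set" where B: "countable B" "topological_basis B"
    using ex_countable_basis by blast
  obtain e :: "(nat \<Rightarrow> circle) set \<Rightarrow> nat" where e: "inj_on e B" using B(1) by (auto simp: countable_def)
  define f where "f x = e ` {b \<in> B. x \<in> b}" for x
  have "inj f"
  proof (rule injI, rule ccontr)
    fix x y assume xy: "f x = f y" "x \<noteq> y"
    have "{b \<in> B. x \<in> b} = {b \<in> B. y \<in> b}"
      using xy(1) inj_on_image_eq_iff[OF e, of "{b \<in> B. x \<in> b}" "{b \<in> B. y \<in> b}"] by (simp add: f_def)
    obtain U where "open U" "x \<in> U" "y \<notin> U" using separation_t1[of x y] xy(2) by blast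
    then obtain b where "b \<in> B" "x \<in> b" "b \<subseteq> U" using topological_basisE[OF B(2)] by blast
    then show False using \<open>{b \<in> B. x \<in> b} = {b \<in> B. y \<in> b}\<close> \<open>y \<notin> U\<close> by blast
  qed
  then show ?thesis by (intro card_of_ordLeqI[where f = f]) auto
qed

lemma cardSuc_natLeq_uncountable: "uncountable (Field (cardSuc natLeq))"
proof
  assume "countable (Field (cardSuc natLeq))"
  then have "|Field (cardSuc natLeq)| \<le>o |UNIV :: nat set|"
    unfolding countable_def card_of_ordLeq[symmetric] by blast
  moreover have "|Field (cardSuc natLeq)| =o cardSuc natLeq"
    by (rule card_of_Field_ordIso[OF cardSuc_Card_order[OF natLeq_Card_order]])
  ultimately have "cardSuc natLeq \<le>o natLeq"
    using card_of_nat by (meson ordIso_ordLeq_trans ordIso_symmetric ordLeq_ordIso_trans)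
  then show False
    using cardSuc_greater[OF natLeq_Card_order] not_ordLess_ordLeq by blast
qed

text \<open>The free group on \<open>S\<close> is replaced by the isomorphic one on
  \<open>UNIV :: nat set set\<close>, whose carrier is a whole type, as
  \<open>abelian_top_grp\<close> requires. Both the group and
  \<open>nat \<Rightarrow> circle\<close> have size at most the continuum, so the bound of
  \<open>minimal_pseudocompact_card\<close> becomes the hypothesis.\<close>

theorem minimal_pseudocompact_imp_Lusin:
  fixes S :: "'s set"
  assumes S: "|S| =o continuum" and min: "minimal_group_topology (free_Abelian_group S) T"
    and psc: "pseudocompact_space T"
  shows Lusin_hypothesis
proof -
  let ?H = "free_Abelian_group (UNIV :: nat set set)"
  have "S \<approx> (UNIV :: nat set set)"
    using ordIso_transitive[OF S continuum_nat_sets] by (simp add: eqpoll_iff_card_of_ordIso)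
  then have "?H \<cong> free_Abelian_group S"
    using isomorphic_free_Abelian_groups eqpoll_sym by blast
  then obtain \<psi> where \<psi>: "\<psi> \<in> iso ?H (free_Abelian_group S)" by (auto simp: is_iso_def)
  define T' where "T' = pullback_topology (carrier ?H) \<psi> T"
  have min': "minimal_group_topology ?H T'"
    unfolding T'_def by (rule minimal_group_topology_pullback[OF _ _ \<psi> min]) auto
  have psc': "pseudocompact_space T'"
    unfolding T'_def
    using min group_topology_pullback(2)[OF group_free_Abelian_group group_free_Abelian_group \<psi>]
    by (intro pseudocompact_space_homeomorphic[OF _ psc]) (auto simp: minimal_group_topology_def)
  interpret abelian_top_grp T'
    using min' by unfold_locales (simp add: minimal_group_topology_def group_topology_free_UNIV)
  have "minimal" using min' by (simp add: minimal_def minimal_group_topology_def group_topology_free_UNIV)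
  then obtain X :: "((nat set \<Rightarrow>\<^sub>0 int) \<Rightarrow> circle) set" where X: "uncountable X"
    "|Pow X - {{}}| \<le>o |(UNIV :: (nat set \<Rightarrow>\<^sub>0 int) set) \<times> (UNIV :: (nat \<Rightarrow> circle) set)|"
    using minimal_pseudocompact_card[OF _ psc' torsion_free_poly_mapping poly_mapping_not_3_divisible poly_mapping_not_2_divisible]
    by blast
  have inf: "infinite (UNIV :: nat set set)" by (simp add: Finite_Set.finite_set)
  have "carrier ?H \<approx> (UNIV :: nat set set)" by (rule eqpoll_free_Abelian_group_infinite[OF inf])
  moreover have "carrier ?H = UNIV" by auto
  ultimately have "|UNIV :: (nat set \<Rightarrow>\<^sub>0 int) set| \<le>o |UNIV :: nat set set|"
    by (simp add: eqpoll_iff_card_of_ordIso ordIso_imp_ordLeq)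
  then have "|(UNIV :: (nat set \<Rightarrow>\<^sub>0 int) set) \<times> (UNIV :: (nat \<Rightarrow> circle) set)| \<le>o |UNIV :: nat set set|"
    by (intro card_of_Times_ordLeq_infinite_Field) (simp_all add: inf card_fun_circle)
  then have "|Pow X - {{}}| \<le>o |UNIV :: nat set set|" using X(2) ordLeq_transitive by blast
  then have "|(Pow X - {{}}) \<union> {{}}| \<le>o |UNIV :: nat set set|"
    by (intro card_of_Un_ordLeq_infinite_Field) (simp_all add: inf card_of_singl_ordLeq)
  then have "|Pow X| \<le>o |UNIV :: nat set set|" by (simp add: insert_absorb)
  moreover have "|Pow (Field (cardSuc natLeq))| \<le>o |Pow X|"
    by (rule card_of_Pow_mono[OF cardSuc_natLeq_le_uncountable[OF X(1)]])
  ultimately show ?thesis unfolding Lusin_hypothesis_iff using ordLeq_transitive by blast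
qed

text \<open>The first uncountable cardinal as a type, since powers are represented by function
  types.\<close>

typedef omega1 = "Field (cardSuc natLeq)"
proof -
  have "Field (cardSuc natLeq) \<noteq> {}"
    using cardSuc_natLeq_uncountable by auto
  then show "\<exists>x. x \<in> Field (cardSuc natLeq)" by blast
qed

lemma omega1_eqpoll: "(UNIV :: omega1 set) \<approx> Field (cardSuc natLeq)"
  unfolding eqpoll_def
  by (rule exI[of _ Rep_omega1])
    (auto simp: bij_betw_def inj_on_def Rep_omega1_inject type_definition.Rep_range[OF type_definition_omega1])

lemma uncountable_omega1: "uncountable (UNIV :: omega1 set)"
  using cardSuc_natLeq_uncountable omega1_eqpoll by (metis eqpoll_imp_lepoll eqpoll_sym countable_lepoll)

lemma big_iff: "big C \<longleftrightarrow> |UNIV :: nat set set| \<le>o |C|"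
proof -
  have "(UNIV :: real set) \<lesssim> C \<longleftrightarrow> (UNIV :: nat set set) \<lesssim> C"
    using nat_sets_eqpoll_reals by (meson eqpoll_sym eqpoll_imp_lepoll lepoll_trans)
  then show ?thesis by (simp add: big_def lepoll_def card_of_ordLeq)
qed

text \<open>Lusin's Hypothesis enters here: it bounds the number of closed subsets of the power with
  exponent \<open>omega1\<close> by the size of \<open>S\<close>, so that points indexed by
  \<open>S\<close> can meet all the big ones.\<close>

lemma ex_independent_transversal_power:
  fixes S :: "'s set" and X :: "(nat \<Rightarrow> circle) set"
  assumes L: Lusin_hypothesis and S: "|S| =o continuum"
    and X: "closed X" "subgrp X" "torsion_free X" "X \<noteq> {0}"
  obtains B where "independent_transversal X {f :: omega1 \<Rightarrow> nat \<Rightarrow> circle. \<forall>w. f w \<in> X} S B"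
proof -
  define K where "K = {f :: omega1 \<Rightarrow> nat \<Rightarrow> circle. \<forall>w. f w \<in> X}"
  interpret uncountable_power X K
    by unfold_locales (use uncountable_omega1 X K_def in auto)
  define \<C> where "\<C> = {C. closed C \<and> C \<subseteq> K \<and> big C}"
  have S': "|S| =o |UNIV :: nat set set|" using ordIso_transitive[OF S continuum_nat_sets] .
  have natS: "|UNIV :: nat set| <o |S|"
    using card_of_set_type[where ?'a = nat] ordIso_symmetric[OF S'] ordLess_ordIso_trans by blast
  have "|\<C>| \<le>o |{C :: (omega1 \<Rightarrow> nat \<Rightarrow> circle) set. closed C}|"
    by (rule card_of_mono1) (auto simp: \<C>_def)
  also have "|{C :: (omega1 \<Rightarrow> nat \<Rightarrow> circle) set. closed C}| \<le>o |UNIV :: omega1 set set|"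
    by (rule card_closed_sets) (use uncountable_omega1 uncountable_infinite in blast)
  also have "|UNIV :: omega1 set set| \<le>o |Pow (Field (cardSuc natLeq))|"
    using card_of_Pow_mono[of "UNIV :: omega1 set" "Field (cardSuc natLeq)"] omega1_eqpoll
    by (simp add: eqpoll_iff_card_of_ordIso ordIso_imp_ordLeq)
  also have "|Pow (Field (cardSuc natLeq))| \<le>o |UNIV :: nat set set|"
    using L by (simp add: Lusin_hypothesis_iff)
  also have "|UNIV :: nat set set| \<le>o |S|" using ordIso_imp_ordLeq[OF ordIso_symmetric[OF S']] .
  finally have "|\<C>| \<le>o |S|" .
  moreover have "K \<noteq> {0}"
  proof -
    obtain x where x: "x \<in> X" "x \<noteq> 0" using X(2,4) by (auto simp: subgrp_def)
    then have "(\<lambda>_. x) \<in> K" by (simp add: K_def)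
    moreover have "(\<lambda>_::omega1. x) \<noteq> 0"
    proof
      assume "(\<lambda>_::omega1. x) = 0"
      from fun_cong[OF this, of undefined] show False using x(2) by simp
    qed
    ultimately show ?thesis by blast
  qed
  then have "K \<in> \<C>" using big_subgrp[OF closedK subgrpK] closedK by (simp add: \<C>_def)
  then have "\<C> \<noteq> {}" by blast
  moreover have "C \<subseteq> K" if "C \<in> \<C>" for C using that by (simp add: \<C>_def)
  moreover have "|S| \<le>o |C|" if "C \<in> \<C>" for C
    using that ordIso_ordLeq_trans[OF S'] unfolding \<C>_def big_iff by blast
  ultimately obtain B where B: "\<And>s. s \<in> S \<Longrightarrow> B s \<in> K" "\<And>C. C \<in> \<C> \<Longrightarrow> \<exists>s\<in>S. B s \<in> C"
    "\<And>c. Poly_Mapping.keys c \<subseteq> S \<Longrightarrow> lincomb B c = 0 \<Longrightarrow> c = 0"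
    using ex_independent_transversal[OF subgrpK torsion_freeK natS, of \<C>] by metis
  have "independent_transversal X K S B"
    by unfold_locales (use B in \<open>auto simp: \<C>_def\<close>)
  then show ?thesis using that unfolding K_def by blast
qed

theorem theorem2p11:
  fixes S :: "'s set"
  assumes "|S| =o continuum"
  defines "F \<equiv> free_Abelian_group S"
  shows
    "((\<exists>T. minimal_group_topology F T \<and> pseudocompact_space T)
        \<longleftrightarrow> Lusin_hypothesis) \<and>
     ((\<exists>T. connected_space T \<and> minimal_group_topology F T \<and> pseudocompact_space T)
        \<longleftrightarrow> Lusin_hypothesis) \<and>
     ((\<exists>T. zero_dimensional_space T \<and> minimal_group_topology F T \<and> pseudocompact_space T)
        \<longleftrightarrow> Lusin_hypothesis)"
proof -
  have Lusin: Lusin_hypothesis if "minimal_group_topology F T" "pseudocompact_space T" for T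
    using minimal_pseudocompact_imp_Lusin[OF assms(1) that[unfolded F_def]] .
  have conn: "\<exists>T. connected_space T \<and> minimal_group_topology F T \<and> pseudocompact_space T"
    if L: Lusin_hypothesis
  proof -
    have "solenoid \<noteq> {0}" using winding_solenoid winding_pi_nonzero by blast
    then obtain B where "independent_transversal solenoid {f :: omega1 \<Rightarrow> nat \<Rightarrow> circle. \<forall>w. f w \<in> solenoid} S B"
      using ex_independent_transversal_power[OF L assms(1) closed_solenoid subgrp_solenoid torsion_free_solenoid]
      by blast
    then interpret independent_transversal solenoid "{f :: omega1 \<Rightarrow> nat \<Rightarrow> circle. \<forall>w. f w \<in> solenoid}" S B .
    have "connected_space T" by (rule connected_T[OF connected_solenoid]) (rule big_open_solenoid)
    then show ?thesis unfolding F_def using minimal_T pseudocompact_T by blast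
  qed
  have zdim: "\<exists>T. zero_dimensional_space T \<and> minimal_group_topology F T \<and> pseudocompact_space T"
    if L: Lusin_hypothesis
  proof -
    obtain B where "independent_transversal solenoid0 {f :: omega1 \<Rightarrow> nat \<Rightarrow> circle. \<forall>w. f w \<in> solenoid0} S B"
      using ex_independent_transversal_power[OF L assms(1) solenoid0_props(1-4)] by blast
    then interpret independent_transversal solenoid0 "{f :: omega1 \<Rightarrow> nat \<Rightarrow> circle. \<forall>w. f w \<in> solenoid0}" S B .
    show ?thesis
      unfolding F_def using zero_dimensional_T[OF solenoid0_props(5)] minimal_T pseudocompact_T by blast
  qed
  show ?thesis using Lusin conn zdim by blast
qed

end
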